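(* Let $d\ge2$ and let $s=(s_1,\ldots,s_d)$ be the free semicircular $d$-tuple. Then $$\mathcal W^{\min}(\overline{\mathbb B}_d)\subseteq\mathfrak B\subsetneq\mathcal L\subsetneq\mathfrak B^\bullet\subseteq\mathcal W^{\max}(\overline{\mathbb B}_d),\qquad \mathcal W^{\min}(\overline{\mathbb B}_d)\subseteq\mathfrak B\subsetneq\mathcal W(s/2)\subsetneq\mathfrak B^\bullet\subseteq\mathcal W^{\max}(\overline{\mathbb B}_d),$$ and moreover $$\mathcal W(s/2)\nsubseteq\mathfrak D\qquad\text{and}\qquad\mathfrak D\nsubseteq\mathcal L.$$
   Context: $M_n=M_n(\mathbb C)$; $(M_n)^d_{\mathrm{sa}}$ is the set of $d$-tuples of selfadjoint $n\times n$ matrices; $\mathbb M^d_{\mathrm{sa}}=\bigcup_{n\ge1}(M_n)^d_{\mathrm{sa}}$ (disjoint union). A set $\mathcal S\subseteq\mathbb M^d_{\mathrm{sa}}$ with levels $\mathcal S_n=\mathcal S\cap(M_n)^d_{\mathrm{sa}}$ is matrix convex if it is closed under direct sums and under unital completely positive (UCP) maps: if $X\in\mathcal S_n$ and $\phi\colon M_n\to M_k$ is UCP, then $(\phi(X_1),\ldots,\phi(X_d))\in\mathcal S_k$. $\overline{\mathbb B}_d$ is the closed Euclidean unit ball of $\mathbb R^d$; $\mathcal W^{\min}(\overline{\mathbb B}_d)$ and $\mathcal W^{\max}(\overline{\mathbb B}_d)$ denote the smallest and the largest matrix convex subsets of $\mathbb M^d_{\mathrm{sa}}$ whose first level is $\overline{\mathbb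 B}_d$. The other sets are: $\mathfrak B=\{X\in\mathbb M^d_{\mathrm{sa}}:\sum_iX_i^2\le I\}$; $\mathfrak D=\{X\in\mathbb M^d_{\mathrm{sa}}:\sum_iX_i\otimes\overline{X}_i\le I\}$, where $\overline X_i$ is the entrywise complex conjugate; the polar dual $\mathcal S^\bullet=\{X\in\mathbb M^d_{\mathrm{sa}}:\sum_iX_i\otimes Y_i\le I\text{ for all }Y\in\mathcal S\}$. The free semicircular tuple $s$ is realized as follows: let $\mathcal F(\mathbb C^d)=\bigoplus_{n\ge0}(\mathbb C^d)^{\otimes n}$ be the full Fock space, $\Omega=1\in(\mathbb C^d)^{\otimes0}$, $e_1,\ldots,e_d$ the standard orthonormal basis of $\mathbb C^d$, and $\ell_i$ the isometry with $\ell_i\Omega=e_i$ and $\ell_i(x_1\otimes\cdots\otimes x_n)=e_i\otimes x_1\otimes\cdots\otimes x_n$; then $s_i=\ell_i+\ell_i^*$. The Lehner ball is $\mathcal L=\{X\in\mathbb M^d_{\mathrm{sa}}:\sum_iX_i\otimes\frac{s_i}2\le I\}$. The matrix range of a $d$-tuple $A\in B(\mathcal H)^d$ is $\mathcal W(A)=\bigcup_n\mathcal W_n(A)$, where $\mathcal W_n(A)=\{(\phi(A_1),\ldots,\phi(A_d)):\phi\colon B(\mathcal H)\to M_n\text{ UCP}\}$. *)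

theory Defs
  imports
    "HOL-Analysis.Analysis"
    "Jordan_Normal_Form.Schur_Decomposition"
begin

section \<open>Complex Hilbert spaces\<close>

text \<open>The inner product is linear in the first argument, as for \<open>\<bullet>c\<close> on vectors.\<close>

class complex_hilbert = real_inner + complete_space +
  fixes scaleC :: "complex \<Rightarrow> 'a \<Rightarrow> 'a"  (infixr \<open>*\<^sub>C\<close> 75)
    and cinner :: "'a \<Rightarrow> 'a \<Rightarrow> complex"
  assumes scaleC_add_right: "c *\<^sub>C (x + y) = c *\<^sub>C x + c *\<^sub>C y"
    and scaleC_add_left: "(b + c) *\<^sub>C x = b *\<^sub>C x + c *\<^sub>C x"
    and scaleC_scaleC: "b *\<^sub>C c *\<^sub>C x = (b * c) *\<^sub>C x"
    and scaleC_of_real: "of_real r *\<^sub>C x = r *\<^sub>R x"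
    and cinner_commute: "cinner x y = cnj (cinner y x)"
    and cinner_add_left: "cinner (x + y) z = cinner x z + cinner y z"
    and cinner_scaleC_left: "cinner (c *\<^sub>C x) y = c * cinner x y"
    and inner_eq_Re_cinner: "inner x y = Re (cinner x y)"

definition bounded_ops :: "('h::complex_hilbert \<Rightarrow> 'h) set" where
  "bounded_ops = {T. bounded_linear T \<and> (\<forall>c x. T (c *\<^sub>C x) = c *\<^sub>C T x)}"

definition cadjoint :: "('h::complex_hilbert \<Rightarrow> 'h) \<Rightarrow> 'h \<Rightarrow> 'h" where
  "cadjoint T = (THE S. \<forall>x y. cinner (S x) y = cinner x (T y))"

text \<open>Positivity of the operator matrix \<open>[T a b]\<close>, with \<open>a, b < m\<close>, as an operator on \<open>H\<^sup>m\<close>,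
  that is, as an element of \<open>M\<^sub>m(B(H))\<close>.\<close>

definition op_block_pos :: "nat \<Rightarrow> (nat \<Rightarrow> nat \<Rightarrow> 'h::complex_hilbert \<Rightarrow> 'h) \<Rightarrow> bool" where
  "op_block_pos m T \<longleftrightarrow> (\<forall>h :: nat \<Rightarrow> 'h. 0 \<le> (\<Sum>a<m. \<Sum>b<m. cinner (T a b (h b)) (h a)))"


section \<open>The spaces \<open>\<ell>\<^sup>2(I)\<close>\<close>

typedef 'i ell2 = "{f :: 'i \<Rightarrow> complex. (\<lambda>i. (cmod (f i))\<^sup>2) summable_on UNIV}"
  morphisms coeff2 Abs_ell2
  by (rule exI[of _ "\<lambda>_. 0"]) simp

setup_lifting type_definition_ell2

lemma ell2_add_aux:
  fixes f g :: "'i \<Rightarrow> complex"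
  assumes "(\<lambda>i. (cmod (f i))\<^sup>2) summable_on UNIV" "(\<lambda>i. (cmod (g i))\<^sup>2) summable_on UNIV"
  shows "(\<lambda>i. (cmod (f i + g i))\<^sup>2) summable_on UNIV"
proof (rule summable_on_comparison_test)
  show "(\<lambda>i. 2 * (cmod (f i))\<^sup>2 + 2 * (cmod (g i))\<^sup>2) summable_on UNIV"
    using assms by (intro summable_on_add summable_on_cmult_right)
  show "(cmod (f i + g i))\<^sup>2 \<le> 2 * (cmod (f i))\<^sup>2 + 2 * (cmod (g i))\<^sup>2" for i
  proof -
    have "(cmod (f i + g i))\<^sup>2 \<le> (cmod (f i) + cmod (g i))\<^sup>2"
      by (intro power_mono norm_triangle_ineq) auto
    also have "\<dots> \<le> 2 * (cmod (f i))\<^sup>2 + 2 * (cmod (g i))\<^sup>2"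
      using sum_squares_bound[of "cmod (f i)" "cmod (g i)"] by (simp add: power2_sum)
    finally show ?thesis .
  qed
qed auto

lemma ell2_scale_aux:
  fixes f :: "'i \<Rightarrow> complex"
  assumes "(\<lambda>i. (cmod (f i))\<^sup>2) summable_on UNIV"
  shows "(\<lambda>i. (cmod (c * f i))\<^sup>2) summable_on UNIV"
  using summable_on_cmult_right[OF assms, of "(cmod c)\<^sup>2"]
  by (simp add: norm_mult power_mult_distrib)

lemma ell2_prod_aux:
  fixes f g :: "'i \<Rightarrow> complex"
  assumes "(\<lambda>i. (cmod (f i))\<^sup>2) summable_on UNIV" "(\<lambda>i. (cmod (g i))\<^sup>2) summable_on UNIV"
  shows "(\<lambda>i. f i * cnj (g i)) summable_on UNIV"
proof (rule abs_summable_summable)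
  have "(\<lambda>i. norm (f i * cnj (g i))) summable_on UNIV"
  proof (rule summable_on_comparison_test)
    show "(\<lambda>i. (cmod (f i))\<^sup>2 + (cmod (g i))\<^sup>2) summable_on UNIV"
      using assms by (intro summable_on_add)
    show "norm (f i * cnj (g i)) \<le> (cmod (f i))\<^sup>2 + (cmod (g i))\<^sup>2" for i
    proof -
      have "2 * cmod (f i) * cmod (g i) \<le> (cmod (f i))\<^sup>2 + (cmod (g i))\<^sup>2"
        by (rule sum_squares_bound)
      moreover have "0 \<le> cmod (f i) * cmod (g i)" by simp
      ultimately show ?thesis unfolding norm_mult complex_mod_cnj by linarith
    qed
  qed auto
  then show "(\<lambda>i. norm (f i * cnj (g i))) summable_on UNIV" .
qed

lemma ell2_square_aux:
  fixes f :: "'i \<Rightarrow> complex"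
  assumes "(\<lambda>i. (cmod (f i))\<^sup>2) summable_on UNIV"
  shows "Re (\<Sum>\<^sub>\<infinity>i. f i * cnj (f i)) = (\<Sum>\<^sub>\<infinity>i. (cmod (f i))\<^sup>2)"
proof -
  have "Re (f i * cnj (f i)) = (cmod (f i))\<^sup>2" for i
    by (simp add: cmod_power2 power2_eq_square[of "Re _"] power2_eq_square[of "Im _"])
  then show ?thesis using infsum_Re[OF ell2_prod_aux[OF assms assms]] by simp
qed

instantiation ell2 :: (type) real_vector
begin

lift_definition zero_ell2 :: "'a ell2" is "\<lambda>_. 0" by simp
lift_definition plus_ell2 :: "'a ell2 \<Rightarrow> 'a ell2 \<Rightarrow> 'a ell2" is "\<lambda>f g i. f i + g i"
  by (rule ell2_add_aux)
lift_definition uminus_ell2 :: "'a ell2 \<Rightarrow> 'a ell2" is "\<lambda>f i. - f i" by simp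
lift_definition minus_ell2 :: "'a ell2 \<Rightarrow> 'a ell2 \<Rightarrow> 'a ell2" is "\<lambda>f g i. f i - g i"
  subgoal for f g using ell2_add_aux[of f "\<lambda>i. - g i"] by simp
  done
lift_definition scaleR_ell2 :: "real \<Rightarrow> 'a ell2 \<Rightarrow> 'a ell2" is "\<lambda>r f i. of_real r * f i"
  by (rule ell2_scale_aux)

instance
proof
  fix x y z :: "'a ell2" and r s :: real
  show "x + y + z = x + (y + z)" by transfer (simp add: add.assoc)
  show "x + y = y + x" by transfer (simp add: add.commute)
  show "0 + x = x" by transfer simp
  show "- x + x = 0" by transfer simp
  show "x - y = x + - y" by transfer simp
  show "r *\<^sub>R (x + y) = r *\<^sub>R x + r *\<^sub>R y" by transfer (simp add: algebra_simps)
  show "(r + s) *\<^sub>R x = r *\<^sub>R x + s *\<^sub>R x" by transfer (simp add: algebra_simps)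
  show "r *\<^sub>R s *\<^sub>R x = (r * s) *\<^sub>R x" by transfer (simp add: algebra_simps)
  show "1 *\<^sub>R x = x" by transfer simp
qed

end

instantiation ell2 :: (type) real_inner
begin

lift_definition inner_ell2 :: "'a ell2 \<Rightarrow> 'a ell2 \<Rightarrow> real"
  is "\<lambda>f g. Re (\<Sum>\<^sub>\<infinity>i. f i * cnj (g i))" .

definition norm_ell2 :: "'a ell2 \<Rightarrow> real" where "norm_ell2 x = sqrt (inner x x)"
definition dist_ell2 :: "'a ell2 \<Rightarrow> 'a ell2 \<Rightarrow> real" where "dist_ell2 x y = norm (x - y)"
definition sgn_ell2 :: "'a ell2 \<Rightarrow> 'a ell2" where "sgn_ell2 x = x /\<^sub>R norm x"
definition uniformity_ell2 :: "('a ell2 \<times> 'a ell2) filter" where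
  "uniformity_ell2 = (INF e\<in>{0<..}. principal {(x, y). dist x y < e})"
definition open_ell2 :: "'a ell2 set \<Rightarrow> bool" where
  "open_ell2 U \<longleftrightarrow> (\<forall>x\<in>U. eventually (\<lambda>(x', y). x' = x \<longrightarrow> y \<in> U) uniformity)"

instance
proof
  fix x y z :: "'a ell2" and r s :: real
  show "sgn x = x /\<^sub>R norm x" by (rule sgn_ell2_def)
  show "dist x y = norm (x - y)" by (rule dist_ell2_def)
  show "uniformity = (INF e\<in>{0<..}. principal {(x, y :: 'a ell2). dist x y < e})"
    by (rule uniformity_ell2_def)
  show "open U \<longleftrightarrow> (\<forall>x\<in>U. eventually (\<lambda>(x', y). x' = x \<longrightarrow> y \<in> U) uniformity)"
    for U :: "'a ell2 set" by (rule open_ell2_def)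
  show "norm x = sqrt (inner x x)" by (rule norm_ell2_def)
  show "inner x y = inner y x"
  proof transfer
    fix f g :: "'a \<Rightarrow> complex"
    have "(\<Sum>\<^sub>\<infinity>i. f i * cnj (g i)) = cnj (\<Sum>\<^sub>\<infinity>i. g i * cnj (f i))"
      by (subst infsum_cnj[symmetric]) (simp add: mult.commute)
    then show "Re (\<Sum>\<^sub>\<infinity>i. f i * cnj (g i)) = Re (\<Sum>\<^sub>\<infinity>i. g i * cnj (f i))" by simp
  qed
  show "inner (x + y) z = inner x z + inner y z"
    by transfer (simp add: distrib_right infsum_add ell2_prod_aux)
  show "inner (r *\<^sub>R x) y = r * inner x y"
    by transfer (simp add: mult.assoc infsum_cmult_right')
  show "0 \<le> inner x x"
    by transfer (simp only: ell2_square_aux mem_Collect_eq, intro infsum_nonneg, simp)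
  show "inner x x = 0 \<longleftrightarrow> x = 0"
  proof transfer
    fix f :: "'a \<Rightarrow> complex"
    assume f: "(\<lambda>i. (cmod (f i))\<^sup>2) summable_on UNIV"
    have "f = (\<lambda>_. 0)" if "(\<Sum>\<^sub>\<infinity>i. (cmod (f i))\<^sup>2) = 0"
      using nonneg_infsum_le_0D[of "\<lambda>i. (cmod (f i))\<^sup>2" UNIV] f that by auto
    then show "(Re (\<Sum>\<^sub>\<infinity>i. f i * cnj (f i)) = 0) = (f = (\<lambda>_. 0))"
      using ell2_square_aux[OF f] by auto
  qed
qed

end

lemma ell2_norm_sq: "(norm x)\<^sup>2 = (\<Sum>\<^sub>\<infinity>i. (cmod (coeff2 x i))\<^sup>2)"
proof -
  have "(norm x)\<^sup>2 = inner x x" by (simp add: dot_square_norm)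
  also have "\<dots> = (\<Sum>\<^sub>\<infinity>i. (cmod (coeff2 x i))\<^sup>2)"
    by transfer (simp add: ell2_square_aux)
  finally show ?thesis .
qed

lemma ell2_summable: "(\<lambda>i. (cmod (coeff2 x i))\<^sup>2) summable_on UNIV"
  using coeff2[of x] by simp

lemma ell2_sum_le_norm:
  assumes "finite F"
  shows "(\<Sum>i\<in>F. (cmod (coeff2 x i))\<^sup>2) \<le> (norm x)\<^sup>2"
  unfolding ell2_norm_sq by (rule finite_sum_le_infsum[OF ell2_summable assms]) auto

instance ell2 :: (type) complete_space
proof
  fix X :: "nat \<Rightarrow> 'a ell2"
  assume cau: "Cauchy X"
  have "convergent (\<lambda>n. coeff2 (X n) i)" for i
  proof -
    have "Cauchy (\<lambda>n. coeff2 (X n) i)"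
    proof (rule metric_CauchyI)
      fix e :: real assume "0 < e"
      then obtain M where M: "\<And>m n. m \<ge> M \<Longrightarrow> n \<ge> M \<Longrightarrow> dist (X m) (X n) < e"
        using metric_CauchyD[OF cau] by blast
      have "dist (coeff2 (X m) i) (coeff2 (X n) i) < e" if "m \<ge> M" "n \<ge> M" for m n
      proof -
        have "(cmod (coeff2 (X m - X n) i))\<^sup>2 \<le> (norm (X m - X n))\<^sup>2"
          using ell2_sum_le_norm[of "{i}" "X m - X n"] by simp
        then have "cmod (coeff2 (X m) i - coeff2 (X n) i) \<le> norm (X m - X n)"
          by (simp add: minus_ell2.rep_eq)
        then show ?thesis using M[OF that] by (simp add: dist_norm)
      qed
      then show "\<exists>M. \<forall>m\<ge>M. \<forall>n\<ge>M. dist (coeff2 (X m) i) (coeff2 (X n) i) < e" by blast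
    qed
    then show ?thesis by (simp add: Cauchy_convergent_iff)
  qed
  then obtain f where f: "\<And>i. (\<lambda>n. coeff2 (X n) i) \<longlonglongrightarrow> f i"
    unfolding convergent_def by metis
  have fin: "(\<Sum>i\<in>F. (cmod (coeff2 (X m) i - f i))\<^sup>2) \<le> e\<^sup>2"
    if "finite F" "\<And>n. n \<ge> M \<Longrightarrow> dist (X m) (X n) < e" for F m M e
  proof (rule tendsto_upperbound)
    show "(\<lambda>n. \<Sum>i\<in>F. (cmod (coeff2 (X m) i - coeff2 (X n) i))\<^sup>2)
        \<longlonglongrightarrow> (\<Sum>i\<in>F. (cmod (coeff2 (X m) i - f i))\<^sup>2)"
      by (intro tendsto_intros f)
    show "\<forall>\<^sub>F n in sequentially. (\<Sum>i\<in>F. (cmod (coeff2 (X m) i - coeff2 (X n) i))\<^sup>2) \<le> e\<^sup>2"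
    proof (rule eventually_sequentiallyI[of M])
      fix n assume n: "n \<ge> M"
      have "(\<Sum>i\<in>F. (cmod (coeff2 (X m) i - coeff2 (X n) i))\<^sup>2) \<le> (norm (X m - X n))\<^sup>2"
        using ell2_sum_le_norm[OF that(1), of "X m - X n"] by (simp add: minus_ell2.rep_eq)
      also have "\<dots> \<le> e\<^sup>2"
        using that(2)[OF n] by (intro power_mono) (auto simp: dist_norm)
      finally show "(\<Sum>i\<in>F. (cmod (coeff2 (X m) i - coeff2 (X n) i))\<^sup>2) \<le> e\<^sup>2" .
    qed
  qed simp
  have summ: "(\<lambda>i. (cmod (coeff2 (X m) i - f i))\<^sup>2) summable_on UNIV"
    and le: "(\<Sum>\<^sub>\<infinity>i. (cmod (coeff2 (X m) i - f i))\<^sup>2) \<le> e\<^sup>2"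
    if "\<And>n. n \<ge> M \<Longrightarrow> dist (X m) (X n) < e" for m M e
  proof -
    show s: "(\<lambda>i. (cmod (coeff2 (X m) i - f i))\<^sup>2) summable_on UNIV"
      using fin[OF _ that]
      by (intro nonneg_bdd_above_summable_on) (auto intro!: bdd_aboveI[of _ "e\<^sup>2"])
    show "(\<Sum>\<^sub>\<infinity>i. (cmod (coeff2 (X m) i - f i))\<^sup>2) \<le> e\<^sup>2"
      using fin[OF _ that] by (intro infsum_le_finite_sums[OF s]) auto
  qed
  have "\<exists>M. \<forall>m\<ge>M. \<forall>n\<ge>M. dist (X m) (X n) < 1"
    by (rule metric_CauchyD[OF cau]) simp
  then obtain M1 where M1: "\<And>m n. m \<ge> M1 \<Longrightarrow> n \<ge> M1 \<Longrightarrow> dist (X m) (X n) < 1"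
    by blast
  have "(\<lambda>i. (cmod (coeff2 (X M1) i - f i))\<^sup>2) summable_on UNIV"
    by (rule summ[where M = M1 and e = 1], rule M1[OF order_refl])
  then have "(\<lambda>i. (cmod (coeff2 (X M1) i + - (coeff2 (X M1) i - f i)))\<^sup>2) summable_on UNIV"
    by (intro ell2_add_aux[OF ell2_summable]) (simp only: norm_minus_cancel)
  then have fs: "(\<lambda>i. (cmod (f i))\<^sup>2) summable_on UNIV" by simp
  define x where "x = Abs_ell2 f"
  have x: "coeff2 x = f" unfolding x_def using fs by (simp add: Abs_ell2_inverse)
  have "X \<longlonglongrightarrow> x"
  proof (rule metric_LIMSEQ_I)
    fix r :: real assume r: "0 < r"
    have "\<exists>M. \<forall>m\<ge>M. \<forall>n\<ge>M. dist (X m) (X n) < r / 2"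
      by (rule metric_CauchyD[OF cau]) (simp add: r)
    then obtain M where M: "\<And>m n. m \<ge> M \<Longrightarrow> n \<ge> M \<Longrightarrow> dist (X m) (X n) < r / 2"
      by blast
    have "dist (X m) x < r" if "m \<ge> M" for m
    proof -
      have "(norm (X m - x))\<^sup>2 \<le> (r / 2)\<^sup>2"
        unfolding ell2_norm_sq minus_ell2.rep_eq x
        by (rule le[where M = M], rule M[OF that])
      then have "norm (X m - x) \<le> r / 2" by (rule power2_le_imp_le) (use r in simp)
      then show ?thesis using r by (simp add: dist_norm)
    qed
    then show "\<exists>no. \<forall>n\<ge>no. dist (X n) x < r" by blast
  qed
  then show "convergent X" by (auto simp: convergent_def)
qed

instantiation ell2 :: (type) complex_hilbert
begin

lift_definition scaleC_ell2 :: "complex \<Rightarrow> 'a ell2 \<Rightarrow> 'a ell2" is "\<lambda>c f i. c * f i"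
  by (rule ell2_scale_aux)
lift_definition cinner_ell2 :: "'a ell2 \<Rightarrow> 'a ell2 \<Rightarrow> complex"
  is "\<lambda>f g. \<Sum>\<^sub>\<infinity>i. f i * cnj (g i)" .

instance
proof
  fix x y z :: "'a ell2" and b c :: complex and r :: real
  show "c *\<^sub>C (x + y) = c *\<^sub>C x + c *\<^sub>C y" by transfer (simp add: algebra_simps)
  show "(b + c) *\<^sub>C x = b *\<^sub>C x + c *\<^sub>C x" by transfer (simp add: algebra_simps)
  show "b *\<^sub>C c *\<^sub>C x = (b * c) *\<^sub>C x" by transfer (simp add: algebra_simps)
  show "of_real r *\<^sub>C x = r *\<^sub>R x" by transfer simp
  show "cinner x y = cnj (cinner y x)"
    by transfer (subst infsum_cnj[symmetric], simp add: mult.commute)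
  show "cinner (x + y) z = cinner x z + cinner y z"
    by transfer (simp add: distrib_right infsum_add ell2_prod_aux)
  show "cinner (c *\<^sub>C x) y = c * cinner x y"
    by transfer (simp add: mult.assoc infsum_cmult_right')
  show "inner x y = Re (cinner x y)" by transfer simp
qed

end


section \<open>The free semicircular tuple on the full Fock space\<close>

text \<open>The words of length \<open>n\<close> over \<open>'d\<close> index the orthonormal basis
  \<open>e\<^bsub>w\<^sub>1\<^esub> \<otimes> \<dots> \<otimes> e\<^bsub>w\<^sub>n\<^esub>\<close> of \<open>(\<complex>\<^sup>d)\<close> tensored \<open>n\<close> times with itself. So the full Fock space
  is \<open>\<ell>\<^sup>2\<close> over all words, with the vacuum vector at the empty word.\<close>

type_synonym 'd fock = "'d list ell2"

lift_definition fock_basis :: "'d list \<Rightarrow> 'd fock" is "\<lambda>w v. if v = w then 1 else 0"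
proof -
  fix w :: "'d list"
  have "(\<lambda>v. (cmod (if v = w then 1 else 0))\<^sup>2) summable_on {w}" by simp
  moreover have "(\<lambda>v. (cmod (if v = w then 1 else 0))\<^sup>2) summable_on {w} \<longleftrightarrow>
      (\<lambda>v. (cmod (if v = w then 1 else 0))\<^sup>2) summable_on UNIV"
    by (rule summable_on_cong_neutral) auto
  ultimately have "(\<lambda>v. (cmod (if v = w then 1 else 0))\<^sup>2) summable_on UNIV" by blast
  then show "(\<lambda>v. (cmod (if v = w then 1 else 0))\<^sup>2) summable_on UNIV" .
qed

lift_definition creation :: "'d \<Rightarrow> 'd fock \<Rightarrow> 'd fock"
  is "\<lambda>i f w. case w of [] \<Rightarrow> 0 | j # v \<Rightarrow> if j = i then f v else 0"
proof -
  fix i :: 'd and f :: "'d list \<Rightarrow> complex"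
  let ?g = "\<lambda>w. case w of [] \<Rightarrow> 0 | j # v \<Rightarrow> if j = i then f v else 0"
  assume "(\<lambda>w. (cmod (f w))\<^sup>2) summable_on UNIV"
  then have "((\<lambda>w. (cmod (?g w))\<^sup>2) \<circ> (\<lambda>v. i # v)) summable_on UNIV" by (simp add: o_def)
  then have "(\<lambda>w. (cmod (?g w))\<^sup>2) summable_on range (\<lambda>v. i # v)"
    by (subst summable_on_reindex) (auto simp: inj_on_def)
  moreover have "(\<lambda>w. (cmod (?g w))\<^sup>2) summable_on range (\<lambda>v. i # v) \<longleftrightarrow>
      (\<lambda>w. (cmod (?g w))\<^sup>2) summable_on UNIV"
    by (rule summable_on_cong_neutral) (auto split: list.splits)
  ultimately have "(\<lambda>w. (cmod (?g w))\<^sup>2) summable_on UNIV" by blast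
  then show "(\<lambda>w. (cmod (?g w))\<^sup>2) summable_on UNIV" .
qed

lemma creation_fock_basis: "creation i (fock_basis w) = fock_basis (i # w)"
  by transfer (auto simp: fun_eq_iff split: list.splits)

definition semicircular :: "'d \<Rightarrow> 'd fock \<Rightarrow> 'd fock" where
  "semicircular i = (\<lambda>x. creation i x + cadjoint (creation i) x)"

text \<open>The adjoint used in the definition exists, and acts by removing the first letter:\<close>

lift_definition annihilation :: "'d \<Rightarrow> 'd fock \<Rightarrow> 'd fock" is "\<lambda>i f w. f (i # w)"
proof -
  fix i :: 'd and f :: "'d list \<Rightarrow> complex"
  assume "(\<lambda>w. (cmod (f w))\<^sup>2) summable_on UNIV"
  then have "(\<lambda>w. (cmod (f w))\<^sup>2) summable_on range (\<lambda>v. i # v)"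
    by (rule summable_on_subset_banach) auto
  then have "((\<lambda>w. (cmod (f w))\<^sup>2) \<circ> (\<lambda>v. i # v)) summable_on UNIV"
    by (subst (asm) summable_on_reindex) (auto simp: inj_on_def)
  then show "(\<lambda>w. (cmod (f (i # w)))\<^sup>2) summable_on UNIV"
    by (simp add: o_def)
qed

lemma cadjoint_eqI:
  fixes T :: "'h::complex_hilbert \<Rightarrow> 'h"
  assumes "\<And>x y. cinner (S x) y = cinner x (T y)"
  shows "cadjoint T = S"
  unfolding cadjoint_def
proof (rule the_equality)
  show "\<forall>x y. cinner (S x) y = cinner x (T y)" using assms by blast
  fix S' assume S': "\<forall>x y. cinner (S' x) y = cinner x (T y)"
  show "S' = S"
  proof
    fix x
    have "inner (S' x) y = inner (S x) y" for y
      using S' assms by (simp add: inner_eq_Re_cinner)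
    then show "S' x = S x" using vector_eq_rdot[of "S' x" "S x"] by blast
  qed
qed

lemma cadjoint_creation: "cadjoint (creation i) = annihilation i"
proof (rule cadjoint_eqI)
  show "cinner (annihilation i x) y = cinner x (creation i y)" for x y
  proof transfer
    fix i :: 'a and f g :: "'a list \<Rightarrow> complex"
    let ?h = "\<lambda>w. f w * cnj (case w of [] \<Rightarrow> 0 | j # v \<Rightarrow> if j = i then g v else 0)"
    have "(\<Sum>\<^sub>\<infinity>w. ?h w) = infsum ?h (range (\<lambda>v. i # v))"
      by (rule infsum_cong_neutral) (auto split: list.splits)
    also have "\<dots> = infsum (?h \<circ> (\<lambda>v. i # v)) UNIV"
      by (rule infsum_reindex) (auto simp: inj_on_def)
    finally show "(\<Sum>\<^sub>\<infinity>w. f (i # w) * cnj (g w)) = (\<Sum>\<^sub>\<infinity>w. ?h w)" by (simp add: o_def)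
  qed
qed


section \<open>Positive matrices, tensor products and UCP maps\<close>

text \<open>The order on \<^typ>\<open>complex\<close> is that of \<^theory>\<open>HOL-Library.Complex_Order\<close>:
  \<open>0 \<le> z\<close> says that \<open>z\<close> is real and nonnegative. Over the complex numbers
  this forces \<open>A\<close> to be selfadjoint.\<close>

definition psd :: "complex mat \<Rightarrow> bool" where
  "psd A \<longleftrightarrow> square_mat A \<and> (\<forall>v \<in> carrier_vec (dim_row A). 0 \<le> (A *\<^sub>v v) \<bullet>c v)"

definition le_id :: "complex mat \<Rightarrow> bool" where
  "le_id A \<longleftrightarrow> psd (1\<^sub>m (dim_row A) - A)"

definition block_mat :: "nat \<Rightarrow> nat \<Rightarrow> (nat \<Rightarrow> nat \<Rightarrow> complex mat) \<Rightarrow> complex mat" where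
  "block_mat m n T =
     mat (m * n) (m * n) (\<lambda>(i, j). T (i div n) (j div n) $$ (i mod n, j mod n))"

text \<open>The Kronecker product of square matrices.\<close>

definition kron :: "complex mat \<Rightarrow> complex mat \<Rightarrow> complex mat"  (infixl \<open>\<otimes>\<^sub>k\<close> 70) where
  "A \<otimes>\<^sub>k B = block_mat (dim_row A) (dim_row B) (\<lambda>a b. A $$ (a, b) \<cdot>\<^sub>m B)"

definition tuple_sum :: "nat \<Rightarrow> ('d::finite \<Rightarrow> complex mat) \<Rightarrow> complex mat" where
  "tuple_sum n A = mat n n (\<lambda>p. \<Sum>i\<in>UNIV. A i $$ p)"

definition ucp_mat :: "nat \<Rightarrow> nat \<Rightarrow> (complex mat \<Rightarrow> complex mat) \<Rightarrow> bool" where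
  "ucp_mat n k \<phi> \<longleftrightarrow>
     (\<forall>A \<in> carrier_mat n n. \<phi> A \<in> carrier_mat k k) \<and>
     (\<forall>A \<in> carrier_mat n n. \<forall>B \<in> carrier_mat n n. \<phi> (A + B) = \<phi> A + \<phi> B) \<and>
     (\<forall>c. \<forall>A \<in> carrier_mat n n. \<phi> (c \<cdot>\<^sub>m A) = c \<cdot>\<^sub>m \<phi> A) \<and>
     \<phi> (1\<^sub>m n) = 1\<^sub>m k \<and>
     (\<forall>m T. (\<forall>a<m. \<forall>b<m. T a b \<in> carrier_mat n n) \<and> psd (block_mat m n T)
        \<longrightarrow> psd (block_mat m k (\<lambda>a b. \<phi> (T a b))))"

definition ucp_op :: "nat \<Rightarrow> (('h::complex_hilbert \<Rightarrow> 'h) \<Rightarrow> complex mat) \<Rightarrow> bool" where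
  "ucp_op k \<phi> \<longleftrightarrow>
     (\<forall>S \<in> bounded_ops. \<phi> S \<in> carrier_mat k k) \<and>
     (\<forall>S \<in> bounded_ops. \<forall>T \<in> bounded_ops. \<phi> (\<lambda>x. S x + T x) = \<phi> S + \<phi> T) \<and>
     (\<forall>c. \<forall>S \<in> bounded_ops. \<phi> (\<lambda>x. c *\<^sub>C S x) = c \<cdot>\<^sub>m \<phi> S) \<and>
     \<phi> (\<lambda>x. x) = 1\<^sub>m k \<and>
     (\<forall>m T. (\<forall>a<m. \<forall>b<m. T a b \<in> bounded_ops) \<and> op_block_pos m T
        \<longrightarrow> psd (block_mat m k (\<lambda>a b. \<phi> (T a b))))"


section \<open>Matrix convex sets\<close>

definition msa_level :: "nat \<Rightarrow> ('d::finite \<Rightarrow> complex mat) set" where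
  "msa_level n = {X. \<forall>i. X i \<in> carrier_mat n n \<and> mat_adjoint (X i) = X i}"

definition msa :: "('d::finite \<Rightarrow> complex mat) set" where
  "msa = (\<Union>n\<in>{1..}. msa_level n)"

definition mat_dsum :: "complex mat \<Rightarrow> complex mat \<Rightarrow> complex mat" where
  "mat_dsum A B =
     four_block_mat A (0\<^sub>m (dim_row A) (dim_col B)) (0\<^sub>m (dim_row B) (dim_col A)) B"

definition matrix_convex :: "('d::finite \<Rightarrow> complex mat) set \<Rightarrow> bool" where
  "matrix_convex S \<longleftrightarrow>
     S \<subseteq> msa \<and>
     (\<forall>X \<in> S. \<forall>Y \<in> S. (\<lambda>i. mat_dsum (X i) (Y i)) \<in> S) \<and>
     (\<forall>n\<ge>1. \<forall>k\<ge>1. \<forall>X \<in> S \<inter> msa_level n. \<forall>\<phi>. ucp_mat n k \<phi> \<longrightarrow> (\<lambda>i. \<phi> (X i)) \<in> S)"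

definition scalar_tuple :: "real ^ 'd \<Rightarrow> 'd::finite \<Rightarrow> complex mat" where
  "scalar_tuple x = (\<lambda>i. mat 1 1 (\<lambda>_. complex_of_real (vec_nth x i)))"

definition Wmin :: "(real ^ 'd) set \<Rightarrow> ('d::finite \<Rightarrow> complex mat) set" where
  "Wmin C = (LEAST S. matrix_convex S \<and> S \<inter> msa_level 1 = scalar_tuple ` C)"

definition Wmax :: "(real ^ 'd) set \<Rightarrow> ('d::finite \<Rightarrow> complex mat) set" where
  "Wmax C = (GREATEST S. matrix_convex S \<and> S \<inter> msa_level 1 = scalar_tuple ` C)"

definition polar_dual :: "('d::finite \<Rightarrow> complex mat) set \<Rightarrow> ('d \<Rightarrow> complex mat) set" where
  "polar_dual S = {X \<in> msa. \<forall>Y \<in> S. \<forall>n m. X \<in> msa_level n \<and> Y \<in> msa_level m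
     \<longrightarrow> le_id (tuple_sum (n * m) (\<lambda>i. X i \<otimes>\<^sub>k Y i))}"

definition matrix_range ::
    "('d::finite \<Rightarrow> 'h::complex_hilbert \<Rightarrow> 'h) \<Rightarrow> ('d \<Rightarrow> complex mat) set" where
  "matrix_range A = (\<Union>n\<in>{1..}. {(\<lambda>i. \<phi> (A i)) | \<phi>. ucp_op n \<phi>})"


section \<open>The matrix balls\<close>

definition ball_B :: "('d::finite \<Rightarrow> complex mat) set" where
  "ball_B = {X \<in> msa. \<forall>n. X \<in> msa_level n \<longrightarrow> le_id (tuple_sum n (\<lambda>i. X i * X i))}"

definition ball_D :: "('d::finite \<Rightarrow> complex mat) set" where
  "ball_D = {X \<in> msa. \<forall>n. X \<in> msa_level n
     \<longrightarrow> le_id (tuple_sum (n * n) (\<lambda>i. X i \<otimes>\<^sub>k map_mat cnj (X i)))}"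

definition half_semicircular :: "'d \<Rightarrow> 'd fock \<Rightarrow> 'd fock" where
  "half_semicircular i = (\<lambda>x. semicircular i x /\<^sub>R 2)"

text \<open>\<open>X\<^sub>i \<otimes> T\<close> is the operator matrix with the entries \<open>X\<^sub>i $$ (a, b) *\<^sub>C T\<close>.\<close>

definition Lehner_ball :: "('d::finite \<Rightarrow> complex mat) set" where
  "Lehner_ball = {X \<in> msa. \<forall>n. X \<in> msa_level n \<longrightarrow>
     op_block_pos n (\<lambda>a b h. (if a = b then h else 0)
       - (\<Sum>i\<in>UNIV. X i $$ (a, b) *\<^sub>C half_semicircular i h))}"

end

theory Submission
  imports Defs
begin

text \<open>Everything rests on two inclusions. First, \<open>B \<subseteq> L\<close>: for \<open>X \<in> B\<close> the operator
  \<open>\<Sum> X\<^sub>i \<otimes> l\<^sub>i\<close> is a contraction because the creation operators \<open>l\<^sub>i\<close> have orthogonal ranges, and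
  \<open>\<Sum> X\<^sub>i \<otimes> s\<^sub>i / 2\<close> is its real part. Secondly, \<open>B \<subseteq> W(s/2)\<close>, since \<open>W(s/2)\<close> contains the
  real part of every row contraction \<open>C\<close>: after dilating \<open>C\<close> to a coisometric row, the vectors
  \<open>\<Sum> e\<^sub>w \<otimes> C\<^sub>w\<^sup>* x\<close> over the words \<open>w\<close> of length less than \<open>N\<close>, divided by the square root of
  \<open>N\<close>, define vector functionals that carry \<open>l\<^sub>i\<close> to \<open>(1 - 1 / N) C\<^sub>i\<close>, and a Banach limit of these
  is a UCP map. A UCP map applied to the defining inequality of \<open>L\<close> gives
  \<open>\<Sum> X\<^sub>i \<otimes> Y\<^sub>i \<le> I\<close> for \<open>X \<in> L\<close> and \<open>Y \<in> W(s/2)\<close>; with the two inclusions this puts both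
  \<open>L\<close> and \<open>W(s/2)\<close> into the polar dual of \<open>B\<close>, and it also detects the failure of membership in
  the explicit examples that separate the sets.\<close>

text \<open>A coisometric row satisfies \<open>sum C_w C_w^* = I\<close> over the words
  \<open>w\<close> of each fixed length. This makes the averaged vectors exactly orthonormal and the
  functionals unital. The factor \<open>1 - 1/N\<close> is the loss at the top level, which creation
  pushes out of the average. It disappears only in the limit, and since a UCP map must be defined on
  all bounded operators, one limit has to serve all bounded sequences at once. The dilation takes
  two letters, one for the defect and one for the added summand; this is where \<open>d >= 2\<close>
  enters the inclusion of \<open>B\<close> in \<open>W(s/2)\<close>. The separations come from rows
  that are not selfadjoint: the matrix units \<open>E_00, E_10\<close> form a coisometry, yet the
  squares of their real parts add up to \<open>diag(5/4, 1/4)\<close>. Nonmembership in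
  \<open>L\<close> is witnessed by an element of \<open>W(s/2)\<close> for which the pairing fails,
  and conversely. The arrow tuple is built so that pairing with it says that the sum of two squares
  is at most \<open>I\<close>; hence it lies in the polar dual of \<open>B\<close>, and an element
  of \<open>L\<close> outside \<open>B\<close> keeps it out of \<open>W(s/2)\<close>.\<close>

lemma complex_nonneg_iff: "0 \<le> z \<longleftrightarrow> 0 \<le> Re z \<and> Im z = 0"
  by (auto simp: less_eq_complex_def)

lemma complex_nonneg_of_real: "0 \<le> z \<Longrightarrow> z = of_real (Re z)"
  by (simp add: complex_nonneg_iff complex_eq_iff)

text \<open>A limit point of the evaluation functionals in a product of discs, which is compact by Tychonoff.\<close>

lemma Banach_limit_exists:
  obtains Lim :: "(nat \<Rightarrow> complex) \<Rightarrow> complex" where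
    "\<And>f g. bounded (range f) \<Longrightarrow> bounded (range g) \<Longrightarrow> Lim (\<lambda>n. f n + g n) = Lim f + Lim g"
    "\<And>c f. bounded (range f) \<Longrightarrow> Lim (\<lambda>n. c * f n) = c * Lim f"
    "\<And>f l. f \<longlonglongrightarrow> l \<Longrightarrow> Lim f = l"
    "\<And>f. bounded (range f) \<Longrightarrow> (\<And>n. 0 \<le> f n) \<Longrightarrow> 0 \<le> Lim f"
proof -
  define R where "R f = (SOME b. \<forall>n. cmod (f n) \<le> b)" for f :: "nat \<Rightarrow> complex"
  have R: "cmod (f n) \<le> R f" if "bounded (range f)" for f n
  proof -
    have "\<exists>b. \<forall>n. cmod (f n) \<le> b" using that by (auto simp: bounded_iff)
    then have "\<forall>n. cmod (f n) \<le> R f" unfolding R_def by (rule someI_ex)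
    then show ?thesis ..
  qed
  \<comment> \<open>An unbounded sequence has no disc; its factor is the singleton of 0, and
    \<open>ev\<close> evaluates it to 0.\<close>
  define K where "K = (PiE UNIV (\<lambda>f. if bounded (range f) then cball 0 (R f) else {0 :: complex}))"
  have "compactin (product_topology (\<lambda>_. euclidean) UNIV) K"
    unfolding K_def compactin_PiE by auto
  then have "compact K" by (simp add: euclidean_product_topology)
  define ev where "ev n f = (if bounded (range f) then f n else 0)" for n and f :: "nat \<Rightarrow> complex"
  have evK: "ev n \<in> K" for n using R by (auto simp: K_def ev_def)
  let ?F = "filtermap ev sequentially"
  have "?F \<noteq> bot" by (simp add: filtermap_bot_iff)
  moreover have "eventually (\<lambda>x. x \<in> K) ?F" by (simp add: eventually_filtermap evK)
  ultimately obtain Lim where Lim: "inf (nhds Lim) ?F \<noteq> bot"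
    using \<open>compact K\<close> unfolding compact_filter by blast
  \<comment> \<open>Each of the required properties is a closed condition on finitely many
    coordinates, or an intersection of such conditions, and therefore passes from the evaluations
    \<open>ev n\<close> to their cluster point.\<close>
  have cl: "Lim \<in> C" if "closed C" "eventually (\<lambda>n. ev n \<in> C) sequentially" for C
  proof (rule ccontr)
    assume "Lim \<notin> C"
    then have "eventually (\<lambda>x. x \<in> - C) (nhds Lim)"
      using that(1) by (intro eventually_nhds_in_open) auto
    moreover have "eventually (\<lambda>x. x \<in> C) ?F" using that(2) by (simp add: eventually_filtermap)
    ultimately have "eventually (\<lambda>x. False) (inf (nhds Lim) ?F)"
      unfolding eventually_inf by (intro exI conjI) (assumption | auto)+
    with Lim show False by (simp add: trivial_limit_def)
  qed
  have cont: "continuous_on UNIV (\<lambda>x. x f)" for f :: "nat \<Rightarrow> complex"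
    by simp
  show ?thesis
  proof
    show "Lim (\<lambda>n. f n + g n) = Lim f + Lim g"
      if "bounded (range f)" "bounded (range g)" for f g
    proof -
      have "bounded (range (\<lambda>n. f n + g n))"
        using bounded_plus_comp[of f UNIV g] that by simp
      then have "Lim \<in> {x. x (\<lambda>n. f n + g n) = x f + x g}" using that
        by (intro cl closed_Collect_eq continuous_intros cont) (auto simp: ev_def)
      then show ?thesis by simp
    qed
    show "Lim (\<lambda>n. c * f n) = c * Lim f" if "bounded (range f)" for c f
    proof -
      have "bounded (range (\<lambda>n. c * f n))"
        using bounded_linear_image[OF that bounded_linear_mult_right[of c]]
        by (simp add: image_image)
      then have "Lim \<in> {x. x (\<lambda>n. c * f n) = c * x f}" using that
        by (intro cl closed_Collect_eq continuous_intros cont) (auto simp: ev_def)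
      then show ?thesis by simp
    qed
    show "Lim f = l" if "f \<longlonglongrightarrow> l" for f l
    proof -
      have b: "bounded (range f)" using that by (intro convergent_imp_bounded)
      have "cmod (Lim f - l) \<le> e" if "e > 0" for e
      proof -
        have "eventually (\<lambda>n. cmod (f n - l) \<le> e) sequentially"
          using tendstoD[OF \<open>f \<longlonglongrightarrow> l\<close> that]
          by (rule eventually_mono) (simp add: dist_norm)
        then have "Lim \<in> {x. cmod (x f - l) \<le> e}"
          by (intro cl closed_Collect_le continuous_intros cont) (auto simp: ev_def b)
        then show ?thesis by simp
      qed
      then have "cmod (Lim f - l) \<le> 0" by (rule field_le_epsilon[where y = 0, simplified])
      then show ?thesis by simp
    qed
    show "0 \<le> Lim f" if "bounded (range f)" "\<And>n. 0 \<le> f n" for f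
    proof -
      have "Lim \<in> {x. 0 \<le> Re (x f)}" using that
        by (intro cl closed_Collect_le continuous_intros cont)
           (auto simp: ev_def complex_nonneg_iff)
      moreover have "Lim \<in> {x. 0 = Im (x f)}" using that
        by (intro cl closed_Collect_eq continuous_intros cont)
           (auto simp: ev_def complex_nonneg_iff)
      ultimately show ?thesis by (simp add: complex_nonneg_iff)
    qed
  qed
qed

section \<open>Positive forms\<close>

text \<open>This is \<open><P h, h>\<close> with matrices and vectors as bare functions on
  \<open>nat\<close>. Only indices below \<open>m\<close> count, so no carrier conditions
  arise.\<close>

definition form :: "nat \<Rightarrow> (nat \<Rightarrow> nat \<Rightarrow> complex) \<Rightarrow> (nat \<Rightarrow> complex) \<Rightarrow> complex" where
  "form m P h = (\<Sum>a<m. \<Sum>b<m. P a b * h b * cnj (h a))"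

definition pos_form :: "nat \<Rightarrow> (nat \<Rightarrow> nat \<Rightarrow> complex) \<Rightarrow> bool" where
  "pos_form m P \<longleftrightarrow> (\<forall>h. 0 \<le> form m P h)"

lemma pos_formD: "pos_form m P \<Longrightarrow> 0 \<le> form m P h"
  by (simp add: pos_form_def)

lemma form_supported:
  assumes "A \<subseteq> {..<m}" "\<And>a. a \<notin> A \<Longrightarrow> h a = 0"
  shows "form m P h = (\<Sum>a\<in>A. \<Sum>b\<in>A. P a b * h b * cnj (h a))"
proof -
  have "form m P h = (\<Sum>a\<in>A. \<Sum>b<m. P a b * h b * cnj (h a))"
    unfolding form_def by (rule sum.mono_neutral_right) (use assms in auto)
  also have "\<dots> = (\<Sum>a\<in>A. \<Sum>b\<in>A. P a b * h b * cnj (h a))"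
    by (rule sum.cong[OF refl], rule sum.mono_neutral_right) (use assms in auto)
  finally show ?thesis .
qed

lemma pos_form_diag:
  assumes "pos_form m P" "a < m"
  shows "0 \<le> P a a"
proof -
  have "form m P (\<lambda>c. if c = a then 1 else 0) = P a a"
    by (subst form_supported[of "{a}"]) (use assms in auto)
  then show ?thesis using pos_formD[OF assms(1)] by (rule subst)
qed

lemma pos_form_pair:
  assumes "pos_form m P" "a < m" "b < m" "a \<noteq> b"
  shows "0 \<le> P a a * (x * cnj x) + P a b * y * cnj x + P b a * x * cnj y + P b b * (y * cnj y)"
proof -
  have "form m P (\<lambda>c. if c = a then x else if c = b then y else 0) =
      P a a * (x * cnj x) + P a b * y * cnj x + P b a * x * cnj y + P b b * (y * cnj y)"
    by (subst form_supported[of "{a, b}"]) (use assms in \<open>auto simp: algebra_simps\<close>)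
  then show ?thesis using pos_formD[OF assms(1)] by (rule subst)
qed

text \<open>Polarisation: that the form is real at \<open>(1, 1)\<close> and at
  \<open>(1, i)\<close> kills the imaginary and the real part of \<open>P a b - cnj (P b a)\<close>,
  respectively.\<close>

lemma pos_form_hermitian:
  assumes "pos_form m P" "a < m" "b < m"
  shows "P a b = cnj (P b a)"
proof (cases "a = b")
  case True
  then show ?thesis using pos_form_diag[OF assms(1,2)] by (simp add: complex_nonneg_iff complex_eq_iff)
next
  case False
  have "Im (P a a) = 0" "Im (P b b) = 0"
    using pos_form_diag[OF assms(1)] assms(2,3) by (auto simp: complex_nonneg_iff)
  moreover have "Im (P a a * (1 * cnj 1) + P a b * 1 * cnj 1 + P b a * 1 * cnj 1 + P b b * (1 * cnj 1)) = 0"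
    using pos_form_pair[OF assms False, of 1 1] by (simp add: complex_nonneg_iff)
  moreover have "Im (P a a * (1 * cnj 1) + P a b * \<i> * cnj 1 + P b a * 1 * cnj \<i> + P b b * (\<i> * cnj \<i>)) = 0"
    using pos_form_pair[OF assms False, of 1 \<i>] by (simp add: complex_nonneg_iff)
  ultimately show ?thesis by (simp add: complex_eq_iff)
qed

text \<open>On the vectors \<open>(1, y)\<close> the form is affine in \<open>y\<close> once
  \<open>P b b = 0\<close>. If \<open>P a b\<close> were nonzero, a suitable \<open>y\<close> would
  give it the value \<open>q - 2 * (q + 1) < 0\<close>. This settles zero pivots in the
  factorisation below.\<close>

lemma pos_form_zero_diag:
  assumes P: "pos_form m P" "a < m" "b < m" and "P b b = 0"
  shows "P a b = 0"
proof (cases "a = b")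
  case False
  define z where "z = P a b"
  define q where "q = Re (P a a)"
  have q: "q \<ge> 0" "P a a = of_real q"
    using pos_form_diag[OF P(1,2)] unfolding q_def by (auto simp: complex_nonneg_iff intro: complex_nonneg_of_real)
  have z': "P b a = cnj z" using pos_form_hermitian[OF P(1) P(3,2)] by (simp add: z_def)
  have *: "0 \<le> q + 2 * Re (z * y)" for y
    using pos_form_pair[OF P False, of 1 y] \<open>P b b = 0\<close> q z'
    by (simp add: complex_nonneg_iff z_def[symmetric] algebra_simps)
  have "0 \<le> q + 2 * Re (z * (- of_real ((q + 1) / (cmod z)\<^sup>2) * cnj z))" by (rule *)
  also have "z * (- of_real ((q + 1) / (cmod z)\<^sup>2) * cnj z) = - of_real ((q + 1) / (cmod z)\<^sup>2) * (z * cnj z)"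
    by simp
  also have "\<dots> = - of_real ((q + 1) / (cmod z)\<^sup>2 * (cmod z)\<^sup>2)"
    by (simp only: of_real_mult complex_norm_square mult_minus_left)
  finally have "0 \<le> q - 2 * ((q + 1) / (cmod z)\<^sup>2 * (cmod z)\<^sup>2)" by simp
  then show ?thesis using q by (cases "z = 0") (auto simp: z_def)
qed (use assms in simp)

text \<open>Cholesky factorisation, by elimination of the last index.\<close>

lemma pos_form_factor:
  assumes "pos_form m P"
  obtains Q where "\<And>a b. a < m \<Longrightarrow> b < m \<Longrightarrow> P a b = (\<Sum>k<m. Q a k * cnj (Q b k))"
proof -
  have "\<exists>Q. \<forall>a<m. \<forall>b<m. P a b = (\<Sum>k<m. Q a k * cnj (Q b k))"
    using assms
  proof (induction m arbitrary: P)
    case (Suc m)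
    note P = Suc.prems
    define p where "p = Re (P m m)"
    have p: "p \<ge> 0" "P m m = of_real p"
      using pos_form_diag[OF P, of m] unfolding p_def by (auto simp: complex_nonneg_iff intro: complex_nonneg_of_real)
    have herm: "P m b = cnj (P b m)" if "b < Suc m" for b
      using pos_form_hermitian[OF P, of m b] that by simp
    have zero: "P a m = 0" if "a < Suc m" "p = 0" for a
      using pos_form_zero_diag[OF P that(1), of m] that p by simp
    \<comment> \<open>The Schur complement of the last diagonal entry. For \<open>p = 0\<close> the
      division yields 0, which is correct because the whole last column then vanishes.\<close>
    define P' where "P' a b = P a b - P a m * P m b / of_real p" for a b
    have "pos_form m P'"
      unfolding pos_form_def
    proof
      fix h :: "nat \<Rightarrow> complex"
      define s where "s = (\<Sum>b<m. P m b * h b)"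
      have s': "(\<Sum>a<m. P a m * cnj (h a)) = cnj s"
        unfolding s_def cnj_sum by (rule sum.cong) (auto simp: herm)
      \<comment> \<open>The last coordinate that minimises the form over all extensions of
        \<open>h\<close>; the minimum is the form of the Schur complement.\<close>
      define t where "t = - s / of_real p"
      define g where "g = h(m := t)"
      have sz: "s = 0" if "p = 0" unfolding s_def using zero that herm by simp
      have A: "(\<Sum>b<m. P m b * h b * cnj t) = s * cnj t" by (simp add: s_def sum_distrib_right)
      have B: "(\<Sum>a<m. P a m * t * cnj (h a)) = t * cnj s"
        by (simp add: s'[symmetric] sum_distrib_left ac_simps)
      have "form (Suc m) P g = form m P h + (\<Sum>a<m. P a m * t * cnj (h a)) +
          (\<Sum>b<m. P m b * h b * cnj t) + P m m * t * cnj t"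
        by (simp add: form_def g_def sum.distrib)
      also have "\<dots> = form m P h - s * cnj s / of_real p"
        unfolding A B using sz by (cases "p = 0") (auto simp: t_def p field_simps)
      also have "s * cnj s = (\<Sum>a<m. \<Sum>b<m. P a m * P m b * h b * cnj (h a))"
        unfolding s'[symmetric] unfolding s_def sum_product
        by (subst sum.swap) (simp add: ac_simps)
      also have "form m P h - \<dots> / of_real p = form m P' h"
        unfolding form_def P'_def by (simp add: sum_divide_distrib sum_subtractf algebra_simps)
      finally show "0 \<le> form m P' h" using pos_formD[OF P] by (rule subst)
    qed
    then obtain Q where Q: "\<And>a b. a < m \<Longrightarrow> b < m \<Longrightarrow> P' a b = (\<Sum>k<m. Q a k * cnj (Q b k))"
      using Suc.IH[of P'] by auto
    define Q' where "Q' a k = (if k < m then if a < m then Q a k else 0 else P a m / of_real (sqrt p))" for a k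
    have "P a b = (\<Sum>k<Suc m. Q' a k * cnj (Q' b k))" if ab: "a < Suc m" "b < Suc m" for a b
    proof -
      have sq: "complex_of_real (sqrt p) * complex_of_real (sqrt p) = of_real p"
        using p by (metis of_real_mult real_sqrt_mult_self abs_of_nonneg)
      have "(\<Sum>k<Suc m. Q' a k * cnj (Q' b k)) =
          (\<Sum>k<m. Q' a k * cnj (Q' b k)) + P a m * P m b / of_real p"
        using herm[OF ab(2)] by (simp add: Q'_def sq)
      also have "(\<Sum>k<m. Q' a k * cnj (Q' b k)) = (if a < m \<and> b < m then P' a b else 0)"
        by (auto simp: Q Q'_def)
      also have "\<dots> + P a m * P m b / of_real p = P a b"
      proof (cases "p = 0")
        case True
        then show ?thesis using ab zero[of a] zero[of b] herm[of b] herm[of a]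
          by (cases "a = m"; cases "b = m") (auto simp: P'_def)
      next
        case False
        then show ?thesis using ab p
          by (cases "a = m"; cases "b = m") (auto simp: P'_def)
      qed
      finally show ?thesis by simp
    qed
    then show ?case by blast
  qed simp
  with that show ?thesis by blast
qed

lemma sum_swap_inner3:
  "(\<Sum>a\<in>A. \<Sum>b\<in>B. \<Sum>c\<in>C. \<Sum>k\<in>K. g a b c k) = (\<Sum>k\<in>K. \<Sum>a\<in>A. \<Sum>b\<in>B. \<Sum>c\<in>C. g a b c k)"
  by (simp only: sum.swap[where A = C and B = K] sum.swap[where A = B and B = K]
      sum.swap[where A = A and B = K])

lemma sum_swap_inner4:
  "(\<Sum>a\<in>A. \<Sum>b\<in>B. \<Sum>c\<in>C. \<Sum>d\<in>D. \<Sum>k\<in>K. g a b c d k) =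
    (\<Sum>k\<in>K. \<Sum>a\<in>A. \<Sum>b\<in>B. \<Sum>c\<in>C. \<Sum>d\<in>D. g a b c d k)"
  by (simp only: sum.swap[where A = D and B = K] sum.swap[where A = C and B = K]
      sum.swap[where A = B and B = K] sum.swap[where A = A and B = K])

lemma sum_lessThan_add: "(\<Sum>l<n + m. f l) = (\<Sum>l<n. f l) + (\<Sum>l<m. f (n + l))"
  for f :: "nat \<Rightarrow> 'a::comm_monoid_add"
  by (induction m) (simp_all add: add.assoc)

section \<open>Positive semidefinite matrices and block matrices as forms\<close>

lemma psd_iff_pos_form:
  assumes "A \<in> carrier_mat n n"
  shows "psd A \<longleftrightarrow> pos_form n (\<lambda>i j. A $$ (i, j))"
proof -
  have q: "(A *\<^sub>v v) \<bullet>c v = form n (\<lambda>i j. A $$ (i, j)) (\<lambda>i. v $ i)" if "v \<in> carrier_vec n" for v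
    using that assms
    by (auto simp: form_def scalar_prod_def atLeast0LessThan sum_distrib_right intro!: sum.cong)
  have "form n (\<lambda>i j. A $$ (i, j)) h = form n (\<lambda>i j. A $$ (i, j)) (\<lambda>i. vec n h $ i)" for h
    by (simp add: form_def)
  then show ?thesis
    using assms q unfolding psd_def pos_form_def by (auto) (metis vec_carrier)
qed

text \<open>The form of an element of \<open>M_m(M_n)\<close> at \<open>m\<close> vectors of length
  \<open>n\<close>: \<open>a, b\<close> number the blocks and \<open>i, j\<close> the entries inside
  a block. It replaces the \<open>div\<close> and \<open>mod\<close> indices of
  \<open>block_mat\<close>, both in tensor inequalities and in complete positivity.\<close>

definition bform ::
    "nat \<Rightarrow> nat \<Rightarrow> (nat \<Rightarrow> nat \<Rightarrow> nat \<Rightarrow> nat \<Rightarrow> complex) \<Rightarrow> (nat \<Rightarrow> nat \<Rightarrow> complex) \<Rightarrow> complex" where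
  "bform m n P h = (\<Sum>a<m. \<Sum>b<m. \<Sum>i<n. \<Sum>j<n. P a b i j * h b j * cnj (h a i))"

lemma form_block:
  "form (m * n) (\<lambda>x y. P (x div n) (y div n) (x mod n) (y mod n)) g =
    bform m n P (\<lambda>a i. g (i + a * n))"
proof -
  have "form (m * n) (\<lambda>x y. P (x div n) (y div n) (x mod n) (y mod n)) g =
      (\<Sum>a<m. \<Sum>i<n. \<Sum>b<m. \<Sum>j<n. P a b i j * g (j + b * n) * cnj (g (i + a * n)))"
    unfolding form_def sum_mult_product by (intro sum.cong refl) simp
  also have "\<dots> = bform m n P (\<lambda>a i. g (i + a * n))"
    unfolding bform_def by (subst (2) sum.swap) simp
  finally show ?thesis .
qed

lemma pos_form_block_iff:
  "pos_form (m * n) (\<lambda>x y. P (x div n) (y div n) (x mod n) (y mod n)) \<longleftrightarrow> (\<forall>h. 0 \<le> bform m n P h)"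
proof
  assume *: "pos_form (m * n) (\<lambda>x y. P (x div n) (y div n) (x mod n) (y mod n))"
  show "\<forall>h. 0 \<le> bform m n P h"
  proof
    fix h
    have "bform m n P h = bform m n P (\<lambda>a i. (\<lambda>x. h (x div n) (x mod n)) (i + a * n))"
      unfolding bform_def by (intro sum.cong refl) simp
    then show "0 \<le> bform m n P h"
      using pos_formD[OF *, of "\<lambda>x. h (x div n) (x mod n)"] unfolding form_block by simp
  qed
qed (simp add: pos_form_def form_block)

lemma psd_cong:
  assumes "A \<in> carrier_mat n n" "\<And>i j. i < n \<Longrightarrow> j < n \<Longrightarrow> A $$ (i, j) = P i j"
  shows "psd A \<longleftrightarrow> pos_form n P"
  unfolding psd_iff_pos_form[OF assms(1)] pos_form_def form_def using assms(2) by simp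

lemma block_index_bounds:
  assumes "x < m * (n::nat)"
  shows "x div n < m" "x mod n < n"
  using assms by (simp add: less_mult_imp_div_less) (use assms in \<open>cases "n = 0"; simp\<close>)

lemma psd_block_mat_iff:
  "psd (block_mat m n T) \<longleftrightarrow> (\<forall>h. 0 \<le> bform m n (\<lambda>a b i j. T a b $$ (i, j)) h)"
  unfolding pos_form_block_iff[symmetric]
  by (rule psd_cong) (auto simp: block_mat_def)

section \<open>Complex Hilbert spaces and bounded operators\<close>

lemma cinner_zero_left [simp]: "cinner 0 y = 0"
  using cinner_add_left[of 0 0 y] by simp

lemma cinner_zero_right [simp]: "cinner x 0 = 0"
  using cinner_commute[of x 0] by simp

lemma cinner_add_right: "cinner x (y + z) = cinner x y + cinner x z"
  by (metis cinner_add_left cinner_commute complex_cnj_add)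

lemma cinner_scaleC_right: "cinner x (c *\<^sub>C y) = cnj c * cinner x y"
  by (metis cinner_scaleC_left cinner_commute complex_cnj_mult)

lemma cinner_minus_left: "cinner (- x) y = - cinner x y"
  using cinner_add_left[of x "- x" y] by (simp add: eq_neg_iff_add_eq_0 add.commute)

lemma cinner_diff_left: "cinner (x - z) y = cinner x y - cinner z y"
  using cinner_add_left[of x "- z" y] by (simp add: cinner_minus_left)

lemma cinner_sum_left: "cinner (\<Sum>i\<in>I. f i) y = (\<Sum>i\<in>I. cinner (f i) y)"
  by (induction I rule: infinite_finite_induct) (auto simp: cinner_add_left)

lemma cinner_sum_right: "cinner y (\<Sum>i\<in>I. f i) = (\<Sum>i\<in>I. cinner y (f i))"
  by (induction I rule: infinite_finite_induct) (auto simp: cinner_add_right)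

lemma cinner_self: "cinner x x = of_real ((norm x)\<^sup>2)"
  using cinner_commute[of x x]
  by (simp add: complex_eq_iff flip: inner_eq_Re_cinner dot_square_norm)

lemma cinner_self_nonneg: "0 \<le> cinner x x"
  by (simp add: cinner_self complex_nonneg_iff)

lemma scaleC_zero_left [simp]: "0 *\<^sub>C (x::'a::complex_hilbert) = 0"
  using scaleC_of_real[of 0 x] by simp

lemma scaleC_zero_right [simp]: "c *\<^sub>C (0::'a::complex_hilbert) = 0"
  using scaleC_add_right[of c "0::'a" 0] by simp

lemma scaleC_one [simp]: "1 *\<^sub>C (x::'a::complex_hilbert) = x"
  using scaleC_of_real[of 1 x] by simp

lemma norm_scaleC: "norm (c *\<^sub>C (x::'a::complex_hilbert)) = cmod c * norm x"
proof -
  have "complex_of_real ((norm (c *\<^sub>C x))\<^sup>2) = of_real ((cmod c * norm x)\<^sup>2)"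
    unfolding cinner_self[symmetric] cinner_scaleC_left cinner_scaleC_right
    by (simp add: cinner_self power_mult_distrib) (metis complex_norm_square mult.commute of_real_power)
  then have "(norm (c *\<^sub>C x))\<^sup>2 = (cmod c * norm x)\<^sup>2" by (simp only: of_real_eq_iff)
  then show ?thesis by (rule power2_eq_imp_eq) auto
qed

text \<open>A unimodular factor \<open>u\<close> makes the complex inner product real and
  nonnegative, so that the real Cauchy-Schwarz inequality applies to \<open>u *\<^sub>C x\<close>
  and \<open>y\<close>.\<close>

lemma cmod_cinner_le: "cmod (cinner x y) \<le> norm x * norm y"
proof (cases "cinner x y = 0")
  case False
  define u where "u = cnj (cinner x y) / of_real (cmod (cinner x y))"
  have u: "cmod u = 1" using False by (simp add: u_def norm_divide)
  have "cmod (cinner x y) = Re (u * cinner x y)"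
    using False by (simp add: u_def mult.commute[of "cnj _"] power2_eq_square flip: complex_norm_square)
  also have "\<dots> = inner (u *\<^sub>C x) y" by (simp add: inner_eq_Re_cinner cinner_scaleC_left)
  also have "\<dots> \<le> norm (u *\<^sub>C x) * norm y" by (rule norm_cauchy_schwarz)
  finally show ?thesis by (simp add: norm_scaleC u)
qed simp

lemma bounded_opsI:
  assumes add: "\<And>x y. T (x + y) = T x + T y"
    and scale: "\<And>c x. T (c *\<^sub>C x) = c *\<^sub>C T x"
    and bound: "\<And>x. norm (T x) \<le> B * norm x"
  shows "T \<in> bounded_ops"
proof -
  have "bounded_linear T"
    by (rule bounded_linear_intro[where K = B])
       (use add bound in \<open>auto simp: mult.commute scale simp flip: scaleC_of_real\<close>)
  then show ?thesis by (simp add: bounded_ops_def scale)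
qed

lemma bounded_opsD:
  assumes "T \<in> bounded_ops"
  shows "T (x + y) = T x + T y" "T (c *\<^sub>C x) = c *\<^sub>C T x" "T 0 = 0" "T (\<Sum>i\<in>I. f i) = (\<Sum>i\<in>I. T (f i))"
    "\<exists>B. \<forall>x. norm (T x) \<le> B * norm x"
proof -
  have b: "bounded_linear T" and s: "\<And>c x. T (c *\<^sub>C x) = c *\<^sub>C T x"
    using assms by (auto simp: bounded_ops_def)
  interpret bounded_linear T by (rule b)
  show "T (x + y) = T x + T y" by (rule add)
  show "T (c *\<^sub>C x) = c *\<^sub>C T x" by (rule s)
  show "T 0 = 0" by (rule zero)
  show "T (\<Sum>i\<in>I. f i) = (\<Sum>i\<in>I. T (f i))" by (rule sum)
  show "\<exists>B. \<forall>x. norm (T x) \<le> B * norm x"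
    using bounded by (metis mult.commute)
qed

lemma bounded_ops_id: "(\<lambda>x. x) \<in> bounded_ops"
  by (simp add: bounded_ops_def bounded_linear_ident)

lemma bounded_ops_zero: "(\<lambda>x. 0) \<in> bounded_ops"
  by (simp add: bounded_ops_def bounded_linear_zero)

lemma bounded_ops_add:
  "S \<in> bounded_ops \<Longrightarrow> T \<in> bounded_ops \<Longrightarrow> (\<lambda>x. S x + T x) \<in> bounded_ops"
  by (simp add: bounded_ops_def bounded_linear_add scaleC_add_right)

lemma bounded_ops_scaleC:
  assumes "S \<in> bounded_ops"
  shows "(\<lambda>x. c *\<^sub>C S x) \<in> bounded_ops"
proof -
  obtain B where B: "\<forall>x. norm (S x) \<le> B * norm x" using bounded_opsD(5)[OF assms] by blast
  show ?thesis
  proof (rule bounded_opsI)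
    fix x
    have "cmod c * norm (S x) \<le> cmod c * (B * norm x)" by (intro mult_left_mono) (use B in auto)
    then show "norm (c *\<^sub>C S x) \<le> (cmod c * B) * norm x" by (simp add: norm_scaleC mult.assoc)
  qed (simp_all add: bounded_opsD[OF assms] scaleC_add_right scaleC_scaleC mult.commute)
qed

lemma bounded_ops_sum:
  assumes "\<And>i. i \<in> I \<Longrightarrow> S i \<in> bounded_ops"
  shows "(\<lambda>x. \<Sum>i\<in>I. S i x) \<in> bounded_ops"
  using assms
  by (induction I rule: infinite_finite_induct) (auto intro: bounded_ops_zero bounded_ops_add)

lemma bounded_ops_comp:
  "S \<in> bounded_ops \<Longrightarrow> T \<in> bounded_ops \<Longrightarrow> (\<lambda>x. S (T x)) \<in> bounded_ops"
  by (simp add: bounded_ops_def bounded_linear_compose)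

section \<open>The semicircular tuple and its matrix range\<close>

lemma annihilation_creation:
  "annihilation p (creation q x) = (if p = q then x else 0)"
  by transfer auto

lemma cinner_annihilation: "cinner (annihilation i x) y = cinner x (creation i y)"
proof transfer
  fix i :: 'a and f g :: "'a list \<Rightarrow> complex"
  let ?h = "\<lambda>w. f w * cnj (case w of [] \<Rightarrow> 0 | j # v \<Rightarrow> if j = i then g v else 0)"
  have "(\<Sum>\<^sub>\<infinity>w. f (i # w) * cnj (g w)) = infsum ?h ((#) i ` UNIV)"
    by (subst infsum_reindex) (auto simp: o_def)
  also have "\<dots> = (\<Sum>\<^sub>\<infinity>w. ?h w)"
    by (rule infsum_cong_neutral) (auto split: list.splits)
  finally show "(\<Sum>\<^sub>\<infinity>w. f (i # w) * cnj (g w)) = (\<Sum>\<^sub>\<infinity>w. ?h w)" .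
qed

text \<open>The Cuntz-Toeplitz relation: isometries with orthogonal ranges. It drives both the
  intertwining property of the Poisson vectors and the norm identity for
  \<open>creation_row\<close>.\<close>

lemma cinner_creation:
  "cinner (creation p x) (creation q y) = (if p = q then cinner x y else 0)"
  by (simp add: annihilation_creation flip: cinner_annihilation)

lemma annihilation_vacuum: "annihilation p (fock_basis []) = 0"
  by transfer simp

lemma cinner_vacuum_creation [simp]: "cinner (fock_basis []) (creation p x) = 0"
  by (simp add: annihilation_vacuum flip: cinner_annihilation)

lemma cinner_creation_vacuum [simp]: "cinner (creation p x) (fock_basis []) = 0"
  by (subst cinner_commute) simp

lemma cinner_vacuum [simp]: "cinner (fock_basis []) (fock_basis []) = 1"
proof transfer
  let ?h = "\<lambda>v::'a list. (if v = [] then 1 else 0) * cnj (if v = [] then 1 else 0)"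
  have "infsum ?h UNIV = infsum ?h {[]}" by (rule infsum_cong_neutral) auto
  then show "infsum ?h UNIV = 1" by simp
qed

text \<open>Made for the adjoint of an isometry: with \<open>x = annihilation p y\<close> and
  \<open>z = creation p x\<close> it shows that annihilation is a contraction.\<close>

lemma norm_le_of_cinner:
  assumes "cinner x x = cinner y z" "norm z \<le> norm x"
  shows "norm x \<le> norm y"
proof (cases "x = 0")
  case False
  have "complex_of_real ((norm x)\<^sup>2) = cinner y z" using assms(1) cinner_self[of x] by metis
  then have "(norm x)\<^sup>2 = cmod (cinner y z)" by (metis norm_of_real abs_of_nonneg zero_le_power2)
  also have "\<dots> \<le> norm y * norm z" by (rule cmod_cinner_le)
  also have "\<dots> \<le> norm y * norm x" using assms by (intro mult_left_mono) auto
  finally show ?thesis using False by (simp add: power2_eq_square)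
qed simp

lemma norm_creation: "norm (creation p x) = norm x"
proof -
  have "complex_of_real ((norm (creation p x))\<^sup>2) = of_real ((norm x)\<^sup>2)"
    by (metis cinner_creation cinner_self)
  then show ?thesis by (simp only: of_real_eq_iff) (simp add: power2_eq_iff_nonneg)
qed

lemma creation_bounded: "creation p \<in> bounded_ops"
proof (rule bounded_opsI[where B = 1])
  show "creation p (x + y) = creation p x + creation p y" for x y
    by transfer (auto split: list.splits)
  show "creation p (c *\<^sub>C x) = c *\<^sub>C creation p x" for c x
    by transfer (auto split: list.splits)
qed (simp add: norm_creation)

lemma annihilation_bounded: "annihilation p \<in> bounded_ops"
proof (rule bounded_opsI[where B = 1])
  show "annihilation p (x + y) = annihilation p x + annihilation p y" for x y
    by transfer auto
  show "annihilation p (c *\<^sub>C x) = c *\<^sub>C annihilation p x" for c x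
    by transfer auto
  show "norm (annihilation p x) \<le> 1 * norm x" for x
    using norm_le_of_cinner[of "annihilation p x" x "creation p (annihilation p x)"]
    by (simp add: cinner_annihilation norm_creation)
qed

lemma half_semicircular_eq:
  "half_semicircular p x = (1/2) *\<^sub>C (creation p x + annihilation p x)"
  using scaleC_of_real[of "1/2" "creation p x + annihilation p x"]
  by (simp add: half_semicircular_def semicircular_def cadjoint_creation)

lemma half_semicircular_bounded: "half_semicircular p \<in> bounded_ops"
proof -
  have "half_semicircular p = (\<lambda>x. (1/2) *\<^sub>C (creation p x + annihilation p x))"
    by (rule ext) (rule half_semicircular_eq)
  then show ?thesis
    by (simp add: bounded_ops_scaleC bounded_ops_add creation_bounded annihilation_bounded)
qed

lemma cinner_half_semicircular:
  "cinner (half_semicircular p x) y = (cinner (creation p x) y + cinner x (creation p y)) / 2"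
  by (simp add: half_semicircular_eq cinner_scaleC_left cinner_add_left cinner_annihilation)

lemma half_semicircular_symmetric:
  "cinner (half_semicircular p x) y = cinner x (half_semicircular p y)"
  unfolding cinner_half_semicircular
  by (subst (3) cinner_commute)
     (simp add: cinner_half_semicircular cinner_commute[of "creation p y"] cinner_commute[of y])

text \<open>For fixed \<open>N\<close> the families \<open>(\<xi> N k j)\<close> with
  \<open>k < K\<close> form an orthonormal system, indexed by \<open>j < n\<close>, in the direct
  sum of \<open>K\<close> copies of the space. Compressing the \<open>K\<close>-fold amplification
  of an operator to its span is UCP. Only the compressions of the \<open>A p\<close> are assumed to
  converge; a Banach limit supplies the values on all other bounded operators.\<close>

lemma matrix_range_limitI:
  fixes A :: "'d::finite \<Rightarrow> 'h::complex_hilbert \<Rightarrow> 'h" and \<xi> :: "nat \<Rightarrow> nat \<Rightarrow> nat \<Rightarrow> 'h"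
  assumes n: "1 \<le> n"
    and orth: "\<And>N i j. i < n \<Longrightarrow> j < n \<Longrightarrow>
      (\<Sum>k<K. cinner (\<xi> N k j) (\<xi> N k i)) = (if i = j then 1 else 0)"
    and lim: "\<And>p i j. i < n \<Longrightarrow> j < n \<Longrightarrow>
      (\<lambda>N. \<Sum>k<K. cinner (A p (\<xi> N k j)) (\<xi> N k i)) \<longlonglongrightarrow> Y p i j"
  shows "(\<lambda>p. mat n n (\<lambda>(i, j). Y p i j)) \<in> matrix_range A"
proof -
  obtain Lim :: "(nat \<Rightarrow> complex) \<Rightarrow> complex" where
    add: "\<And>f g. bounded (range f) \<Longrightarrow> bounded (range g) \<Longrightarrow> Lim (\<lambda>n. f n + g n) = Lim f + Lim g"
    and scale: "\<And>c f. bounded (range f) \<Longrightarrow> Lim (\<lambda>n. c * f n) = c * Lim f"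
    and conv: "\<And>f l. f \<longlonglongrightarrow> l \<Longrightarrow> Lim f = l"
    and pos: "\<And>f. bounded (range f) \<Longrightarrow> (\<And>n. 0 \<le> f n) \<Longrightarrow> 0 \<le> Lim f"
    by (rule Banach_limit_exists) blast
  have bounded_add: "bounded (range (\<lambda>n. f n + g n))"
    if "bounded (range f)" "bounded (range g)" for f g :: "nat \<Rightarrow> complex"
    using bounded_plus_comp[OF that] .
  have bounded_scale: "bounded (range (\<lambda>n. c * f n))"
    if "bounded (range f)" for c and f :: "nat \<Rightarrow> complex"
    using bounded_linear_image[OF that bounded_linear_mult_right[of c]] by (simp add: image_image)
  \<comment> \<open>Boundedness and the value of the limit are proved together, since additivity of
    \<open>Lim\<close> is available for bounded sequences only.\<close>
  have sums: "bounded (range (\<lambda>n. \<Sum>x\<in>I. f x n)) \<and> Lim (\<lambda>n. \<Sum>x\<in>I. f x n) = (\<Sum>x\<in>I. Lim (f x))"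
    if "\<And>x. x \<in> I \<Longrightarrow> bounded (range (f x))" for I :: "nat set" and f
    using that
  proof (induction I rule: infinite_finite_induct)
    case (insert x I)
    then show ?case using add[of "f x" "\<lambda>n. \<Sum>x\<in>I. f x n"] bounded_add[of "f x" "\<lambda>n. \<Sum>x\<in>I. f x n"] by simp
  qed (auto intro!: conv)
  define q where "q S i j N = (\<Sum>k<K. cinner (S (\<xi> N k j)) (\<xi> N k i))" for S i j N
  have norm1: "norm (\<xi> N k j) \<le> 1" if "k < K" "j < n" for N k j
  proof -
    have "complex_of_real (\<Sum>k<K. (norm (\<xi> N k j))\<^sup>2) = of_real 1"
      using orth[OF that(2,2), of N] by (simp add: cinner_self)
    then have "(\<Sum>k<K. (norm (\<xi> N k j))\<^sup>2) = 1" by (simp only: of_real_eq_iff)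
    moreover have "(norm (\<xi> N k j))\<^sup>2 \<le> (\<Sum>k<K. (norm (\<xi> N k j))\<^sup>2)"
      by (rule member_le_sum) (use that in auto)
    ultimately show ?thesis by (simp add: power_le_one_iff)
  qed
  have bq: "bounded (range (q S i j))" if S: "S \<in> bounded_ops" and ij: "i < n" "j < n" for S i j
  proof -
    obtain B where B: "\<forall>x. norm (S x) \<le> B * norm x" using bounded_opsD(5)[OF S] by blast
    have "norm (q S i j N) \<le> (\<Sum>k<K. \<bar>B\<bar>)" for N
      unfolding q_def
    proof (rule sum_norm_le)
      fix k assume "k \<in> {..<K}"
      then have k: "k < K" by simp
      have "cmod (cinner (S (\<xi> N k j)) (\<xi> N k i)) \<le> norm (S (\<xi> N k j)) * norm (\<xi> N k i)"
        by (rule cmod_cinner_le)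
      also have "\<dots> \<le> \<bar>B\<bar> * 1"
      proof (rule mult_mono)
        have "norm (S (\<xi> N k j)) \<le> B * norm (\<xi> N k j)" using B by blast
        also have "\<dots> \<le> \<bar>B\<bar> * 1" using norm1[OF k ij(2)] by (intro mult_mono) auto
        finally show "norm (S (\<xi> N k j)) \<le> \<bar>B\<bar>" by simp
      qed (use norm1[OF k ij(1)] in auto)
      finally show "cmod (cinner (S (\<xi> N k j)) (\<xi> N k i)) \<le> \<bar>B\<bar>" by simp
    qed
    then show ?thesis by (auto simp: bounded_iff)
  qed
  define \<phi> where "\<phi> S = mat n n (\<lambda>(i, j). Lim (q S i j))" for S
  have "ucp_op n \<phi>"
    unfolding ucp_op_def
  proof (intro conjI ballI allI impI)
    show "\<phi> S \<in> carrier_mat n n" for S by (simp add: \<phi>_def)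
    show "\<phi> (\<lambda>x. S x + T x) = \<phi> S + \<phi> T" if "S \<in> bounded_ops" "T \<in> bounded_ops" for S T
    proof (rule eq_matI)
      fix i j assume "i < dim_row (\<phi> S + \<phi> T)" "j < dim_col (\<phi> S + \<phi> T)"
      then have ij: "i < n" "j < n" by (auto simp: \<phi>_def)
      have "q (\<lambda>x. S x + T x) i j = (\<lambda>N. q S i j N + q T i j N)"
        by (simp add: q_def fun_eq_iff cinner_add_left sum.distrib)
      then show "\<phi> (\<lambda>x. S x + T x) $$ (i, j) = (\<phi> S + \<phi> T) $$ (i, j)"
        using ij by (simp add: \<phi>_def add bq that)
    qed (auto simp: \<phi>_def)
    show "\<phi> (\<lambda>x. c *\<^sub>C S x) = c \<cdot>\<^sub>m \<phi> S" if "S \<in> bounded_ops" for c S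
    proof (rule eq_matI)
      fix i j assume "i < dim_row (c \<cdot>\<^sub>m \<phi> S)" "j < dim_col (c \<cdot>\<^sub>m \<phi> S)"
      then have ij: "i < n" "j < n" by (auto simp: \<phi>_def)
      have "q (\<lambda>x. c *\<^sub>C S x) i j = (\<lambda>N. c * q S i j N)"
        by (simp add: q_def fun_eq_iff cinner_scaleC_left sum_distrib_left)
      then show "\<phi> (\<lambda>x. c *\<^sub>C S x) $$ (i, j) = (c \<cdot>\<^sub>m \<phi> S) $$ (i, j)"
        using ij by (simp add: \<phi>_def scale bq that)
    qed (auto simp: \<phi>_def)
    have "q (\<lambda>x. x) i j = (\<lambda>N. if i = j then 1 else 0)" if "i < n" "j < n" for i j
      using that by (simp add: q_def fun_eq_iff orth)
    then show "\<phi> (\<lambda>x. x) = 1\<^sub>m n"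
      by (intro eq_matI) (auto simp: \<phi>_def intro!: conv)
    fix m and T :: "nat \<Rightarrow> nat \<Rightarrow> 'h \<Rightarrow> 'h"
    assume T: "(\<forall>a<m. \<forall>b<m. T a b \<in> bounded_ops) \<and> op_block_pos m T"
    show "psd (block_mat m n (\<lambda>a b. \<phi> (T a b)))"
      unfolding psd_block_mat_iff
    proof
      fix h :: "nat \<Rightarrow> nat \<Rightarrow> complex"
      define f where "f a b i j N = h b j * cnj (h a i) * q (T a b) i j N" for a b i j N
      have bf: "bounded (range (f a b i j))" if "a < m" "b < m" "i < n" "j < n" for a b i j
        unfolding f_def by (rule bounded_scale) (use that T bq in auto)
      have Lf: "Lim (f a b i j) = h b j * cnj (h a i) * Lim (q (T a b) i j)"
        if "a < m" "b < m" "i < n" "j < n" for a b i j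
        unfolding f_def by (rule scale) (use that T bq in auto)
      define F where "F N = (\<Sum>a<m. \<Sum>b<m. \<Sum>i<n. \<Sum>j<n. f a b i j N)" for N
      have s1: "bounded (range (\<lambda>N. \<Sum>j<n. f a b i j N)) \<and>
          Lim (\<lambda>N. \<Sum>j<n. f a b i j N) = (\<Sum>j<n. Lim (f a b i j))"
        if "a < m" "b < m" "i < n" for a b i
        by (rule sums) (use that bf in auto)
      have s2: "bounded (range (\<lambda>N. \<Sum>i<n. \<Sum>j<n. f a b i j N)) \<and>
          Lim (\<lambda>N. \<Sum>i<n. \<Sum>j<n. f a b i j N) = (\<Sum>i<n. \<Sum>j<n. Lim (f a b i j))"
        if "a < m" "b < m" for a b
        using sums[of "{..<n}" "\<lambda>i N. \<Sum>j<n. f a b i j N"] s1[OF that] by simp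
      have s3: "bounded (range (\<lambda>N. \<Sum>b<m. \<Sum>i<n. \<Sum>j<n. f a b i j N)) \<and>
          Lim (\<lambda>N. \<Sum>b<m. \<Sum>i<n. \<Sum>j<n. f a b i j N) = (\<Sum>b<m. \<Sum>i<n. \<Sum>j<n. Lim (f a b i j))"
        if "a < m" for a
        using sums[of "{..<m}" "\<lambda>b N. \<Sum>i<n. \<Sum>j<n. f a b i j N"] s2[OF that] by simp
      have s4: "bounded (range F) \<and> Lim F = (\<Sum>a<m. \<Sum>b<m. \<Sum>i<n. \<Sum>j<n. Lim (f a b i j))"
        using sums[of "{..<m}" "\<lambda>a N. \<Sum>b<m. \<Sum>i<n. \<Sum>j<n. f a b i j N"] s3 by (simp add: F_def[abs_def])
      have "0 \<le> F N" for N
      proof -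
        \<comment> \<open>Absorbing the scalars \<open>h\<close> into the vectors turns the fourfold
          sum into \<open>K\<close> instances of \<open>op_block_pos\<close>, one for each
          \<open>k\<close>.\<close>
        define \<eta> where "\<eta> k b = (\<Sum>j<n. h b j *\<^sub>C \<xi> N k j)" for k b
        have "F N = (\<Sum>k<K. \<Sum>a<m. \<Sum>b<m. \<Sum>i<n. \<Sum>j<n.
            h b j * cnj (h a i) * cinner (T a b (\<xi> N k j)) (\<xi> N k i))"
          unfolding F_def f_def q_def sum_distrib_left by (rule sum_swap_inner4)
        also have "\<dots> = (\<Sum>k<K. \<Sum>a<m. \<Sum>b<m. cinner (T a b (\<eta> k b)) (\<eta> k a))"
        proof (intro sum.cong refl)
          fix k a b assume "a \<in> {..<m}" "b \<in> {..<m}"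
          then have "T a b \<in> bounded_ops" using T by auto
          note T_lin = bounded_opsD(2,4)[OF this]
          show "(\<Sum>i<n. \<Sum>j<n. h b j * cnj (h a i) * cinner (T a b (\<xi> N k j)) (\<xi> N k i)) =
              cinner (T a b (\<eta> k b)) (\<eta> k a)"
            unfolding \<eta>_def[of k a] cinner_sum_right cinner_scaleC_right
            unfolding \<eta>_def T_lin cinner_sum_left cinner_scaleC_left sum_distrib_left
            by (intro sum.cong refl) (simp only: mult.assoc mult.left_commute)
        qed
        also have "0 \<le> \<dots>"
        proof (rule sum_nonneg)
          show "0 \<le> (\<Sum>a<m. \<Sum>b<m. cinner (T a b (\<eta> k b)) (\<eta> k a))" for k
            using T[THEN conjunct2, unfolded op_block_pos_def, THEN spec, of "\<eta> k"] .
        qed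
        finally show ?thesis .
      qed
      then have "0 \<le> Lim F" by (rule pos[OF conjunct1[OF s4]])
      also have "Lim F = bform m n (\<lambda>a b i j. \<phi> (T a b) $$ (i, j)) h"
        unfolding bform_def using s4 Lf by (simp add: \<phi>_def ac_simps)
      finally show "0 \<le> bform m n (\<lambda>a b i j. \<phi> (T a b) $$ (i, j)) h" .
    qed
  qed
  moreover have "mat n n (\<lambda>(i, j). Y p i j) = \<phi> (A p)" for p
    unfolding \<phi>_def by (rule eq_matI) (auto simp: q_def[abs_def] intro!: conv[symmetric] lim)
  ultimately show ?thesis
    using n unfolding matrix_range_def by auto
qed

text \<open>The \<open>k\<close>-th coordinate of the sum of \<open>e_w tensor C_w^* e_j\<close>
  over the words \<open>w\<close> of length \<open>r\<close>, an element of Fock space tensored with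
  \<open>C^m\<close>. These are the homogeneous parts of the noncommutative Poisson kernel of the
  row \<open>C\<close>.\<close>

primrec Poisson_vector ::
    "('d::finite \<Rightarrow> nat \<Rightarrow> nat \<Rightarrow> complex) \<Rightarrow> nat \<Rightarrow> nat \<Rightarrow> nat \<Rightarrow> nat \<Rightarrow> 'd fock" where
  "Poisson_vector C m 0 k j = (if k = j then fock_basis [] else 0)"
| "Poisson_vector C m (Suc r) k j =
    (\<Sum>p\<in>UNIV. \<Sum>l<m. cnj (C p j l) *\<^sub>C creation p (Poisson_vector C m r k l))"

text \<open>Intertwining: the adjoint of \<open>creation p\<close> strips the first letter, which
  lowers the level by one and applies the adjoint of \<open>C p\<close> to the basis vector
  \<open>e_i\<close>.\<close>

lemma cinner_creation_Poisson:
  "cinner (creation p x) (Poisson_vector C m (Suc s) k i) =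
    (\<Sum>l<m. C p i l * cinner x (Poisson_vector C m s k l))"
proof -
  have "cinner (creation p x) (Poisson_vector C m (Suc s) k i) =
      (\<Sum>q\<in>UNIV. if p = q then \<Sum>l<m. C q i l * cinner x (Poisson_vector C m s k l) else 0)"
    unfolding Poisson_vector.simps cinner_sum_right cinner_scaleC_right cinner_creation
    by (intro sum.cong refl) auto
  then show ?thesis by simp
qed

lemma cinner_Poisson_Suc:
  "cinner (Poisson_vector C m (Suc r) k j) y =
    (\<Sum>p\<in>UNIV. \<Sum>l<m. cnj (C p j l) * cinner (creation p (Poisson_vector C m r k l)) y)"
  by (simp add: cinner_sum_left cinner_scaleC_left)

lemma Poisson_orthogonal:
  "r \<noteq> s \<Longrightarrow> cinner (Poisson_vector C m r k j) (Poisson_vector C m s k' i) = 0"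
proof (induction r arbitrary: s j i)
  case 0
  then obtain s' where "s = Suc s'" by (cases s) auto
  then show ?case by (simp add: cinner_sum_right cinner_scaleC_right)
next
  case (Suc r)
  show ?case
  proof (cases s)
    case 0
    then show ?thesis by (simp add: cinner_sum_left cinner_scaleC_left)
  next
    case s: (Suc s')
    then have "cinner (Poisson_vector C m r k l) (Poisson_vector C m s' k' l') = 0" for l l'
      using Suc by simp
    then show ?thesis
      unfolding s cinner_Poisson_Suc
      by (simp add: cinner_sum_right cinner_scaleC_right cinner_creation)
  qed
qed

context
  fixes C :: "'d::finite \<Rightarrow> nat \<Rightarrow> nat \<Rightarrow> complex" and m :: nat
  assumes coisometry: "\<And>a b. a < m \<Longrightarrow> b < m \<Longrightarrow>
    (\<Sum>p\<in>UNIV. \<Sum>l<m. C p a l * cnj (C p b l)) = (if a = b then 1 else 0)"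
begin

text \<open>By the coisometry condition every level gives again an isometry. For a mere row
  contraction the Gram matrices could shrink with the level, and the averages below need not be
  orthonormal.\<close>

lemma Poisson_gram:
  "i < m \<Longrightarrow> j < m \<Longrightarrow>
    (\<Sum>k<m. cinner (Poisson_vector C m r k j) (Poisson_vector C m r k i)) = (if i = j then 1 else 0)"
proof (induction r arbitrary: i j)
  case 0
  have "(\<Sum>k<m. cinner (Poisson_vector C m 0 k j) (Poisson_vector C m 0 k i)) =
      (\<Sum>k<m. if k = j then if i = j then 1 else 0 else 0)"
    by (intro sum.cong) auto
  then show ?case using 0 by simp
next
  case (Suc r)
  have "(\<Sum>k<m. cinner (Poisson_vector C m (Suc r) k j) (Poisson_vector C m (Suc r) k i)) =
      (\<Sum>p\<in>UNIV. \<Sum>l<m. \<Sum>l'<m. cnj (C p j l) * C p i l' *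
        (\<Sum>k<m. cinner (Poisson_vector C m r k l) (Poisson_vector C m r k l')))"
    unfolding cinner_Poisson_Suc cinner_creation_Poisson sum_distrib_left mult.assoc
    by (rule sum_swap_inner3[symmetric])
  also have "\<dots> = (\<Sum>p\<in>UNIV. \<Sum>l<m. \<Sum>l'<m. if l' = l then cnj (C p j l) * C p i l' else 0)"
    by (intro sum.cong refl) (simp add: Suc.IH)
  also have "\<dots> = (\<Sum>p\<in>UNIV. \<Sum>l<m. C p i l * cnj (C p j l))"
    by (simp add: mult.commute)
  finally show ?case using coisometry Suc.prems by simp
qed

lemma Poisson_shift:
  assumes "i < m" "j < m"
  shows "(\<Sum>k<m. cinner (creation p (Poisson_vector C m r k j)) (Poisson_vector C m s k i)) =
    (if s = Suc r then C p i j else 0)"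
proof (cases s)
  case 0
  then show ?thesis by simp
next
  case s: (Suc s')
  have "(\<Sum>k<m. cinner (creation p (Poisson_vector C m r k j)) (Poisson_vector C m s k i)) =
      (\<Sum>l<m. C p i l * (\<Sum>k<m. cinner (Poisson_vector C m r k j) (Poisson_vector C m s' k l)))"
    unfolding s cinner_creation_Poisson sum_distrib_left by (rule sum.swap)
  also have "\<dots> = (\<Sum>l<m. if l = j then if s = Suc r then C p i j else 0 else 0)"
    using assms by (intro sum.cong refl) (auto simp: s Poisson_gram Poisson_orthogonal)
  finally show ?thesis using assms by simp
qed

text \<open>The averages of the Poisson vectors over the first \<open>N\<close> levels of the Fock space are
  orthonormal, and compress \<open>creation p\<close> to \<open>(1 - 1 / N) C p\<close>.\<close>

lemma coisometry_real_part_in_range: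
  assumes "1 \<le> n" "n \<le> m"
  shows "(\<lambda>p. mat n n (\<lambda>(i, j). (C p i j + cnj (C p j i)) / 2)) \<in> matrix_range half_semicircular"
proof (rule matrix_range_limitI[OF assms(1), where K = m])
  \<comment> \<open>Index \<open>N\<close> averages the \<open>Suc N\<close> levels
    \<open>0..N\<close>, so the number of levels is never zero; the compression factor is
    \<open>N / Suc N\<close>.\<close>
  define c where "c N = complex_of_real (1 / sqrt (real (Suc N)))" for N
  have c2: "c N * cnj (c N) = 1 / of_nat (Suc N)" for N
  proof -
    have "c N * cnj (c N) = complex_of_real (1 / sqrt (real (Suc N)) * (1 / sqrt (real (Suc N))))"
      by (simp only: c_def complex_cnj_complex_of_real of_real_mult)
    also have "1 / sqrt (real (Suc N)) * (1 / sqrt (real (Suc N))) = 1 / real (Suc N)" by simp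
    also have "complex_of_real (1 / real (Suc N)) = 1 / of_nat (Suc N)" by (simp del: of_nat_Suc)
    finally show ?thesis .
  qed
  define \<xi> where "\<xi> N k j = c N *\<^sub>C (\<Sum>r<Suc N. Poisson_vector C m r k j)" for N k j
  have average: "(\<Sum>k<m. cinner (T (\<xi> N k j)) (\<xi> N k i)) =
      (\<Sum>r<Suc N. \<Sum>s<Suc N. \<Sum>k<m. cinner (T (Poisson_vector C m r k j)) (Poisson_vector C m s k i))
        / of_nat (Suc N)"
    if "T \<in> bounded_ops" for T N i j
  proof -
    have "(\<Sum>k<m. cinner (T (\<xi> N k j)) (\<xi> N k i)) =
      (\<Sum>k<m. c N * cnj (c N) * (\<Sum>r<Suc N. \<Sum>s<Suc N.
        cinner (T (Poisson_vector C m r k j)) (Poisson_vector C m s k i)))"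
    proof (rule sum.cong[OF refl])
      fix k
      show "cinner (T (\<xi> N k j)) (\<xi> N k i) = c N * cnj (c N) * (\<Sum>r<Suc N. \<Sum>s<Suc N.
          cinner (T (Poisson_vector C m r k j)) (Poisson_vector C m s k i))"
        unfolding \<xi>_def[of N k j] bounded_opsD(2,4)[OF that] cinner_scaleC_left cinner_sum_left
        unfolding \<xi>_def cinner_scaleC_right cinner_sum_right sum_distrib_left
        by (simp only: mult.assoc)
    qed
    also have "\<dots> = c N * cnj (c N) * (\<Sum>k<m. \<Sum>r<Suc N. \<Sum>s<Suc N.
        cinner (T (Poisson_vector C m r k j)) (Poisson_vector C m s k i))"
      by (rule sum_distrib_left[symmetric])
    also have "(\<Sum>k<m. \<Sum>r<Suc N. \<Sum>s<Suc N.
        cinner (T (Poisson_vector C m r k j)) (Poisson_vector C m s k i)) =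
      (\<Sum>r<Suc N. \<Sum>k<m. \<Sum>s<Suc N.
        cinner (T (Poisson_vector C m r k j)) (Poisson_vector C m s k i))"
      by (rule sum.swap)
    also have "\<dots> = (\<Sum>r<Suc N. \<Sum>s<Suc N. \<Sum>k<m.
        cinner (T (Poisson_vector C m r k j)) (Poisson_vector C m s k i))"
      by (intro sum.cong refl sum.swap)
    finally show ?thesis by (simp only: c2) simp
  qed
  show "(\<Sum>k<m. cinner (\<xi> N k j) (\<xi> N k i)) = (if i = j then 1 else 0)"
    if "i < n" "j < n" for N i j
  proof -
    have "(\<Sum>r<Suc N. \<Sum>s<Suc N. \<Sum>k<m. cinner (Poisson_vector C m r k j) (Poisson_vector C m s k i)) =
        (\<Sum>r<Suc N. \<Sum>s<Suc N. if s = r then if i = j then 1 else 0 else 0)"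
    proof (intro sum.cong refl)
      fix r s
      show "(\<Sum>k<m. cinner (Poisson_vector C m r k j) (Poisson_vector C m s k i)) =
          (if s = r then if i = j then 1 else 0 else 0)"
        using that assms(2) Poisson_gram[of i j] Poisson_orthogonal[of r s C] by (cases "s = r") auto
    qed
    also have "\<dots> = of_nat (Suc N) * (if i = j then 1 else 0)"
      by (simp del: sum.lessThan_Suc)
    finally show ?thesis unfolding average[OF bounded_ops_id] by (simp del: of_nat_Suc)
  qed
  have shift: "(\<Sum>k<m. cinner (creation p (\<xi> N k j)) (\<xi> N k i)) = of_nat N / of_nat (Suc N) * C p i j"
    if "i < m" "j < m" for N i j p
  proof -
    have "(\<Sum>r<Suc N. \<Sum>s<Suc N. \<Sum>k<m. cinner (creation p (Poisson_vector C m r k j)) (Poisson_vector C m s k i)) =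
        (\<Sum>r<Suc N. \<Sum>s<Suc N. if s = Suc r then C p i j else 0)"
      using that by (simp only: Poisson_shift)
    \<comment> \<open>Among the levels \<open>0..N\<close> only the top one has no
      successor.\<close>
    also have "\<dots> = (\<Sum>r<Suc N. if r < N then C p i j else 0)"
      by (intro sum.cong refl) (simp del: sum.lessThan_Suc)
    also have "\<dots> = of_nat N * C p i j" by simp
    finally show ?thesis unfolding average[OF creation_bounded] by simp
  qed
  show "(\<lambda>N. \<Sum>k<m. cinner (half_semicircular p (\<xi> N k j)) (\<xi> N k i)) \<longlonglongrightarrow>
      (C p i j + cnj (C p j i)) / 2" if "i < n" "j < n" for p i j
  proof -
    have ij: "i < m" "j < m" using that assms(2) by auto
    have "(\<Sum>k<m. cinner (half_semicircular p (\<xi> N k j)) (\<xi> N k i)) =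
        ((\<Sum>k<m. cinner (creation p (\<xi> N k j)) (\<xi> N k i)) +
         cnj (\<Sum>k<m. cinner (creation p (\<xi> N k i)) (\<xi> N k j))) / 2" for N
      unfolding cinner_half_semicircular cnj_sum
      by (simp add: sum_divide_distrib sum.distrib add_divide_distrib flip: cinner_commute)
    also have "\<dots> N = of_real (real N / real (Suc N)) * ((C p i j + cnj (C p j i)) / 2)" for N
      unfolding shift[OF ij] shift[OF ij(2,1)] by (simp add: distrib_left)
    finally have eq: "(\<Sum>k<m. cinner (half_semicircular p (\<xi> N k j)) (\<xi> N k i)) =
        of_real (real N / real (Suc N)) * ((C p i j + cnj (C p j i)) / 2)" for N .
    have "(\<lambda>N. of_real (real N / real (Suc N)) * ((C p i j + cnj (C p j i)) / 2)) \<longlonglongrightarrow>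
        of_real 1 * ((C p i j + cnj (C p j i)) / 2)"
      by (intro tendsto_intros LIMSEQ_n_over_Suc_n)
    then show ?thesis unfolding eq by simp
  qed
qed

end

lemma obtain_two_elements:
  assumes "2 \<le> CARD('d::finite)"
  obtains p1 p2 :: "'d::finite" where "p1 \<noteq> p2"
  using assms by (metis UNIV_I card_le_Suc0_iff_eq finite not_less_eq_eq numeral_2_eq_2)

text \<open>The row \<open>C\<close> is the compression of a coisometric row \<open>D\<close> on twice the space: the first letter
  carries a factor \<open>Q\<close> of the defect, and the second one the identity of the added summand, so
  that the two pieces stay orthogonal.\<close>

lemma contraction_real_part_in_range:
  fixes C :: "'d::finite \<Rightarrow> nat \<Rightarrow> nat \<Rightarrow> complex"
  assumes d: "2 \<le> CARD('d)" and n: "1 \<le> n"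
    and contraction: "pos_form n (\<lambda>a b. (if a = b then 1 else 0) - (\<Sum>p\<in>UNIV. \<Sum>l<n. C p a l * cnj (C p b l)))"
  shows "(\<lambda>p. mat n n (\<lambda>(i, j). (C p i j + cnj (C p j i)) / 2)) \<in> matrix_range half_semicircular"
proof -
  obtain p1 p2 :: 'd where p12: "p1 \<noteq> p2"
    using obtain_two_elements[OF d] .
  obtain Q where Q: "\<And>a b. a < n \<Longrightarrow> b < n \<Longrightarrow>
      (if a = b then 1 else 0) - (\<Sum>p\<in>UNIV. \<Sum>l<n. C p a l * cnj (C p b l)) = (\<Sum>l<n. Q a l * cnj (Q b l))"
    using pos_form_factor[OF contraction] by blast
  define D where "D p a l = (if a < n then if l < n then C p a l else if p = p1 then Q a (l - n) else 0
      else if p = p2 \<and> l = a then 1 else 0)" for p a l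
  have split: "(\<Sum>l<2 * n. f l) = (\<Sum>l<n. f l) + (\<Sum>l<n. f (n + l))" for f :: "nat \<Rightarrow> complex"
    using sum_lessThan_add[of f n n] by (simp add: mult_2)
  have "(\<Sum>p\<in>UNIV. \<Sum>l<2 * n. D p a l * cnj (D p b l)) = (if a = b then 1 else 0)"
    if "a < 2 * n" "b < 2 * n" for a b
  proof -
    consider "a < n" "b < n" | "a < n" "b \<ge> n" | "a \<ge> n" "b < n" | "a \<ge> n" "b \<ge> n" by linarith
    then show ?thesis
    proof cases
      case 1
      have "(\<Sum>p\<in>UNIV. \<Sum>l<2 * n. D p a l * cnj (D p b l)) =
          (\<Sum>p\<in>UNIV. (\<Sum>l<n. C p a l * cnj (C p b l)) + (if p = p1 then \<Sum>l<n. Q a l * cnj (Q b l) else 0))"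
        unfolding split using 1 by (intro sum.cong refl) (simp add: D_def)
      also have "\<dots> = (\<Sum>p\<in>UNIV. \<Sum>l<n. C p a l * cnj (C p b l)) + (\<Sum>l<n. Q a l * cnj (Q b l))"
        by (simp add: sum.distrib)
      finally show ?thesis unfolding Q[OF 1, symmetric] by simp
    next
      case 2
      then have "D p a l * cnj (D p b l) = 0" for p l using p12 by (auto simp: D_def)
      then show ?thesis using 2 by simp
    next
      case 3
      then have "D p a l * cnj (D p b l) = 0" for p l using p12 by (auto simp: D_def)
      then show ?thesis using 3 by simp
    next
      case 4
      then have "(\<Sum>p\<in>UNIV. \<Sum>l<2 * n. D p a l * cnj (D p b l)) =
          (\<Sum>p\<in>UNIV. \<Sum>l<2 * n. if l = a then if p = p2 then if a = b then 1 else 0 else 0 else 0)"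
        by (intro sum.cong refl) (auto simp: D_def)
      then show ?thesis using that by simp
    qed
  qed
  from coisometry_real_part_in_range[of "2 * n" D n, OF this] n
  have "(\<lambda>p. mat n n (\<lambda>(i, j). (D p i j + cnj (D p j i)) / 2)) \<in> matrix_range half_semicircular" by simp
  also have "(\<lambda>p. mat n n (\<lambda>(i, j). (D p i j + cnj (D p j i)) / 2)) =
      (\<lambda>p. mat n n (\<lambda>(i, j). (C p i j + cnj (C p j i)) / 2))"
    by (intro ext eq_matI) (auto simp: D_def)
  finally show ?thesis .
qed

section \<open>The balls in terms of forms\<close>

lemma mat_adjoint_index:
  assumes "A \<in> carrier_mat n n" "i < n" "j < n"
  shows "mat_adjoint A $$ (i, j) = cnj (A $$ (j, i))"
  using assms by (simp add: mat_adjoint_def mat_of_rows_def)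

lemma msa_level_iff:
  "X \<in> msa_level n \<longleftrightarrow>
    (\<forall>p. X p \<in> carrier_mat n n \<and> (\<forall>a<n. \<forall>b<n. X p $$ (a, b) = cnj (X p $$ (b, a))))"
proof -
  have "mat_adjoint A = A \<longleftrightarrow> (\<forall>a<n. \<forall>b<n. A $$ (a, b) = cnj (A $$ (b, a)))"
    if A: "A \<in> carrier_mat n n" for A :: "complex mat"
  proof
    assume "mat_adjoint A = A"
    then show "\<forall>a<n. \<forall>b<n. A $$ (a, b) = cnj (A $$ (b, a))"
      using mat_adjoint_index[OF A] by metis
  next
    assume *: "\<forall>a<n. \<forall>b<n. A $$ (a, b) = cnj (A $$ (b, a))"
    show "mat_adjoint A = A"
    proof (rule eq_matI)
      show "mat_adjoint A $$ (i, j) = A $$ (i, j)" if "i < dim_row A" "j < dim_col A" for i j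
      proof -
        have "i < n" "j < n" using that A by auto
        then show ?thesis using * mat_adjoint_index[OF A] by metis
      qed
    qed (use A in \<open>auto simp: mat_adjoint_def\<close>)
  qed
  then show ?thesis unfolding msa_level_def by blast
qed

lemma msa_levelD:
  assumes "X \<in> msa_level n"
  shows "X p \<in> carrier_mat n n" "dim_row (X p) = n" "dim_col (X p) = n"
    "a < n \<Longrightarrow> b < n \<Longrightarrow> cnj (X p $$ (a, b)) = X p $$ (b, a)"
proof -
  show "X p \<in> carrier_mat n n" using assms unfolding msa_level_iff by blast
  then show "dim_row (X p) = n" "dim_col (X p) = n" by auto
  show "cnj (X p $$ (a, b)) = X p $$ (b, a)" if "a < n" "b < n"
    using assms that unfolding msa_level_iff by metis
qed

lemma msa_level_unique: "X \<in> msa_level n \<Longrightarrow> X \<in> msa_level m \<Longrightarrow> n = m"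
  using msa_levelD(2) by metis

lemma msaI: "X \<in> msa_level n \<Longrightarrow> 1 \<le> n \<Longrightarrow> X \<in> msa"
  by (auto simp: msa_def)

lemma msaE:
  assumes "X \<in> msa"
  obtains n where "1 \<le> n" "X \<in> msa_level n"
  using assms by (auto simp: msa_def)

lemma msa_forall_level:
  assumes "X \<in> msa_level n"
  shows "(\<forall>m. X \<in> msa_level m \<longrightarrow> R m) \<longleftrightarrow> R n"
  using assms msa_level_unique by blast

lemma le_id_iff:
  assumes "A \<in> carrier_mat n n"
  shows "le_id A \<longleftrightarrow> pos_form n (\<lambda>a b. (if a = b then 1 else 0) - A $$ (a, b))"
  unfolding le_id_def using assms by (intro psd_cong) auto

definition row_contraction :: "nat \<Rightarrow> ('d::finite \<Rightarrow> nat \<Rightarrow> nat \<Rightarrow> complex) \<Rightarrow> bool" where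
  "row_contraction n C \<longleftrightarrow>
    pos_form n (\<lambda>a b. (if a = b then 1 else 0) - (\<Sum>p\<in>UNIV. \<Sum>l<n. C p a l * cnj (C p b l)))"

lemma pos_form_congI:
  assumes "\<And>a b. a < n \<Longrightarrow> b < n \<Longrightarrow> P a b = P' a b"
  shows "pos_form n P \<longleftrightarrow> pos_form n P'"
  unfolding pos_form_def form_def using assms by simp

lemma ball_B_iff:
  assumes X: "X \<in> msa_level n" and n: "1 \<le> n"
  shows "X \<in> ball_B \<longleftrightarrow> row_contraction n (\<lambda>p a l. X p $$ (a, l))"
proof -
  have "X \<in> ball_B \<longleftrightarrow> le_id (tuple_sum n (\<lambda>i. X i * X i))"
    unfolding ball_B_def using msaI[OF X n] msa_forall_level[OF X] by simp
  also have "\<dots> \<longleftrightarrow> row_contraction n (\<lambda>p a l. X p $$ (a, l))"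
    unfolding row_contraction_def
  proof (subst le_id_iff[of _ n], simp add: tuple_sum_def, rule pos_form_congI)
    fix a b assume "a < n" "b < n"
    then show "(if a = b then 1 else 0) - tuple_sum n (\<lambda>i. X i * X i) $$ (a, b) =
        (if a = b then 1 else 0) - (\<Sum>p\<in>UNIV. \<Sum>l<n. X p $$ (a, l) * cnj (X p $$ (b, l)))"
      by (simp add: tuple_sum_def scalar_prod_def msa_levelD[OF X] atLeast0LessThan)
  qed
  finally show ?thesis .
qed

lemma row_contraction_iff:
  "row_contraction n C \<longleftrightarrow>
    (\<forall>h. (\<Sum>p\<in>UNIV. \<Sum>l<n. (cmod (\<Sum>a<n. C p a l * cnj (h a)))\<^sup>2) \<le> (\<Sum>a<n. (cmod (h a))\<^sup>2))"
proof -
  have "form n (\<lambda>a b. (if a = b then 1 else 0) - (\<Sum>p\<in>UNIV. \<Sum>l<n. C p a l * cnj (C p b l))) h =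
      of_real ((\<Sum>a<n. (cmod (h a))\<^sup>2) - (\<Sum>p\<in>UNIV. \<Sum>l<n. (cmod (\<Sum>a<n. C p a l * cnj (h a)))\<^sup>2))" for h
  proof -
    have "(\<Sum>a<n. \<Sum>b<n. (if a = b then 1 else 0) * h b * cnj (h a)) =
        (\<Sum>a<n. \<Sum>b<n. if b = a then h a * cnj (h a) else 0)"
      by (intro sum.cong refl) auto
    then have 1: "(\<Sum>a<n. \<Sum>b<n. (if a = b then 1 else 0) * h b * cnj (h a)) = of_real (\<Sum>a<n. (cmod (h a))\<^sup>2)"
      by (simp add: complex_norm_square del: of_real_power)
    have "(\<Sum>a<n. \<Sum>b<n. (\<Sum>p\<in>UNIV. \<Sum>l<n. C p a l * cnj (C p b l)) * h b * cnj (h a)) =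
        (\<Sum>a<n. \<Sum>b<n. \<Sum>p\<in>UNIV. \<Sum>l<n. (C p a l * cnj (h a)) * cnj (C p b l * cnj (h b)))"
      unfolding sum_distrib_right by (intro sum.cong refl) simp
    also have "\<dots> = (\<Sum>a<n. \<Sum>p\<in>UNIV. \<Sum>b<n. \<Sum>l<n. (C p a l * cnj (h a)) * cnj (C p b l * cnj (h b)))"
      by (intro sum.cong refl sum.swap)
    also have "\<dots> = (\<Sum>p\<in>UNIV. \<Sum>a<n. \<Sum>b<n. \<Sum>l<n. (C p a l * cnj (h a)) * cnj (C p b l * cnj (h b)))"
      by (rule sum.swap)
    also have "\<dots> = (\<Sum>p\<in>UNIV. \<Sum>a<n. \<Sum>l<n. \<Sum>b<n. (C p a l * cnj (h a)) * cnj (C p b l * cnj (h b)))"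
      by (intro sum.cong refl sum.swap)
    also have "\<dots> = (\<Sum>p\<in>UNIV. \<Sum>l<n. \<Sum>a<n. \<Sum>b<n. (C p a l * cnj (h a)) * cnj (C p b l * cnj (h b)))"
      by (intro sum.cong refl sum.swap)
    also have "\<dots> = of_real (\<Sum>p\<in>UNIV. \<Sum>l<n. (cmod (\<Sum>a<n. C p a l * cnj (h a)))\<^sup>2)"
      by (simp only: of_real_sum complex_norm_square cnj_sum sum_product)
    finally show ?thesis
      using 1 by (simp add: form_def left_diff_distrib sum_subtractf del: of_real_power)
  qed
  then show ?thesis
    unfolding row_contraction_def pos_form_def by (simp add: complex_nonneg_iff del: of_real_diff)
qed

lemma ball_B_iff_norm:
  assumes X: "X \<in> msa_level n" and n: "1 \<le> n"
  shows "X \<in> ball_B \<longleftrightarrow>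
    (\<forall>h. (\<Sum>p\<in>UNIV. \<Sum>l<n. (cmod (\<Sum>a<n. X p $$ (l, a) * h a))\<^sup>2) \<le> (\<Sum>a<n. (cmod (h a))\<^sup>2))"
proof -
  have "cmod (\<Sum>a<n. X p $$ (a, l) * cnj (h a)) = cmod (\<Sum>a<n. X p $$ (l, a) * h a)" if "l < n" for p l h
  proof -
    have "(\<Sum>a<n. X p $$ (a, l) * cnj (h a)) = cnj (\<Sum>a<n. X p $$ (l, a) * h a)"
      using that by (simp add: cnj_sum msa_levelD[OF X])
    then show ?thesis by (simp only: complex_mod_cnj)
  qed
  then show ?thesis unfolding ball_B_iff[OF assms] row_contraction_iff by simp
qed

definition tensor_le :: "nat \<Rightarrow> nat \<Rightarrow> ('d::finite \<Rightarrow> complex mat) \<Rightarrow> ('d \<Rightarrow> complex mat) \<Rightarrow> bool" where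
  "tensor_le n m X Y \<longleftrightarrow> (\<forall>h. 0 \<le> bform n m
    (\<lambda>a b i j. (if a = b \<and> i = j then 1 else 0) - (\<Sum>p\<in>UNIV. X p $$ (a, b) * Y p $$ (i, j))) h)"

lemma le_id_kron_iff:
  assumes "\<And>p. X p \<in> carrier_mat n n" "\<And>p. Y p \<in> carrier_mat m m"
  shows "le_id (tuple_sum (n * m) (\<lambda>p. X p \<otimes>\<^sub>k Y p)) \<longleftrightarrow> tensor_le n m X Y"
  unfolding tensor_le_def pos_form_block_iff[symmetric]
proof (subst le_id_iff[of _ "n * m"], simp add: tuple_sum_def, rule pos_form_congI)
  fix x y assume xy: "x < n * m" "y < n * m"
  have dims: "dim_row (X p) = n" "dim_row (Y p) = m" "dim_col (Y p) = m" for p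
    using assms[of p] by auto
  have eq: "x = y \<longleftrightarrow> x div m = y div m \<and> x mod m = y mod m"
    by (metis div_mult_mod_eq)
  show "(if x = y then 1 else 0) - tuple_sum (n * m) (\<lambda>p. X p \<otimes>\<^sub>k Y p) $$ (x, y) =
      (if x div m = y div m \<and> x mod m = y mod m then 1 else 0) -
      (\<Sum>p\<in>UNIV. X p $$ (x div m, y div m) * Y p $$ (x mod m, y mod m))"
    using xy block_index_bounds[OF xy(1)] block_index_bounds[OF xy(2)]
    unfolding eq by (simp add: tuple_sum_def kron_def block_mat_def dims)
qed

lemma bform_flip: "bform n m P h = bform m n (\<lambda>i j a b. P a b i j) (\<lambda>i a. h a i)"
proof -
  have "bform n m P h = (\<Sum>a<n. \<Sum>i<m. \<Sum>b<n. \<Sum>j<m. P a b i j * h b j * cnj (h a i))"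
    unfolding bform_def by (intro sum.cong refl sum.swap)
  also have "\<dots> = (\<Sum>i<m. \<Sum>a<n. \<Sum>j<m. \<Sum>b<n. P a b i j * h b j * cnj (h a i))"
    by (subst sum.swap) (intro sum.cong refl sum.swap)
  also have "\<dots> = bform m n (\<lambda>i j a b. P a b i j) (\<lambda>i a. h a i)"
    unfolding bform_def by (intro sum.cong refl sum.swap)
  finally show ?thesis .
qed

lemma tensor_le_flip: "tensor_le n m X Y \<Longrightarrow> tensor_le m n Y X"
  unfolding tensor_le_def
  by (subst (asm) bform_flip) (auto simp: conj_commute mult.commute elim!: allE[where x = "\<lambda>a i. _ i a"])

lemma polar_dual_iff:
  assumes X: "X \<in> msa_level n" and n: "1 \<le> n"
  shows "X \<in> polar_dual S \<longleftrightarrow> (\<forall>Y\<in>S. \<forall>m. Y \<in> msa_level m \<longrightarrow> tensor_le n m X Y)"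
proof -
  have "le_id (tuple_sum (n * m) (\<lambda>p. X p \<otimes>\<^sub>k Y p)) \<longleftrightarrow> tensor_le n m X Y" if "Y \<in> msa_level m" for m Y
    using le_id_kron_iff[of X n Y m] msa_levelD(1)[OF X] msa_levelD(1)[OF that] by simp
  then show ?thesis
    unfolding polar_dual_def using msaI[OF X n] msa_level_unique[OF X] X by blast
qed

lemma psd_block_hermitian:
  assumes "psd (block_mat m n T)" "a < m" "b < m" "i < n" "j < n"
  shows "T a b $$ (i, j) = cnj (T b a $$ (j, i))"
proof -
  have P: "pos_form (m * n) (\<lambda>x y. T (x div n) (y div n) $$ (x mod n, y mod n))"
    using assms(1) by (subst psd_cong[symmetric]) (auto simp: block_mat_def)
  have bound: "k + c * n < m * n" if "c < m" "k < n" for c k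
  proof -
    have "k + c * n < Suc c * n" using that by simp
    also have "\<dots> \<le> m * n" using that by (intro mult_le_mono1) simp
    finally show ?thesis .
  qed
  show ?thesis
    using pos_form_hermitian[OF P bound[of a i] bound[of b j]] assms by simp
qed

section \<open>UCP maps on bounded operators, and the pairing of the Lehner ball with the matrix
  range\<close>

lemma ucp_opD:
  assumes "ucp_op k \<phi>"
  shows "S \<in> bounded_ops \<Longrightarrow> \<phi> S \<in> carrier_mat k k"
    "S \<in> bounded_ops \<Longrightarrow> T \<in> bounded_ops \<Longrightarrow> \<phi> (\<lambda>x. S x + T x) = \<phi> S + \<phi> T"
    "S \<in> bounded_ops \<Longrightarrow> \<phi> (\<lambda>x. c *\<^sub>C S x) = c \<cdot>\<^sub>m \<phi> S"
    "\<phi> (\<lambda>x. x) = 1\<^sub>m k"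
    "(\<And>a b. a < m \<Longrightarrow> b < m \<Longrightarrow> U a b \<in> bounded_ops) \<Longrightarrow> op_block_pos m U \<Longrightarrow>
      psd (block_mat m k (\<lambda>a b. \<phi> (U a b)))"
proof -
  note u = assms[unfolded ucp_op_def]
  show "\<phi> S \<in> carrier_mat k k" if "S \<in> bounded_ops"
    using u[THEN conjunct1] that by (rule bspec)
  show "\<phi> (\<lambda>x. S x + T x) = \<phi> S + \<phi> T" if "S \<in> bounded_ops" "T \<in> bounded_ops"
    using u[THEN conjunct2, THEN conjunct1, THEN bspec, OF that(1)] that(2) by (rule bspec)
  show "\<phi> (\<lambda>x. c *\<^sub>C S x) = c \<cdot>\<^sub>m \<phi> S" if "S \<in> bounded_ops"
    using u[THEN conjunct2, THEN conjunct2, THEN conjunct1, THEN spec] that by (rule bspec)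
  show "\<phi> (\<lambda>x. x) = 1\<^sub>m k"
    using u[THEN conjunct2, THEN conjunct2, THEN conjunct2, THEN conjunct1] .
  show "psd (block_mat m k (\<lambda>a b. \<phi> (U a b)))"
    if "\<And>a b. a < m \<Longrightarrow> b < m \<Longrightarrow> U a b \<in> bounded_ops" "op_block_pos m U"
    using u[THEN conjunct2, THEN conjunct2, THEN conjunct2, THEN conjunct2, THEN spec, THEN spec, of m U] that
    by simp
qed

lemma ucp_op_sum:
  assumes \<phi>: "ucp_op k \<phi>" and "finite I" "\<And>i. i \<in> I \<Longrightarrow> S i \<in> bounded_ops" "a < k" "b < k"
  shows "\<phi> (\<lambda>x. \<Sum>i\<in>I. S i x) $$ (a, b) = (\<Sum>i\<in>I. \<phi> (S i) $$ (a, b))"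
  using assms(2,3)
proof (induction I rule: finite_induct)
  case empty
  have "\<phi> (\<lambda>x. 0) = 0 \<cdot>\<^sub>m \<phi> (\<lambda>x. 0)"
    using ucp_opD(3)[OF \<phi> bounded_ops_zero, of 0] by (simp only: scaleC_zero_right)
  then have "\<phi> (\<lambda>x. 0) $$ (a, b) = (0 \<cdot>\<^sub>m \<phi> (\<lambda>x. 0)) $$ (a, b)" by (rule arg_cong)
  also have "\<dots> = 0" using ucp_opD(1)[OF \<phi> bounded_ops_zero] assms(4,5) by simp
  finally show ?case by simp
next
  case (insert i I)
  have b: "S i \<in> bounded_ops" "(\<lambda>x. \<Sum>i\<in>I. S i x) \<in> bounded_ops"
    using insert by (auto intro: bounded_ops_sum)
  have "\<phi> (\<lambda>x. S i x + (\<Sum>i\<in>I. S i x)) = \<phi> (S i) + \<phi> (\<lambda>x. \<Sum>i\<in>I. S i x)"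
    by (rule ucp_opD(2)[OF \<phi> b])
  moreover have "\<phi> (\<lambda>x. \<Sum>i\<in>I. S i x) \<in> carrier_mat k k"
    by (rule ucp_opD(1)[OF \<phi> b(2)])
  ultimately show ?case using insert assms(4,5) by simp
qed

text \<open>The operator matrix with rows \<open>1, S\<close> and \<open>S, S^2\<close> is positive,
  as its form at \<open>h\<close> is the squared norm of \<open>h 0 + S (h 1)\<close>. Its image is
  positive, hence hermitian, and the two off-diagonal blocks of the image are both
  \<open>\<phi> S\<close>.\<close>

lemma ucp_op_hermitian:
  assumes \<phi>: "ucp_op k \<phi>" and S: "S \<in> bounded_ops" and sym: "\<And>x y. cinner (S x) y = cinner x (S y)"
    and ab: "a < k" "b < k"
  shows "\<phi> S $$ (a, b) = cnj (\<phi> S $$ (b, a))"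
proof -
  define T where "T a b = (if a = 0 then if b = 0 then (\<lambda>x. x) else S
    else if b = 0 then S else (\<lambda>x. S (S x)))" for a b :: nat
  have bT: "T a b \<in> bounded_ops" for a b
    using S by (simp add: T_def bounded_ops_id bounded_ops_comp[OF S S])
  have "op_block_pos 2 T"
    unfolding op_block_pos_def
  proof
    fix h
    have "(\<Sum>a<2. \<Sum>b<2. cinner (T a b (h b)) (h a)) = cinner (h 0 + S (h 1)) (h 0 + S (h 1))"
      by (simp add: T_def numeral_2_eq_2 cinner_add_left cinner_add_right sym)
    then show "0 \<le> (\<Sum>a<2. \<Sum>b<2. cinner (T a b (h b)) (h a))" by (simp add: cinner_self_nonneg)
  qed
  then have "psd (block_mat 2 k (\<lambda>a b. \<phi> (T a b)))" by (intro ucp_opD(5)[OF \<phi>] bT)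
  from psd_block_hermitian[OF this, of 0 1 a b] ab show ?thesis by (simp add: T_def)
qed

lemma matrix_range_in_msa_level:
  assumes "ucp_op n \<phi>"
  shows "(\<lambda>p. \<phi> (half_semicircular p)) \<in> msa_level n"
  unfolding msa_level_iff
proof (intro allI conjI impI)
  show "\<phi> (half_semicircular p) \<in> carrier_mat n n" for p
    by (rule ucp_opD(1)[OF assms half_semicircular_bounded])
  show "\<phi> (half_semicircular p) $$ (a, b) = cnj (\<phi> (half_semicircular p) $$ (b, a))"
    if "a < n" "b < n" for p a b
    by (rule ucp_op_hermitian[OF assms half_semicircular_bounded half_semicircular_symmetric that])
qed

lemma matrix_range_cases:
  assumes "Y \<in> matrix_range half_semicircular" "Y \<in> msa_level m"
  obtains \<phi> where "ucp_op m \<phi>" "Y = (\<lambda>p. \<phi> (half_semicircular p))"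
proof -
  obtain n where "Y \<in> {(\<lambda>p. \<phi> (half_semicircular p)) | \<phi>. ucp_op n \<phi>}"
    using assms(1) unfolding matrix_range_def by (rule UN_E)
  then obtain \<phi> where \<phi>: "Y = (\<lambda>p. \<phi> (half_semicircular p))" "ucp_op n \<phi>"
    unfolding mem_Collect_eq by (elim exE conjE)
  have "Y \<in> msa_level n" unfolding \<phi>(1) by (rule matrix_range_in_msa_level[OF \<phi>(2)])
  then have "n = m" by (rule msa_level_unique[OF _ assms(2)])
  then show ?thesis using that[OF _ \<phi>(1)] \<phi>(2) by simp
qed

lemma Lehner_tensor_range:
  fixes X Y :: "'d::finite \<Rightarrow> complex mat"
  assumes X: "X \<in> Lehner_ball" "X \<in> msa_level n"
    and Y: "Y \<in> matrix_range half_semicircular" "Y \<in> msa_level m"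
  shows "tensor_le n m X Y"
proof -
  obtain \<phi> where \<phi>: "ucp_op m \<phi>" "Y = (\<lambda>p. \<phi> (half_semicircular p))"
    using matrix_range_cases[OF Y] .
  \<comment> \<open>The linearity clauses of \<open>ucp_op\<close> speak of sums and scalar
    multiples. So the diagonal and the off-diagonal entries of the identity are both written as
    multiples of the identity map, and the subtraction in \<open>T\<close> as adding a multiple by
    -1.\<close>
  define I where "I a b = (\<lambda>h :: 'd fock. (if a = b then 1 else 0) *\<^sub>C h)" for a b :: nat
  define R where "R a b = (\<lambda>h. \<Sum>p\<in>UNIV. X p $$ (a, b) *\<^sub>C half_semicircular p h)" for a b
  define T where "T a b = (\<lambda>h. I a b h + (-1) *\<^sub>C R a b h)" for a b
  have bI: "I a b \<in> bounded_ops" for a b unfolding I_def by (intro bounded_ops_scaleC bounded_ops_id)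
  have bR: "R a b \<in> bounded_ops" for a b
    unfolding R_def by (intro bounded_ops_sum bounded_ops_scaleC half_semicircular_bounded)
  have bT: "T a b \<in> bounded_ops" for a b
    unfolding T_def by (intro bounded_ops_add bounded_ops_scaleC bI bR)
  have minus: "(-1) *\<^sub>C x = - x" for x :: "'d fock"
    using scaleC_of_real[of "-1" x] by simp
  have "op_block_pos n (\<lambda>a b h. (if a = b then h else 0)
      - (\<Sum>i\<in>UNIV. X i $$ (a, b) *\<^sub>C half_semicircular i h))"
    using X unfolding Lehner_ball_def by blast
  moreover have "(\<lambda>a b h. (if a = b then h else 0)
      - (\<Sum>i\<in>UNIV. X i $$ (a, b) *\<^sub>C half_semicircular i h)) = T"
    by (intro ext) (simp add: T_def I_def R_def minus)
  ultimately have "psd (block_mat n m (\<lambda>a b. \<phi> (T a b)))"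
    by (intro ucp_opD(5)[OF \<phi>(1)] bT) simp
  moreover have "\<phi> (T a b) $$ (i, j) =
      (if a = b \<and> i = j then 1 else 0) - (\<Sum>p\<in>UNIV. X p $$ (a, b) * Y p $$ (i, j))"
    if ij: "i < m" "j < m" for a b i j
  proof -
    have c: "\<phi> S \<in> carrier_mat m m" if "S \<in> bounded_ops" for S
      by (rule ucp_opD(1)[OF \<phi>(1) that])
    have "\<phi> (T a b) = \<phi> (I a b) + \<phi> (\<lambda>h. (-1) *\<^sub>C R a b h)"
      unfolding T_def by (rule ucp_opD(2)[OF \<phi>(1) bI bounded_ops_scaleC[OF bR]])
    also have "\<phi> (\<lambda>h. (-1) *\<^sub>C R a b h) = (-1) \<cdot>\<^sub>m \<phi> (R a b)"
      by (rule ucp_opD(3)[OF \<phi>(1) bR])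
    also have "\<phi> (I a b) = (if a = b then 1 else 0) \<cdot>\<^sub>m 1\<^sub>m m"
      unfolding I_def ucp_opD(3)[OF \<phi>(1) bounded_ops_id] ucp_opD(4)[OF \<phi>(1)] ..
    finally have "\<phi> (T a b) $$ (i, j) = (if a = b \<and> i = j then 1 else 0) - \<phi> (R a b) $$ (i, j)"
      using ij carrier_matD[OF c[OF bR]] by simp
    also have "\<phi> (R a b) $$ (i, j) = (\<Sum>p\<in>UNIV. \<phi> (\<lambda>h. X p $$ (a, b) *\<^sub>C half_semicircular p h) $$ (i, j))"
      unfolding R_def using ij
      by (intro ucp_op_sum[OF \<phi>(1)] bounded_ops_scaleC half_semicircular_bounded) auto
    also have "\<dots> = (\<Sum>p\<in>UNIV. X p $$ (a, b) * Y p $$ (i, j))"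
    proof (rule sum.cong[OF refl])
      fix p
      have "\<phi> (\<lambda>h. X p $$ (a, b) *\<^sub>C half_semicircular p h) = X p $$ (a, b) \<cdot>\<^sub>m \<phi> (half_semicircular p)"
        by (rule ucp_opD(3)[OF \<phi>(1) half_semicircular_bounded])
      then show "\<phi> (\<lambda>h. X p $$ (a, b) *\<^sub>C half_semicircular p h) $$ (i, j) = X p $$ (a, b) * Y p $$ (i, j)"
        using ij c[OF half_semicircular_bounded, of p] by (simp add: \<phi>(2))
    qed
    finally show ?thesis .
  qed
  ultimately show ?thesis
    unfolding psd_block_mat_iff tensor_le_def bform_def by simp
qed

text \<open>A selfadjoint tuple is its own real part, so the result on row contractions applies with
  the tuple itself as \<open>C\<close>.\<close>

lemma ball_B_subset_range:
  assumes "2 \<le> CARD('d::finite)"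
  shows "(ball_B :: ('d \<Rightarrow> complex mat) set) \<subseteq> matrix_range half_semicircular"
proof
  fix X :: "'d \<Rightarrow> complex mat" assume X: "X \<in> ball_B"
  then obtain n where n: "1 \<le> n" "X \<in> msa_level n" by (auto simp: ball_B_def elim: msaE)
  have "(\<lambda>p. mat n n (\<lambda>(i, j). (X p $$ (i, j) + cnj (X p $$ (j, i))) / 2)) \<in> matrix_range half_semicircular"
    using X ball_B_iff[OF n(2,1)]
    by (intro contraction_real_part_in_range[OF assms n(1)]) (simp add: row_contraction_def)
  also have "(\<lambda>p. mat n n (\<lambda>(i, j). (X p $$ (i, j) + cnj (X p $$ (j, i))) / 2)) = X"
    by (intro ext eq_matI) (auto simp: msa_levelD[OF n(2)])
  finally show "X \<in> matrix_range half_semicircular" .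
qed

text \<open>A factorisation of \<open>P\<close> writes the sum as squared norms of combinations of
  the \<open>h b\<close>. This carries the defining inequality of \<open>ball_B\<close> from scalar
  vectors to vectors of Fock space vectors.\<close>

lemma pos_form_cinner:
  assumes "pos_form m P"
  shows "0 \<le> (\<Sum>a<m. \<Sum>b<m. P a b * cinner (h b) (h a))"
proof -
  obtain Q where Q: "\<And>a b. a < m \<Longrightarrow> b < m \<Longrightarrow> P a b = (\<Sum>k<m. Q a k * cnj (Q b k))"
    using pos_form_factor[OF assms] by blast
  have "(\<Sum>a<m. \<Sum>b<m. P a b * cinner (h b) (h a)) =
      (\<Sum>a<m. \<Sum>b<m. \<Sum>k<m. cinner (cnj (Q b k) *\<^sub>C h b) (cnj (Q a k) *\<^sub>C h a))"
  proof (intro sum.cong refl)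
    fix a b assume "a \<in> {..<m}" "b \<in> {..<m}"
    then have ab: "a < m" "b < m" by auto
    show "P a b * cinner (h b) (h a) = (\<Sum>k<m. cinner (cnj (Q b k) *\<^sub>C h b) (cnj (Q a k) *\<^sub>C h a))"
      unfolding Q[OF ab] sum_distrib_right
      by (intro sum.cong refl) (simp add: cinner_scaleC_left cinner_scaleC_right)
  qed
  also have "\<dots> = (\<Sum>a<m. \<Sum>k<m. \<Sum>b<m. cinner (cnj (Q b k) *\<^sub>C h b) (cnj (Q a k) *\<^sub>C h a))"
    by (intro sum.cong refl sum.swap)
  also have "\<dots> = (\<Sum>k<m. \<Sum>a<m. \<Sum>b<m. cinner (cnj (Q b k) *\<^sub>C h b) (cnj (Q a k) *\<^sub>C h a))"
    by (rule sum.swap)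
  also have "\<dots> = (\<Sum>k<m. cinner (\<Sum>b<m. cnj (Q b k) *\<^sub>C h b) (\<Sum>a<m. cnj (Q a k) *\<^sub>C h a))"
    unfolding cinner_sum_right by (simp only: cinner_sum_left)
  also have "0 \<le> \<dots>" by (intro sum_nonneg cinner_self_nonneg)
  finally show ?thesis .
qed

text \<open>Component \<open>a\<close> of \<open>sum_p X_p tensor l_p\<close> applied to
  \<open>h\<close>, an operator on \<open>n\<close> copies of the Fock space.\<close>

definition creation_row ::
    "('d::finite \<Rightarrow> complex mat) \<Rightarrow> nat \<Rightarrow> (nat \<Rightarrow> 'd fock) \<Rightarrow> nat \<Rightarrow> 'd fock" where
  "creation_row X n h a = (\<Sum>p\<in>UNIV. creation p (\<Sum>b<n. X p $$ (a, b) *\<^sub>C h b))"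

lemma norm_creation_row:
  "(norm (creation_row X n h a))\<^sup>2 = (\<Sum>p\<in>UNIV. (norm (\<Sum>b<n. X p $$ (a, b) *\<^sub>C h b))\<^sup>2)"
proof -
  have "complex_of_real ((norm (creation_row X n h a))\<^sup>2) =
      of_real (\<Sum>p\<in>UNIV. (norm (\<Sum>b<n. X p $$ (a, b) *\<^sub>C h b))\<^sup>2)"
    unfolding creation_row_def cinner_self[symmetric] of_real_sum
    by (simp only: cinner_sum_left cinner_sum_right cinner_creation) simp
  then show ?thesis by (simp only: of_real_eq_iff)
qed

text \<open>Since the \<open>X p\<close> are selfadjoint and \<open>s_p\<close> is
  \<open>l_p\<close> plus its adjoint, the form of \<open>sum_p X_p tensor s_p / 2\<close> is the
  real part of the form of \<open>creation_row\<close>. Membership thus becomes an estimate of real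
  inner products.\<close>

lemma Lehner_ball_iff:
  assumes X: "X \<in> msa_level n" and n: "1 \<le> n"
  shows "X \<in> Lehner_ball \<longleftrightarrow>
    (\<forall>h. (\<Sum>a<n. inner (creation_row X n h a) (h a)) \<le> (\<Sum>a<n. (norm (h a))\<^sup>2))"
proof -
  have "(\<Sum>a<n. \<Sum>b<n. cinner ((if a = b then h b else 0) -
        (\<Sum>p\<in>UNIV. X p $$ (a, b) *\<^sub>C half_semicircular p (h b))) (h a)) =
      of_real ((\<Sum>a<n. (norm (h a))\<^sup>2) - (\<Sum>a<n. inner (creation_row X n h a) (h a)))" for h
  proof -
    define S where "S = (\<Sum>a<n. \<Sum>b<n. \<Sum>p\<in>UNIV. X p $$ (a, b) * cinner (creation p (h b)) (h a))"
    have row: "(\<Sum>a<n. cinner (creation_row X n h a) (h a)) = S"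
      unfolding S_def creation_row_def bounded_opsD(2,4)[OF creation_bounded]
        cinner_sum_left cinner_scaleC_left by (intro sum.cong refl sum.swap)
    have "cnj S = (\<Sum>a<n. \<Sum>b<n. \<Sum>p\<in>UNIV. X p $$ (b, a) * cinner (h a) (creation p (h b)))"
      unfolding S_def cnj_sum by (intro sum.cong refl) (simp add: msa_levelD[OF X] flip: cinner_commute)
    also have "\<dots> = (\<Sum>a<n. \<Sum>b<n. \<Sum>p\<in>UNIV. X p $$ (a, b) * cinner (h b) (creation p (h a)))"
      by (rule sum.swap)
    finally have cS: "(\<Sum>a<n. \<Sum>b<n. \<Sum>p\<in>UNIV. X p $$ (a, b) * cinner (h b) (creation p (h a))) = cnj S" ..
    have "(\<Sum>a<n. \<Sum>b<n. cinner ((if a = b then h b else 0) -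
          (\<Sum>p\<in>UNIV. X p $$ (a, b) *\<^sub>C half_semicircular p (h b))) (h a)) =
        (\<Sum>a<n. \<Sum>b<n. if b = a then cinner (h a) (h a) else 0) - (S + cnj S) / 2"
      unfolding cS[symmetric] unfolding S_def
      by (simp add: cinner_diff_left cinner_sum_left cinner_scaleC_left cinner_half_semicircular
          sum_subtractf sum.distrib distrib_left add_divide_distrib sum_divide_distrib
          if_distrib[of "\<lambda>x. cinner x _"] cong: if_cong)
    also have "(S + cnj S) / 2 = of_real (Re S)" by (simp add: complex_add_cnj)
    also have "Re S = (\<Sum>a<n. inner (creation_row X n h a) (h a))"
      unfolding row[symmetric] by (simp add: inner_eq_Re_cinner)
    finally show ?thesis by (simp add: cinner_self)
  qed
  then have "op_block_pos n (\<lambda>a b h. (if a = b then h else 0)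
       - (\<Sum>i\<in>UNIV. X i $$ (a, b) *\<^sub>C half_semicircular i h)) \<longleftrightarrow>
    (\<forall>h. (\<Sum>a<n. inner (creation_row X n h a) (h a)) \<le> (\<Sum>a<n. (norm (h a))\<^sup>2))"
    unfolding op_block_pos_def by (simp add: complex_nonneg_iff del: of_real_diff)
  then show ?thesis
    unfolding Lehner_ball_def using msaI[OF X n] msa_forall_level[OF X] by simp
qed

lemma ball_B_creation_row_le:
  assumes X: "X \<in> ball_B" "X \<in> msa_level n" and n: "1 \<le> n"
  shows "(\<Sum>a<n. (norm (creation_row X n h a))\<^sup>2) \<le> (\<Sum>a<n. (norm (h a))\<^sup>2)"
proof -
  let ?P = "\<lambda>a b. (if a = b then 1 else 0) - (\<Sum>p\<in>UNIV. \<Sum>l<n. X p $$ (a, l) * cnj (X p $$ (b, l)))"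
  have "pos_form n ?P" using X ball_B_iff[OF X(2) n] by (simp add: row_contraction_def)
  then have "0 \<le> (\<Sum>a<n. \<Sum>b<n. ?P a b * cinner (h b) (h a))" by (rule pos_form_cinner)
  also have "\<dots> = (\<Sum>a<n. \<Sum>b<n. if b = a then cinner (h a) (h a) else 0) -
      (\<Sum>a<n. \<Sum>b<n. \<Sum>p\<in>UNIV. \<Sum>l<n. X p $$ (a, l) * cnj (X p $$ (b, l)) * cinner (h b) (h a))"
    unfolding sum_subtractf[symmetric]
    by (intro sum.cong refl) (simp add: left_diff_distrib sum_distrib_right)
  also have "(\<Sum>a<n. \<Sum>b<n. \<Sum>p\<in>UNIV. \<Sum>l<n. X p $$ (a, l) * cnj (X p $$ (b, l)) * cinner (h b) (h a)) =
      (\<Sum>l<n. \<Sum>a<n. \<Sum>b<n. \<Sum>p\<in>UNIV. X p $$ (a, l) * cnj (X p $$ (b, l)) * cinner (h b) (h a))"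
    by (rule sum_swap_inner3)
  also have "\<dots> = (\<Sum>l<n. \<Sum>p\<in>UNIV. \<Sum>a<n. \<Sum>b<n. X p $$ (a, l) * cnj (X p $$ (b, l)) * cinner (h b) (h a))"
    by (simp only: sum.swap[where B = "UNIV :: 'a set"])
  also have "\<dots> = (\<Sum>l<n. \<Sum>p\<in>UNIV. \<Sum>a<n. \<Sum>b<n.
      cinner (X p $$ (l, b) *\<^sub>C h b) (X p $$ (l, a) *\<^sub>C h a))"
    by (intro sum.cong refl) (simp add: cinner_scaleC_left cinner_scaleC_right msa_levelD[OF X(2)])
  also have "\<dots> = (\<Sum>l<n. of_real ((norm (creation_row X n h l))\<^sup>2))"
    unfolding norm_creation_row of_real_sum cinner_self[symmetric]
    unfolding cinner_sum_right by (simp only: cinner_sum_left)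
  finally show ?thesis
    by (simp add: cinner_self complex_nonneg_iff flip: of_real_power of_real_sum of_real_diff)
qed

lemma two_inner_le: "2 * inner x y \<le> (norm x)\<^sup>2 + (norm y)\<^sup>2"
  using zero_le_power2[of "norm (x - y)"] by (simp add: power2_norm_eq_inner inner_diff inner_commute)

lemma ball_B_subset_Lehner: "ball_B \<subseteq> Lehner_ball"
proof
  fix X :: "'d::finite \<Rightarrow> complex mat" assume X: "X \<in> ball_B"
  then obtain n where n: "1 \<le> n" "X \<in> msa_level n" by (auto simp: ball_B_def elim: msaE)
  show "X \<in> Lehner_ball"
    unfolding Lehner_ball_iff[OF n(2,1)]
  proof
    fix h :: "nat \<Rightarrow> 'd fock"
    have "2 * (\<Sum>a<n. inner (creation_row X n h a) (h a)) \<le>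
        (\<Sum>a<n. (norm (creation_row X n h a))\<^sup>2) + (\<Sum>a<n. (norm (h a))\<^sup>2)"
      unfolding sum_distrib_left sum.distrib[symmetric] by (intro sum_mono two_inner_le)
    also have "\<dots> \<le> 2 * (\<Sum>a<n. (norm (h a))\<^sup>2)"
      using ball_B_creation_row_le[OF X n(2,1), of h] by simp
    finally show "(\<Sum>a<n. inner (creation_row X n h a) (h a)) \<le> (\<Sum>a<n. (norm (h a))\<^sup>2)" by simp
  qed
qed

lemma Lehner_subset_polar:
  assumes "2 \<le> CARD('d::finite)"
  shows "(Lehner_ball :: ('d \<Rightarrow> complex mat) set) \<subseteq> polar_dual ball_B"
proof
  fix X :: "'d \<Rightarrow> complex mat" assume X: "X \<in> Lehner_ball"
  then obtain n where n: "1 \<le> n" "X \<in> msa_level n" by (auto simp: Lehner_ball_def elim: msaE)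
  show "X \<in> polar_dual ball_B"
    unfolding polar_dual_iff[OF n(2,1)]
    using Lehner_tensor_range[OF X n(2)] ball_B_subset_range[OF assms] by blast
qed

lemma range_subset_polar:
  "matrix_range half_semicircular \<subseteq> polar_dual ball_B"
proof
  fix X :: "'d::finite \<Rightarrow> complex mat" assume X: "X \<in> matrix_range half_semicircular"
  then obtain n where n: "1 \<le> n" "X \<in> msa_level n"
    using matrix_range_in_msa_level unfolding matrix_range_def by auto
  show "X \<in> polar_dual ball_B"
    unfolding polar_dual_iff[OF n(2,1)]
    using Lehner_tensor_range[OF _ _ X n(2)] ball_B_subset_Lehner tensor_le_flip by blast
qed

section \<open>Matrix convexity, and the minimal and maximal sets over the ball\<close>

lemma ucp_matD:
  assumes "ucp_mat n k \<phi>"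
  shows "A \<in> carrier_mat n n \<Longrightarrow> \<phi> A \<in> carrier_mat k k"
    "A \<in> carrier_mat n n \<Longrightarrow> B \<in> carrier_mat n n \<Longrightarrow> \<phi> (A + B) = \<phi> A + \<phi> B"
    "A \<in> carrier_mat n n \<Longrightarrow> \<phi> (c \<cdot>\<^sub>m A) = c \<cdot>\<^sub>m \<phi> A"
    "\<phi> (1\<^sub>m n) = 1\<^sub>m k"
    "(\<And>a b. a < m \<Longrightarrow> b < m \<Longrightarrow> T a b \<in> carrier_mat n n) \<Longrightarrow> psd (block_mat m n T) \<Longrightarrow>
      psd (block_mat m k (\<lambda>a b. \<phi> (T a b)))"
proof -
  note u = assms[unfolded ucp_mat_def]
  show "\<phi> A \<in> carrier_mat k k" if "A \<in> carrier_mat n n"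
    using u[THEN conjunct1] that by (rule bspec)
  show "\<phi> (A + B) = \<phi> A + \<phi> B" if "A \<in> carrier_mat n n" "B \<in> carrier_mat n n"
    using u[THEN conjunct2, THEN conjunct1, THEN bspec, OF that(1)] that(2) by (rule bspec)
  show "\<phi> (c \<cdot>\<^sub>m A) = c \<cdot>\<^sub>m \<phi> A" if "A \<in> carrier_mat n n"
    using u[THEN conjunct2, THEN conjunct2, THEN conjunct1, THEN spec] that by (rule bspec)
  show "\<phi> (1\<^sub>m n) = 1\<^sub>m k"
    using u[THEN conjunct2, THEN conjunct2, THEN conjunct2, THEN conjunct1] .
  show "psd (block_mat m k (\<lambda>a b. \<phi> (T a b)))"
    if "\<And>a b. a < m \<Longrightarrow> b < m \<Longrightarrow> T a b \<in> carrier_mat n n" "psd (block_mat m n T)"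
    using u[THEN conjunct2, THEN conjunct2, THEN conjunct2, THEN conjunct2, THEN spec, THEN spec, of m T] that
    by simp
qed

lemma ucp_mat_sum:
  assumes \<phi>: "ucp_mat n k \<phi>" and A: "\<And>p. A p \<in> carrier_mat n n" and "finite I" and ij: "i < k" "j < k"
  shows "\<phi> (mat n n (\<lambda>q. \<Sum>p\<in>I. c p * A p $$ q)) $$ (i, j) = (\<Sum>p\<in>I. c p * \<phi> (A p) $$ (i, j))"
  using assms(3)
proof (induction I rule: finite_induct)
  case empty
  have "mat n n (\<lambda>q. 0) = 0 \<cdot>\<^sub>m mat n n (\<lambda>q. 0 :: complex)" by (rule eq_matI) auto
  then have "\<phi> (mat n n (\<lambda>q. 0)) = 0 \<cdot>\<^sub>m \<phi> (mat n n (\<lambda>q. 0))"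
    using ucp_matD(3)[OF \<phi>, of "mat n n (\<lambda>q. 0)" 0] by simp
  then have "\<phi> (mat n n (\<lambda>q. 0)) $$ (i, j) = (0 \<cdot>\<^sub>m \<phi> (mat n n (\<lambda>q. 0))) $$ (i, j)" by (rule arg_cong)
  also have "\<dots> = 0" using ucp_matD(1)[OF \<phi>, of "mat n n (\<lambda>q. 0)"] ij by simp
  finally show ?case by simp
next
  case (insert p I)
  let ?S = "mat n n (\<lambda>q. \<Sum>p\<in>I. c p * A p $$ q)"
  have "mat n n (\<lambda>q. \<Sum>p\<in>insert p I. c p * A p $$ q) = c p \<cdot>\<^sub>m A p + ?S"
    using insert(1,2) A[of p] by (intro eq_matI) auto
  also have "\<phi> (c p \<cdot>\<^sub>m A p + ?S) = c p \<cdot>\<^sub>m \<phi> (A p) + \<phi> ?S"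
    using ucp_matD(2)[OF \<phi>, of "c p \<cdot>\<^sub>m A p" ?S] ucp_matD(3)[OF \<phi> A] A[of p] by simp
  finally show ?case
    using insert ij ucp_matD(1)[OF \<phi> A, of p] ucp_matD(1)[OF \<phi>, of ?S] by simp
qed

lemma ucp_mat_pos_form:
  assumes \<phi>: "ucp_mat n k \<phi>" and A: "A \<in> carrier_mat n n" and pos: "pos_form n (\<lambda>a b. A $$ (a, b))"
  shows "pos_form k (\<lambda>i j. \<phi> A $$ (i, j))"
proof -
  have "bform 1 r (\<lambda>a b i j. B $$ (i, j)) h = form r (\<lambda>i j. B $$ (i, j)) (h 0)" for r h and B :: "complex mat"
    by (simp add: bform_def form_def)
  then have "psd (block_mat 1 r (\<lambda>a b. B)) \<longleftrightarrow>
      (\<forall>h::nat \<Rightarrow> nat \<Rightarrow> complex. 0 \<le> form r (\<lambda>i j. B $$ (i, j)) (h 0))" for r and B :: "complex mat"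
    by (simp only: psd_block_mat_iff)
  moreover have "(\<forall>h::nat \<Rightarrow> nat \<Rightarrow> complex. 0 \<le> F (h 0)) \<longleftrightarrow> (\<forall>h. 0 \<le> F h)" for F :: "(nat \<Rightarrow> complex) \<Rightarrow> complex"
    by (auto dest: spec[of _ "\<lambda>_. _"])
  ultimately have "psd (block_mat 1 r (\<lambda>a b. B)) \<longleftrightarrow> pos_form r (\<lambda>i j. B $$ (i, j))" for r and B :: "complex mat"
    by (simp only: pos_form_def)
  then show ?thesis using ucp_matD(5)[OF \<phi>, of 1 "\<lambda>a b. A"] A pos by simp
qed

lemma ucp_mat_pos_affine:
  fixes A :: "'d::finite \<Rightarrow> complex mat"
  assumes \<phi>: "ucp_mat n k \<phi>" and A: "\<And>p. A p \<in> carrier_mat n n"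
    and pos: "pos_form n (\<lambda>a b. (if a = b then 1 else 0) - (\<Sum>p\<in>UNIV. c p * A p $$ (a, b)))"
  shows "pos_form k (\<lambda>i j. (if i = j then 1 else 0) - (\<Sum>p\<in>UNIV. c p * \<phi> (A p) $$ (i, j)))"
proof -
  let ?S = "mat n n (\<lambda>q. \<Sum>p\<in>UNIV. c p * A p $$ q)"
  let ?M = "1\<^sub>m n + (-1) \<cdot>\<^sub>m ?S"
  have "pos_form n (\<lambda>a b. ?M $$ (a, b))"
    using pos by (subst pos_form_congI) auto
  then have "pos_form k (\<lambda>i j. \<phi> ?M $$ (i, j))"
    by (intro ucp_mat_pos_form[OF \<phi>]) auto
  moreover have "\<phi> ?M $$ (i, j) = (if i = j then 1 else 0) - (\<Sum>p\<in>UNIV. c p * \<phi> (A p) $$ (i, j))"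
    if ij: "i < k" "j < k" for i j
  proof -
    have "\<phi> ?M = 1\<^sub>m k + (-1) \<cdot>\<^sub>m \<phi> ?S"
      using ucp_matD(2)[OF \<phi>, of "1\<^sub>m n" "(-1) \<cdot>\<^sub>m ?S"] ucp_matD(3)[OF \<phi>, of ?S "-1"] ucp_matD(4)[OF \<phi>] by simp
    then show ?thesis
      using ij ucp_matD(1)[OF \<phi>, of ?S] ucp_mat_sum[OF \<phi> A finite ij, of c] by simp
  qed
  ultimately show ?thesis by (subst pos_form_congI) auto
qed

text \<open>The block matrix with rows \<open>1, A\<close> and \<open>A, A\<^sup>2\<close> is positive, so its image under a UCP map
  yields both selfadjointness of \<open>\<phi> A\<close> and the Kadison inequality \<open>\<phi> A\<^sup>2 \<le> \<phi> (A\<^sup>2)\<close>.\<close>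

lemma ucp_mat_hermitian_Kadison:
  assumes \<phi>: "ucp_mat n k \<phi>" and A: "A \<in> carrier_mat n n"
    and herm: "\<And>a b. a < n \<Longrightarrow> b < n \<Longrightarrow> cnj (A $$ (a, b)) = A $$ (b, a)"
  shows "i < k \<Longrightarrow> j < k \<Longrightarrow> \<phi> A $$ (i, j) = cnj (\<phi> A $$ (j, i))"
    and "(\<Sum>l<k. (cmod (\<Sum>j<k. \<phi> A $$ (l, j) * h j))\<^sup>2) \<le> Re (form k (\<lambda>i j. \<phi> (A * A) $$ (i, j)) h)"
proof -
  define T where "T a b = (if a = 0 then if b = 0 then 1\<^sub>m n else A
    else if b = 0 then A else A * A)" for a b :: nat
  have "psd (block_mat 2 n T)"
    unfolding psd_block_mat_iff
  proof
    fix h :: "nat \<Rightarrow> nat \<Rightarrow> complex"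
    define v where "v i = (\<Sum>j<n. A $$ (i, j) * h 1 j)" for i
    have cv: "cnj (v j) = (\<Sum>i<n. A $$ (i, j) * cnj (h 1 i))" if "j < n" for j
      using that by (simp add: v_def cnj_sum herm)
    have b00: "(\<Sum>i<n. \<Sum>j<n. 1\<^sub>m n $$ (i, j) * h 0 j * cnj (h 0 i)) = (\<Sum>i<n. h 0 i * cnj (h 0 i))"
    proof (rule sum.cong[OF refl])
      fix i assume "i \<in> {..<n}"
      then have "(\<Sum>j<n. 1\<^sub>m n $$ (i, j) * h 0 j * cnj (h 0 i)) = (\<Sum>j<n. if j = i then h 0 i * cnj (h 0 i) else 0)"
        by (intro sum.cong) auto
      with \<open>i \<in> {..<n}\<close> show "(\<Sum>j<n. 1\<^sub>m n $$ (i, j) * h 0 j * cnj (h 0 i)) = h 0 i * cnj (h 0 i)" by simp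
    qed
    have b01: "(\<Sum>i<n. \<Sum>j<n. A $$ (i, j) * h 1 j * cnj (h 0 i)) = (\<Sum>i<n. v i * cnj (h 0 i))"
      by (simp add: v_def sum_distrib_right)
    have b10: "(\<Sum>i<n. \<Sum>j<n. A $$ (i, j) * h 0 j * cnj (h 1 i)) = (\<Sum>j<n. h 0 j * cnj (v j))"
      by (subst sum.swap) (simp add: cv sum_distrib_left ac_simps)
    have "(\<Sum>i<n. \<Sum>j<n. (A * A) $$ (i, j) * h 1 j * cnj (h 1 i)) =
        (\<Sum>i<n. \<Sum>j<n. \<Sum>l<n. (A $$ (i, l) * cnj (h 1 i)) * (A $$ (l, j) * h 1 j))"
      using A by (intro sum.cong refl) (simp add: scalar_prod_def atLeast0LessThan sum_distrib_left sum_distrib_right ac_simps)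
    also have "\<dots> = (\<Sum>i<n. \<Sum>l<n. \<Sum>j<n. (A $$ (i, l) * cnj (h 1 i)) * (A $$ (l, j) * h 1 j))"
      by (intro sum.cong refl sum.swap)
    also have "\<dots> = (\<Sum>l<n. \<Sum>i<n. \<Sum>j<n. (A $$ (i, l) * cnj (h 1 i)) * (A $$ (l, j) * h 1 j))"
      by (rule sum.swap)
    also have "\<dots> = (\<Sum>l<n. cnj (v l) * v l)"
      by (intro sum.cong refl) (simp only: lessThan_iff cv, simp only: v_def sum_product)
    finally have b11: "(\<Sum>i<n. \<Sum>j<n. (A * A) $$ (i, j) * h 1 j * cnj (h 1 i)) = (\<Sum>l<n. cnj (v l) * v l)" .
    have "bform 2 n (\<lambda>a b i j. T a b $$ (i, j)) h = (\<Sum>i<n. (h 0 i + v i) * cnj (h 0 i + v i))"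
      using b00 b01 b10 b11
      by (simp add: bform_def T_def numeral_2_eq_2 sum.distrib algebra_simps)
    also have "0 \<le> \<dots>"
      by (intro sum_nonneg) (simp only: complex_norm_square[symmetric] complex_nonneg_iff, simp)
    finally show "0 \<le> bform 2 n (\<lambda>a b i j. T a b $$ (i, j)) h" .
  qed
  moreover have "T a b \<in> carrier_mat n n" for a b using A by (simp add: T_def)
  ultimately have pos: "psd (block_mat 2 k (\<lambda>a b. \<phi> (T a b)))" by (intro ucp_matD(5)[OF \<phi>])
  have T: "T 0 0 = 1\<^sub>m n" "T 0 1 = A" "T 1 0 = A" "T 1 1 = A * A" by (simp_all add: T_def)
  show herm': "\<phi> A $$ (i, j) = cnj (\<phi> A $$ (j, i))" if "i < k" "j < k" for i j
  proof -
    have "\<phi> (T 0 1) $$ (i, j) = cnj (\<phi> (T 1 0) $$ (j, i))"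
      by (rule psd_block_hermitian[OF pos]) (use that in simp_all)
    then show ?thesis by (simp only: T)
  qed
  define w where "w l = (\<Sum>j<k. \<phi> A $$ (l, j) * h j)" for l
  have cw: "cnj (w j) = (\<Sum>i<k. \<phi> A $$ (i, j) * cnj (h i))" if "j < k" for j
    unfolding w_def cnj_sum
  proof (rule sum.cong[OF refl])
    fix i assume "i \<in> {..<k}"
    then show "cnj (\<phi> A $$ (j, i) * h i) = \<phi> A $$ (i, j) * cnj (h i)"
      using herm'[of i j] that by simp
  qed
  \<comment> \<open>Positivity of the image is tested at \<open>(- \<phi> A h, h)\<close>, where its
    form is \<open><\<phi> (A * A) h, h>\<close> minus the squared norm of
    \<open>\<phi> A h\<close>.\<close>
  define g where "g a i = (if a = 0 then - w i else h i)" for a i :: nat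
  have b00: "(\<Sum>i<k. \<Sum>j<k. 1\<^sub>m k $$ (i, j) * g 0 j * cnj (g 0 i)) = (\<Sum>i<k. w i * cnj (w i))"
  proof (rule sum.cong[OF refl])
    fix i assume "i \<in> {..<k}"
    then have "(\<Sum>j<k. 1\<^sub>m k $$ (i, j) * g 0 j * cnj (g 0 i)) = (\<Sum>j<k. if j = i then w i * cnj (w i) else 0)"
      by (intro sum.cong) (auto simp: g_def)
    with \<open>i \<in> {..<k}\<close> show "(\<Sum>j<k. 1\<^sub>m k $$ (i, j) * g 0 j * cnj (g 0 i)) = w i * cnj (w i)" by simp
  qed
  have b01: "(\<Sum>i<k. \<Sum>j<k. \<phi> A $$ (i, j) * g 1 j * cnj (g 0 i)) = - (\<Sum>i<k. w i * cnj (w i))"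
    by (simp add: w_def g_def sum_distrib_right sum_negf)
  have b10: "(\<Sum>i<k. \<Sum>j<k. \<phi> A $$ (i, j) * g 0 j * cnj (g 1 i)) = - (\<Sum>j<k. w j * cnj (w j))"
    by (subst sum.swap) (simp add: cw g_def sum_distrib_left sum_negf ac_simps)
  have b11: "(\<Sum>i<k. \<Sum>j<k. \<phi> (A * A) $$ (i, j) * g 1 j * cnj (g 1 i)) = form k (\<lambda>i j. \<phi> (A * A) $$ (i, j)) h"
    by (simp add: form_def g_def)
  have "0 \<le> bform 2 k (\<lambda>a b i j. \<phi> (T a b) $$ (i, j)) g"
    using pos unfolding psd_block_mat_iff by blast
  also have "\<dots> = form k (\<lambda>i j. \<phi> (A * A) $$ (i, j)) h - (\<Sum>i<k. w i * cnj (w i))"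
    using b00 b01 b10 b11 T by (simp add: bform_def numeral_2_eq_2 ucp_matD(4)[OF \<phi>])
  also have "(\<Sum>i<k. w i * cnj (w i)) = of_real (\<Sum>l<k. (cmod (w l))\<^sup>2)"
    by (simp only: of_real_sum complex_norm_square)
  finally show "(\<Sum>l<k. (cmod (\<Sum>j<k. \<phi> A $$ (l, j) * h j))\<^sup>2) \<le> Re (form k (\<lambda>i j. \<phi> (A * A) $$ (i, j)) h)"
    by (simp add: w_def complex_nonneg_iff del: of_real_sum of_real_power)
qed

lemma form_affine:
  "form n (\<lambda>a b. (if a = b then 1 else 0) - (\<Sum>p\<in>I. c p * A p a b)) h =
    of_real (\<Sum>a<n. (cmod (h a))\<^sup>2) - (\<Sum>p\<in>I. c p * form n (A p) h)"
proof -
  have "(\<Sum>a<n. \<Sum>b<n. (if a = b then 1 else 0) * h b * cnj (h a)) =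
      (\<Sum>a<n. \<Sum>b<n. if b = a then h a * cnj (h a) else 0)"
    by (intro sum.cong refl) auto
  also have "\<dots> = of_real (\<Sum>a<n. (cmod (h a))\<^sup>2)"
    by (simp add: complex_norm_square del: of_real_power)
  finally have 1: "(\<Sum>a<n. \<Sum>b<n. (if a = b then 1 else 0) * h b * cnj (h a)) =
      of_real (\<Sum>a<n. (cmod (h a))\<^sup>2)" .
  have "(\<Sum>a<n. \<Sum>b<n. (\<Sum>p\<in>I. c p * A p a b) * h b * cnj (h a)) =
      (\<Sum>a<n. \<Sum>b<n. \<Sum>p\<in>I. c p * (A p a b * h b * cnj (h a)))"
    unfolding sum_distrib_right by (simp only: mult.assoc)
  also have "\<dots> = (\<Sum>a<n. \<Sum>p\<in>I. \<Sum>b<n. c p * (A p a b * h b * cnj (h a)))"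
    by (intro sum.cong refl sum.swap)
  also have "\<dots> = (\<Sum>p\<in>I. \<Sum>a<n. \<Sum>b<n. c p * (A p a b * h b * cnj (h a)))"
    by (rule sum.swap)
  also have "\<dots> = (\<Sum>p\<in>I. c p * form n (A p) h)"
    by (simp only: form_def sum_distrib_left)
  finally show ?thesis
    using 1 by (simp only: form_def left_diff_distrib sum_subtractf)
qed

lemma ucp_mat_msa_level:
  assumes "ucp_mat n k \<phi>" "X \<in> msa_level n"
  shows "(\<lambda>p. \<phi> (X p)) \<in> msa_level k"
  unfolding msa_level_iff
proof (intro allI conjI impI)
  show "\<phi> (X p) \<in> carrier_mat k k" for p
    by (rule ucp_matD(1)[OF assms(1) msa_levelD(1)[OF assms(2)]])
  show "\<phi> (X p) $$ (a, b) = cnj (\<phi> (X p) $$ (b, a))" if "a < k" "b < k" for p a b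
    by (rule ucp_mat_hermitian_Kadison(1)[OF assms(1) msa_levelD(1)[OF assms(2)] _ that])
       (rule msa_levelD(4)[OF assms(2)])
qed

text \<open>By the Kadison inequality the squares of the images sum to at most the image of
  \<open>sum X_p^2\<close>, and this is at most the image of the identity.\<close>

lemma ball_B_ucp:
  assumes X: "X \<in> ball_B" "X \<in> msa_level n" and \<phi>: "ucp_mat n k \<phi>" and nk: "1 \<le> n" "1 \<le> k"
  shows "(\<lambda>p. \<phi> (X p)) \<in> ball_B"
  unfolding ball_B_iff_norm[OF ucp_mat_msa_level[OF \<phi> X(2)] nk(2)]
proof
  fix h :: "nat \<Rightarrow> complex"
  have c: "X p * X p \<in> carrier_mat n n" for p
    using msa_levelD(1)[OF X(2), of p] by simp
  have "row_contraction n (\<lambda>p a l. X p $$ (a, l)) \<longleftrightarrow>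
      pos_form n (\<lambda>a b. (if a = b then 1 else 0) - (\<Sum>p\<in>UNIV. 1 * (X p * X p) $$ (a, b)))"
    unfolding row_contraction_def
    by (rule pos_form_congI) (simp add: scalar_prod_def msa_levelD[OF X(2)] atLeast0LessThan)
  then have "pos_form n (\<lambda>a b. (if a = b then 1 else 0) - (\<Sum>p\<in>UNIV. 1 * (X p * X p) $$ (a, b)))"
    using X(1) ball_B_iff[OF X(2) nk(1)] by simp
  then have "pos_form k (\<lambda>i j. (if i = j then 1 else 0) - (\<Sum>p\<in>UNIV. 1 * \<phi> (X p * X p) $$ (i, j)))"
    by (rule ucp_mat_pos_affine[OF \<phi> c])
  from pos_formD[OF this, of h] have "(\<Sum>p\<in>UNIV. Re (form k (\<lambda>i j. \<phi> (X p * X p) $$ (i, j)) h)) \<le> (\<Sum>a<k. (cmod (h a))\<^sup>2)"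
    unfolding form_affine by (simp add: complex_nonneg_iff)
  moreover have "(\<Sum>p\<in>UNIV. \<Sum>l<k. (cmod (\<Sum>a<k. \<phi> (X p) $$ (l, a) * h a))\<^sup>2) \<le>
      (\<Sum>p\<in>UNIV. Re (form k (\<lambda>i j. \<phi> (X p * X p) $$ (i, j)) h))"
    by (intro sum_mono ucp_mat_hermitian_Kadison(2)[OF \<phi> msa_levelD(1)[OF X(2)]] msa_levelD(4)[OF X(2)])
  ultimately show "(\<Sum>p\<in>UNIV. \<Sum>l<k. (cmod (\<Sum>a<k. \<phi> (X p) $$ (l, a) * h a))\<^sup>2) \<le> (\<Sum>a<k. (cmod (h a))\<^sup>2)"
    by linarith
qed

lemma mat_dsum_index:
  assumes "A \<in> carrier_mat n n" "B \<in> carrier_mat m m" "i < n + m" "j < n + m"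
  shows "mat_dsum A B $$ (i, j) =
    (if i < n then if j < n then A $$ (i, j) else 0 else if j < n then 0 else B $$ (i - n, j - n))"
  using assms by (auto simp: mat_dsum_def)

lemma msa_level_dsum:
  assumes "X \<in> msa_level n" "Y \<in> msa_level m"
  shows "(\<lambda>p. mat_dsum (X p) (Y p)) \<in> msa_level (n + m)"
  unfolding msa_level_iff
proof (intro allI conjI impI)
  note c = msa_levelD(1)[OF assms(1)] msa_levelD(1)[OF assms(2)]
  show "mat_dsum (X p) (Y p) \<in> carrier_mat (n + m) (n + m)" for p
    using c[of p] by (auto simp: mat_dsum_def)
  show "mat_dsum (X p) (Y p) $$ (a, b) = cnj (mat_dsum (X p) (Y p) $$ (b, a))"
    if "a < n + m" "b < n + m" for p a b
    using that by (simp add: mat_dsum_index[OF c] msa_levelD[OF assms(1)] msa_levelD[OF assms(2)])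
qed

lemma pos_form_dsum:
  assumes "pos_form n P" "pos_form m Q"
    and "\<And>a b. a < n \<Longrightarrow> b < n \<Longrightarrow> R a b = P a b"
    and "\<And>a b. a < n \<Longrightarrow> b < m \<Longrightarrow> R a (n + b) = 0"
    and "\<And>a b. a < m \<Longrightarrow> b < n \<Longrightarrow> R (n + a) b = 0"
    and "\<And>a b. a < m \<Longrightarrow> b < m \<Longrightarrow> R (n + a) (n + b) = Q a b"
  shows "pos_form (n + m) R"
  unfolding pos_form_def
proof
  fix h
  have "form (n + m) R h = form n P h + form m Q (\<lambda>a. h (n + a))"
    unfolding form_def sum_lessThan_add by (simp add: assms(3-6))
  then show "0 \<le> form (n + m) R h"
    using pos_formD[OF assms(1)] pos_formD[OF assms(2)] by simp
qed

lemma ball_B_dsum: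
  assumes X: "X \<in> ball_B" "X \<in> msa_level n" "1 \<le> n" and Y: "Y \<in> ball_B" "Y \<in> msa_level m" "1 \<le> m"
  shows "(\<lambda>p. mat_dsum (X p) (Y p)) \<in> ball_B"
proof -
  note c = msa_levelD(1)[OF X(2)] msa_levelD(1)[OF Y(2)]
  have "row_contraction n (\<lambda>p a l. X p $$ (a, l))" "row_contraction m (\<lambda>p a l. Y p $$ (a, l))"
    using X Y ball_B_iff by blast+
  then have "row_contraction (n + m) (\<lambda>p a l. mat_dsum (X p) (Y p) $$ (a, l))"
    unfolding row_contraction_def
    by (rule pos_form_dsum) (simp_all add: sum_lessThan_add mat_dsum_index[OF c])
  then show ?thesis
    using ball_B_iff[OF msa_level_dsum[OF X(2) Y(2)]] X(3) by simp
qed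

lemma matrix_convexI:
  assumes "S \<subseteq> msa"
    and "\<And>X Y n m. X \<in> S \<Longrightarrow> Y \<in> S \<Longrightarrow> X \<in> msa_level n \<Longrightarrow> Y \<in> msa_level m \<Longrightarrow> 1 \<le> n \<Longrightarrow> 1 \<le> m \<Longrightarrow>
      (\<lambda>p. mat_dsum (X p) (Y p)) \<in> S"
    and "\<And>X n k \<phi>. X \<in> S \<Longrightarrow> X \<in> msa_level n \<Longrightarrow> ucp_mat n k \<phi> \<Longrightarrow> 1 \<le> n \<Longrightarrow> 1 \<le> k \<Longrightarrow>
      (\<lambda>p. \<phi> (X p)) \<in> S"
  shows "matrix_convex S"
  unfolding matrix_convex_def
proof (intro conjI ballI allI impI)
  show "S \<subseteq> msa" by (rule assms(1))
  show "(\<lambda>p. mat_dsum (X p) (Y p)) \<in> S" if "X \<in> S" "Y \<in> S" for X Y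
  proof -
    obtain n where "1 \<le> n" "X \<in> msa_level n" using assms(1) \<open>X \<in> S\<close> by (meson msaE subsetD)
    moreover obtain m where "1 \<le> m" "Y \<in> msa_level m" using assms(1) \<open>Y \<in> S\<close> by (meson msaE subsetD)
    ultimately show ?thesis using assms(2) that by blast
  qed
  show "(\<lambda>p. \<phi> (X p)) \<in> S" if "1 \<le> n" "1 \<le> k" "X \<in> S \<inter> msa_level n" "ucp_mat n k \<phi>" for n k X \<phi>
    using assms(3) that by blast
qed

lemma matrix_convexD:
  assumes "matrix_convex S"
  shows "S \<subseteq> msa"
    "X \<in> S \<Longrightarrow> Y \<in> S \<Longrightarrow> (\<lambda>p. mat_dsum (X p) (Y p)) \<in> S"
    "X \<in> S \<Longrightarrow> X \<in> msa_level n \<Longrightarrow> ucp_mat n k \<phi> \<Longrightarrow> 1 \<le> n \<Longrightarrow> 1 \<le> k \<Longrightarrow> (\<lambda>p. \<phi> (X p)) \<in> S"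
  using assms unfolding matrix_convex_def by simp_all

lemma matrix_convex_ball_B: "matrix_convex ball_B"
proof (rule matrix_convexI)
  show "ball_B \<subseteq> msa" by (auto simp: ball_B_def)
qed (use ball_B_dsum ball_B_ucp in blast)+

section \<open>The first level, and the extremal matrix convex sets over the ball\<close>

lemma msa_level_1_iff: "X \<in> msa_level 1 \<longleftrightarrow> (\<exists>x. X = scalar_tuple x)"
proof
  assume X: "X \<in> msa_level 1"
  have "X = scalar_tuple (\<chi> p. Re (X p $$ (0, 0)))"
  proof (intro ext eq_matI)
    fix p i j
    assume "i < dim_row (scalar_tuple (\<chi> p. Re (X p $$ (0, 0))) p)"
      "j < dim_col (scalar_tuple (\<chi> p. Re (X p $$ (0, 0))) p)"
    moreover have "cnj (X p $$ (0, 0)) = X p $$ (0, 0)" by (rule msa_levelD(4)[OF X]) auto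
    ultimately show "X p $$ (i, j) = scalar_tuple (\<chi> p. Re (X p $$ (0, 0))) p $$ (i, j)"
      by (simp add: scalar_tuple_def complex_eq_iff)
  qed (use msa_levelD[OF X] in \<open>auto simp: scalar_tuple_def\<close>)
  then show "\<exists>x. X = scalar_tuple x" by blast
qed (auto simp: msa_level_iff scalar_tuple_def)

lemma scalar_tuple_level: "scalar_tuple x \<in> msa_level 1"
  using msa_level_1_iff by blast

lemma scalar_tuple_index: "scalar_tuple x p $$ (0, 0) = of_real (vec_nth x p)"
  by (simp add: scalar_tuple_def)

lemma level_1_eqI:
  assumes "\<And>x. scalar_tuple x \<in> S \<longleftrightarrow> x \<in> C"
  shows "S \<inter> msa_level 1 = scalar_tuple ` C"
proof (intro equalityI subsetI)
  fix X assume "X \<in> S \<inter> msa_level 1"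
  moreover obtain x where "X = scalar_tuple x" using calculation msa_level_1_iff by blast
  ultimately show "X \<in> scalar_tuple ` C" using assms by blast
qed (use assms scalar_tuple_level in blast)

lemma norm_vec_sq: "(norm x)\<^sup>2 = (\<Sum>p\<in>UNIV. (vec_nth x p)\<^sup>2)" for x :: "real ^ 'd::finite"
  by (simp add: norm_vec_def L2_set_def sum_nonneg)

lemma scalar_tuple_in_ball_B: "scalar_tuple x \<in> ball_B \<longleftrightarrow> x \<in> cball 0 1"
proof -
  have "scalar_tuple x \<in> ball_B \<longleftrightarrow> (\<forall>h::nat \<Rightarrow> complex. (norm x)\<^sup>2 * (cmod (h 0))\<^sup>2 \<le> (cmod (h 0))\<^sup>2)"
    unfolding ball_B_iff_norm[OF scalar_tuple_level order_refl] norm_vec_sq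
    by (simp add: scalar_tuple_index norm_mult power_mult_distrib sum_distrib_right)
  also have "\<dots> \<longleftrightarrow> (norm x)\<^sup>2 \<le> 1"
  proof
    assume "\<forall>h::nat \<Rightarrow> complex. (norm x)\<^sup>2 * (cmod (h 0))\<^sup>2 \<le> (cmod (h 0))\<^sup>2"
    from this[rule_format, of "\<lambda>_. 1"] show "(norm x)\<^sup>2 \<le> 1" by simp
  qed (auto intro: mult_left_le_one_le)
  finally show ?thesis by (simp add: abs_square_le_1)
qed

text \<open>\<open>Wmin\<close> is a \<open>LEAST\<close>, so a least element has to be exhibited:
  the intersection of the family. That \<open>ball_B\<close> belongs to the family does double duty:
  it keeps the intersection inside \<open>msa\<close> with the right first level, and it bounds it
  from above.\<close>

lemma Wmin_subset_ball_B: "Wmin (cball 0 1 :: (real ^ 'd::finite) set) \<subseteq> ball_B"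
proof -
  let ?P = "\<lambda>S :: ('d \<Rightarrow> complex mat) set. matrix_convex S \<and> S \<inter> msa_level 1 = scalar_tuple ` cball 0 1"
  let ?I = "\<Inter>{S. ?P S}"
  have B: "?P ball_B"
    using matrix_convex_ball_B level_1_eqI[OF scalar_tuple_in_ball_B] by blast
  have "matrix_convex ?I"
  proof (rule matrix_convexI)
    show "?I \<subseteq> msa" using B by (auto simp: ball_B_def)
    show "(\<lambda>p. mat_dsum (X p) (Y p)) \<in> ?I" if "X \<in> ?I" "Y \<in> ?I" for X Y
    proof
      fix S assume "S \<in> {S. ?P S}"
      then show "(\<lambda>p. mat_dsum (X p) (Y p)) \<in> S" using that matrix_convexD(2)[of S X Y] by simp
    qed
    show "(\<lambda>p. \<phi> (X p)) \<in> ?I" if "X \<in> ?I" "X \<in> msa_level n" "ucp_mat n k \<phi>" "1 \<le> n" "1 \<le> k" for X n k \<phi>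
    proof
      fix S assume "S \<in> {S. ?P S}"
      then show "(\<lambda>p. \<phi> (X p)) \<in> S" using that matrix_convexD(3)[of S X n k \<phi>] by simp
    qed
  qed
  moreover have "?I \<inter> msa_level 1 = scalar_tuple ` cball 0 1" using B by blast
  ultimately have "Wmin (cball 0 1) = ?I"
    unfolding Wmin_def by (intro Least_equality) auto
  then show ?thesis using B by blast
qed

text \<open>An explicit form of \<open>Wmax\<close>: every linear inequality valid on the ball is
  imposed on matrices. As the ball is its own polar, the coefficient vectors \<open>y\<close> run
  over the ball again.\<close>

definition halfspace_tuples :: "('d::finite \<Rightarrow> complex mat) set" where
  "halfspace_tuples = {X \<in> msa. \<forall>n. X \<in> msa_level n \<longrightarrow> (\<forall>y\<in>cball 0 1 :: (real ^ 'd) set.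
    pos_form n (\<lambda>a b. (if a = b then 1 else 0) - (\<Sum>p\<in>UNIV. of_real (vec_nth y p) * X p $$ (a, b))))}"

lemma halfspace_tuples_iff:
  fixes X :: "'d::finite \<Rightarrow> complex mat"
  assumes "X \<in> msa_level n" "1 \<le> n"
  shows "X \<in> halfspace_tuples \<longleftrightarrow> (\<forall>y\<in>cball 0 1 :: (real ^ 'd) set.
    pos_form n (\<lambda>a b. (if a = b then 1 else 0) - (\<Sum>p\<in>UNIV. of_real (vec_nth y p) * X p $$ (a, b))))"
  unfolding halfspace_tuples_def using msaI[OF assms] msa_forall_level[OF assms(1)] by simp

lemma matrix_convex_halfspace_tuples: "matrix_convex halfspace_tuples"
proof (rule matrix_convexI)
  show "halfspace_tuples \<subseteq> msa" by (auto simp: halfspace_tuples_def)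
next
  fix X Y :: "'a \<Rightarrow> complex mat" and n m :: nat
  assume X: "X \<in> halfspace_tuples" "X \<in> msa_level n" "1 \<le> n" and Y: "Y \<in> halfspace_tuples" "Y \<in> msa_level m" "1 \<le> m"
  note c = msa_levelD(1)[OF X(2)] msa_levelD(1)[OF Y(2)]
  have nm: "1 \<le> n + m" using X(3) by simp
  show "(\<lambda>p. mat_dsum (X p) (Y p)) \<in> halfspace_tuples"
    unfolding halfspace_tuples_iff[OF msa_level_dsum[OF X(2) Y(2)] nm]
  proof
    fix y :: "real ^ 'a" assume "y \<in> cball 0 1"
    then have "pos_form n (\<lambda>a b. (if a = b then 1 else 0) - (\<Sum>p\<in>UNIV. of_real (vec_nth y p) * X p $$ (a, b)))"
      "pos_form m (\<lambda>a b. (if a = b then 1 else 0) - (\<Sum>p\<in>UNIV. of_real (vec_nth y p) * Y p $$ (a, b)))"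
      using X Y halfspace_tuples_iff by blast+
    then show "pos_form (n + m) (\<lambda>a b. (if a = b then 1 else 0) -
        (\<Sum>p\<in>UNIV. of_real (vec_nth y p) * mat_dsum (X p) (Y p) $$ (a, b)))"
      by (rule pos_form_dsum) (simp_all add: mat_dsum_index[OF c])
  qed
next
  fix X :: "'a \<Rightarrow> complex mat" and n k \<phi>
  assume X: "X \<in> halfspace_tuples" "X \<in> msa_level n" and \<phi>: "ucp_mat n k \<phi>" and nk: "1 \<le> n" "1 \<le> k"
  show "(\<lambda>p. \<phi> (X p)) \<in> halfspace_tuples"
    unfolding halfspace_tuples_iff[OF ucp_mat_msa_level[OF \<phi> X(2)] nk(2)]
  proof
    fix y :: "real ^ 'a" assume "y \<in> cball 0 1"
    then show "pos_form k (\<lambda>a b. (if a = b then 1 else 0) -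
        (\<Sum>p\<in>UNIV. of_real (vec_nth y p) * \<phi> (X p) $$ (a, b)))"
      using X(1) unfolding halfspace_tuples_iff[OF X(2) nk(1)]
      by (intro ucp_mat_pos_affine[OF \<phi> msa_levelD(1)[OF X(2)]]) blast
  qed
qed

text \<open>Self-polarity of the Euclidean ball: Cauchy-Schwarz in one direction, and testing with
  \<open>y = x / |x|\<close> in the other.\<close>

lemma scalar_tuple_in_halfspace_tuples: "scalar_tuple x \<in> halfspace_tuples \<longleftrightarrow> x \<in> cball 0 1"
proof -
  have "pos_form 1 (\<lambda>a b. (if a = b then 1 else 0) -
      (\<Sum>p\<in>UNIV. of_real (vec_nth y p) * scalar_tuple x p $$ (a, b))) \<longleftrightarrow> inner y x \<le> 1" for y
  proof -
    have "form 1 (\<lambda>a b. (if a = b then 1 else 0) -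
        (\<Sum>p\<in>UNIV. of_real (vec_nth y p) * scalar_tuple x p $$ (a, b))) h =
        of_real ((1 - inner y x) * (cmod (h 0))\<^sup>2)" for h
    proof -
      have "form 1 (\<lambda>a b. (if a = b then 1 else 0) -
        (\<Sum>p\<in>UNIV. of_real (vec_nth y p) * scalar_tuple x p $$ (a, b))) h =
        of_real (1 - inner y x) * (h 0 * cnj (h 0))"
        by (simp add: form_def scalar_tuple_index inner_vec_def mult.assoc)
      then show ?thesis by (simp only: complex_norm_square of_real_mult)
    qed
    then have "pos_form 1 (\<lambda>a b. (if a = b then 1 else 0) -
      (\<Sum>p\<in>UNIV. of_real (vec_nth y p) * scalar_tuple x p $$ (a, b))) \<longleftrightarrow>
      (\<forall>h::nat \<Rightarrow> complex. 0 \<le> (1 - inner y x) * (cmod (h 0))\<^sup>2)"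
      unfolding pos_form_def by (simp add: complex_nonneg_iff)
    also have "\<dots> \<longleftrightarrow> inner y x \<le> 1"
    proof
      assume "\<forall>h::nat \<Rightarrow> complex. 0 \<le> (1 - inner y x) * (cmod (h 0))\<^sup>2"
      from this[rule_format, of "\<lambda>_. 1"] show "inner y x \<le> 1" by simp
    qed auto
    finally show ?thesis .
  qed
  then have "scalar_tuple x \<in> halfspace_tuples \<longleftrightarrow> (\<forall>y\<in>cball 0 1. inner y x \<le> 1)"
    by (simp only: halfspace_tuples_iff[OF scalar_tuple_level order_refl])
  also have "\<dots> \<longleftrightarrow> norm x \<le> 1"
  proof
    assume *: "\<forall>y\<in>cball 0 1. inner y x \<le> 1"
    show "norm x \<le> 1"
    proof (cases "x = 0")
      case False
      have "x /\<^sub>R norm x \<in> cball 0 1" using False by simp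
      then have "inner (x /\<^sub>R norm x) x \<le> 1" using * by blast
      moreover have "inner (x /\<^sub>R norm x) x = norm x"
        using False by (simp add: dot_square_norm power2_eq_square)
      ultimately show ?thesis by simp
    qed simp
  next
    assume "norm x \<le> 1"
    show "\<forall>y\<in>cball 0 1. inner y x \<le> 1"
    proof
      fix y :: "real ^ 'a" assume "y \<in> cball 0 1"
      have "inner y x \<le> norm y * norm x" by (rule norm_cauchy_schwarz)
      also have "\<dots> \<le> 1 * 1" using \<open>y \<in> cball 0 1\<close> \<open>norm x \<le> 1\<close> by (intro mult_mono) auto
      finally show "inner y x \<le> 1" by simp
    qed
  qed
  finally show ?thesis by simp
qed

lemma ucp_mat_vector_state:
  assumes u: "(\<Sum>a<n. (cmod (u a))\<^sup>2) = 1"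
  shows "ucp_mat n 1 (\<lambda>A. mat 1 1 (\<lambda>_. form n (\<lambda>a b. A $$ (a, b)) u))"
  unfolding ucp_mat_def
proof (intro conjI ballI allI impI)
  show "mat 1 1 (\<lambda>_. form n (\<lambda>a b. (A + B) $$ (a, b)) u) =
      mat 1 1 (\<lambda>_. form n (\<lambda>a b. A $$ (a, b)) u) + mat 1 1 (\<lambda>_. form n (\<lambda>a b. B $$ (a, b)) u)"
    if "A \<in> carrier_mat n n" "B \<in> carrier_mat n n" for A B
    using that by (intro eq_matI) (auto simp: form_def distrib_right sum.distrib)
  show "mat 1 1 (\<lambda>_. form n (\<lambda>a b. (c \<cdot>\<^sub>m A) $$ (a, b)) u) = c \<cdot>\<^sub>m mat 1 1 (\<lambda>_. form n (\<lambda>a b. A $$ (a, b)) u)"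
    if "A \<in> carrier_mat n n" for c A
    using that by (intro eq_matI) (auto simp: form_def sum_distrib_left mult.assoc)
  have "form n (\<lambda>a b. 1\<^sub>m n $$ (a, b)) u = form n (\<lambda>a b. (if a = b then 1 else 0) - (\<Sum>p\<in>({}::nat set). 0 * 0)) u"
    unfolding form_def by (intro sum.cong refl) simp
  also have "\<dots> = 1" unfolding form_affine using u by simp
  finally show "mat 1 1 (\<lambda>_. form n (\<lambda>a b. 1\<^sub>m n $$ (a, b)) u) = 1\<^sub>m 1"
    by (intro eq_matI) auto
  fix m T
  assume T: "(\<forall>a<m. \<forall>b<m. T a b \<in> carrier_mat n n) \<and> psd (block_mat m n T)"
  show "psd (block_mat m 1 (\<lambda>a b. mat 1 1 (\<lambda>_. form n (\<lambda>i j. T a b $$ (i, j)) u)))"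
    unfolding psd_block_mat_iff
  proof
    fix g :: "nat \<Rightarrow> nat \<Rightarrow> complex"
    have "bform m 1 (\<lambda>a b i j. mat 1 1 (\<lambda>_. form n (\<lambda>i j. T a b $$ (i, j)) u) $$ (i, j)) g =
        bform m n (\<lambda>a b i j. T a b $$ (i, j)) (\<lambda>a i. g a 0 * u i)"
      unfolding bform_def by (simp add: form_def sum_distrib_right sum_distrib_left ac_simps)
    then show "0 \<le> bform m 1 (\<lambda>a b i j. mat 1 1 (\<lambda>_. form n (\<lambda>i j. T a b $$ (i, j)) u) $$ (i, j)) g"
      using T unfolding psd_block_mat_iff by simp
  qed
qed simp

lemma form_scale: "form n P (\<lambda>a. of_real c * h a) = of_real (c\<^sup>2) * form n P h"
  by (simp add: form_def sum_distrib_left power2_eq_square ac_simps)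

text \<open>Compression to a unit vector \<open>u\<close> is a UCP map onto scalars, so it sends
  \<open>X\<close> to a point \<open>x\<close> of the ball. The form of the halfspace inequality at
  \<open>u\<close> is \<open>1 - inner y x\<close>, which Cauchy-Schwarz bounds below by 0; scaling
  gives all other vectors.\<close>

lemma matrix_convex_subset_halfspace_tuples:
  assumes S: "matrix_convex S" "S \<inter> msa_level 1 = scalar_tuple ` cball 0 1"
  shows "S \<subseteq> halfspace_tuples"
proof
  fix X :: "'a \<Rightarrow> complex mat" assume X: "X \<in> S"
  then obtain n where n: "1 \<le> n" "X \<in> msa_level n"
    using matrix_convexD(1)[OF S(1)] by (meson msaE subsetD)
  show "X \<in> halfspace_tuples"
    unfolding halfspace_tuples_iff[OF n(2,1)]
  proof
    fix y :: "real ^ 'a" assume y: "y \<in> cball 0 1"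
    let ?P = "\<lambda>a b. (if a = b then 1 else 0) - (\<Sum>p\<in>UNIV. complex_of_real (vec_nth y p) * X p $$ (a, b))"
    show "pos_form n ?P"
      unfolding pos_form_def
    proof
      fix h :: "nat \<Rightarrow> complex"
      define r where "r = (\<Sum>a<n. (cmod (h a))\<^sup>2)"
      have r: "0 \<le> r" by (simp add: r_def sum_nonneg)
      show "0 \<le> form n ?P h"
      proof (cases "r = 0")
        case True
        then have "h a = 0" if "a < n" for a
          using that unfolding r_def by (subst (asm) sum_nonneg_eq_0_iff) auto
        then show ?thesis by (simp add: form_def)
      next
        case False
        define u where "u a = h a / of_real (sqrt r)" for a
        have "(\<Sum>a<n. (cmod (u a))\<^sup>2) = (\<Sum>a<n. (cmod (h a))\<^sup>2) / r"
          using r by (simp add: u_def norm_divide power_divide sum_divide_distrib)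
        then have u: "(\<Sum>a<n. (cmod (u a))\<^sup>2) = 1" using False by (simp add: r_def)
        have "(\<lambda>p. mat 1 1 (\<lambda>_. form n (\<lambda>a b. X p $$ (a, b)) u)) \<in> S"
          by (rule matrix_convexD(3)[OF S(1) X n(2) ucp_mat_vector_state[OF u] n(1) order_refl])
        moreover have "(\<lambda>p. mat 1 1 (\<lambda>_. form n (\<lambda>a b. X p $$ (a, b)) u)) \<in> msa_level 1"
          by (rule ucp_mat_msa_level[OF ucp_mat_vector_state[OF u] n(2)])
        ultimately obtain x where x: "x \<in> cball 0 1"
            "(\<lambda>p. mat 1 1 (\<lambda>_. form n (\<lambda>a b. X p $$ (a, b)) u)) = scalar_tuple x"
          using S(2) by blast
        have fx: "form n (\<lambda>a b. X p $$ (a, b)) u = of_real (vec_nth x p)" for p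
        proof -
          have "mat 1 1 (\<lambda>_. form n (\<lambda>a b. X p $$ (a, b)) u) $$ (0, 0) = scalar_tuple x p $$ (0, 0)"
            using fun_cong[OF x(2), of p] by (rule arg_cong)
          then show ?thesis by (simp add: scalar_tuple_index)
        qed
        have "inner y x \<le> norm y * norm x" by (rule norm_cauchy_schwarz)
        also have "\<dots> \<le> 1 * 1" using x(1) y by (intro mult_mono) auto
        finally have yx: "(\<Sum>p\<in>UNIV. vec_nth y p * vec_nth x p) \<le> 1" by (simp add: inner_vec_def)
        have "form n ?P u = of_real (1 - (\<Sum>p\<in>UNIV. vec_nth y p * vec_nth x p))"
          unfolding form_affine u fx by simp
        then have "0 \<le> of_real ((sqrt r)\<^sup>2) * form n ?P u"
          using yx r by (simp add: complex_nonneg_iff mult_nonneg_nonneg del: of_real_diff of_real_sum)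
        also have "\<dots> = form n ?P h"
          unfolding form_scale[symmetric] using False r by (simp add: u_def)
        finally show ?thesis .
      qed
    qed
  qed
qed

lemma Wmax_eq_halfspace_tuples: "Wmax (cball 0 1) = halfspace_tuples"
  unfolding Wmax_def
  by (intro Greatest_equality conjI matrix_convex_halfspace_tuples
      level_1_eqI[OF scalar_tuple_in_halfspace_tuples])
     (use matrix_convex_subset_halfspace_tuples in blast)

text \<open>Scalar points of the ball belong to \<open>ball_B\<close>, and the pairing with such a
  point is literally a halfspace inequality.\<close>

lemma polar_subset_Wmax: "polar_dual ball_B \<subseteq> Wmax (cball 0 1)"
  unfolding Wmax_eq_halfspace_tuples
proof
  fix X :: "'a::finite \<Rightarrow> complex mat" assume X: "X \<in> polar_dual ball_B"
  then obtain n where n: "1 \<le> n" "X \<in> msa_level n" by (auto simp: polar_dual_def elim: msaE)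
  show "X \<in> halfspace_tuples"
    unfolding halfspace_tuples_iff[OF n(2,1)]
  proof
    fix y :: "real ^ 'a" assume "y \<in> cball 0 1"
    then have le: "tensor_le n 1 X (scalar_tuple y)"
      using X scalar_tuple_level unfolding polar_dual_iff[OF n(2,1)] by (metis scalar_tuple_in_ball_B)
    show "pos_form n (\<lambda>a b. (if a = b then 1 else 0) - (\<Sum>p\<in>UNIV. of_real (vec_nth y p) * X p $$ (a, b)))"
      unfolding pos_form_def
    proof
      fix h
      show "0 \<le> form n (\<lambda>a b. (if a = b then 1 else 0) - (\<Sum>p\<in>UNIV. of_real (vec_nth y p) * X p $$ (a, b))) h"
        using le[unfolded tensor_le_def, THEN spec, of "\<lambda>a i. h a"]
        by (simp add: bform_def form_def scalar_tuple_index mult.commute)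
    qed
  qed
qed

section \<open>Separating examples\<close>

lemma ball_D_iff:
  assumes "X \<in> msa_level n" "1 \<le> n"
  shows "X \<in> ball_D \<longleftrightarrow> tensor_le n n X (\<lambda>p. map_mat cnj (X p))"
proof -
  have "X \<in> ball_D \<longleftrightarrow> le_id (tuple_sum (n * n) (\<lambda>i. X i \<otimes>\<^sub>k map_mat cnj (X i)))"
    unfolding ball_D_def using msaI[OF assms] msa_forall_level[OF assms(1)] by simp
  then show ?thesis
    using le_id_kron_iff[of X n "\<lambda>p. map_mat cnj (X p)" n] msa_levelD(1)[OF assms(1)] by simp
qed

text \<open>For \<open>0 \<le> t, c \<le> 1\<close> the tuple \<open>two_by_two p1 p2 t c\<close> lies in \<open>ball_B\<close> iff \<open>t\<^sup>2 + c\<^sup>2 \<le> 1\<close>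
  and in \<open>ball_D\<close> iff \<open>t\<^sup>2 + c\<^sup>4 \<le> 1\<close>, and it leaves the Lehner ball once \<open>1 - t < c\<^sup>2 / 4\<close>. The
  numerical values of \<open>t\<close> and \<open>c\<close> below separate these regions.\<close>

definition two_by_two :: "'d \<Rightarrow> 'd \<Rightarrow> real \<Rightarrow> real \<Rightarrow> 'd::finite \<Rightarrow> complex mat" where
  "two_by_two p1 p2 t c = (\<lambda>p. mat 2 2 (\<lambda>(a, b).
    if p = p1 then if a = 0 \<and> b = 0 then of_real t else 0
    else if p = p2 then if a \<noteq> b then of_real c else 0 else 0))"

text \<open>Its pairing with \<open>Y\<close> is the block matrix with first row
  \<open>0, Y p1, Y p2\<close>, the same first column, and zeros elsewhere. By a Schur complement
  this is at most \<open>I\<close> exactly when the squares of \<open>Y p1\<close> and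
  \<open>Y p2\<close> sum to at most \<open>I\<close>.\<close>

definition arrow_tuple :: "'d \<Rightarrow> 'd \<Rightarrow> 'd::finite \<Rightarrow> complex mat" where
  "arrow_tuple p1 p2 = (\<lambda>p. mat 3 3 (\<lambda>(a, b).
    if p = p1 then if {a, b} = {0, 1} then 1 else 0
    else if p = p2 then if {a, b} = {0, 2} then 1 else 0 else 0))"

lemma sum_pair:
  assumes "p1 \<noteq> p2" "\<And>p. p \<noteq> p1 \<Longrightarrow> p \<noteq> p2 \<Longrightarrow> f p = 0"
  shows "(\<Sum>p\<in>UNIV. f p) = f p1 + f (p2 :: 'd::finite)"
proof -
  have "(\<Sum>p\<in>UNIV. f p) = (\<Sum>p\<in>{p1, p2}. f p)"
    by (rule sum.mono_neutral_right) (use assms(2) in auto)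
  then show ?thesis using assms(1) by simp
qed

context
  fixes p1 p2 :: "'d::finite"
  assumes p12: "p1 \<noteq> p2"
begin

section \<open>The tuples of two-by-two matrices\<close>

lemma two_by_two_index:
  "two_by_two p1 p2 t c p1 $$ (0, 0) = of_real t" "two_by_two p1 p2 t c p1 $$ (0, Suc 0) = 0"
  "two_by_two p1 p2 t c p1 $$ (Suc 0, 0) = 0" "two_by_two p1 p2 t c p1 $$ (Suc 0, Suc 0) = 0"
  "two_by_two p1 p2 t c p2 $$ (0, 0) = 0" "two_by_two p1 p2 t c p2 $$ (0, Suc 0) = of_real c"
  "two_by_two p1 p2 t c p2 $$ (Suc 0, 0) = of_real c" "two_by_two p1 p2 t c p2 $$ (Suc 0, Suc 0) = 0"
  using p12 by (simp_all add: two_by_two_def)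

lemma two_by_two_other:
  "p \<noteq> p1 \<Longrightarrow> p \<noteq> p2 \<Longrightarrow> a < 2 \<Longrightarrow> b < 2 \<Longrightarrow> two_by_two p1 p2 t c p $$ (a, b) = 0"
  by (simp add: two_by_two_def)

lemma two_by_two_level: "two_by_two p1 p2 t c \<in> msa_level 2"
  unfolding msa_level_iff by (auto simp: two_by_two_def)

text \<open>The form decouples into the pairs \<open>h 0 0, h 1 1\<close> and
  \<open>h 0 1, h 1 0\<close>. The first pair has the matrix with rows
  \<open>1 - t * t', - c * c'\<close> and \<open>- c * c', 1\<close>, so it requires
  \<open>(c * c')^2 <= 1 - t * t'\<close>. Equal tuples give \<open>t^2 + c^4 <= 1\<close>; the
  choice \<open>t' = 1, c' = 1/2\<close> gives \<open>c^2 / 4 <= 1 - t\<close>.\<close>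

lemma two_by_two_tensor_form:
  "bform 2 2 (\<lambda>a b i j. (if a = b \<and> i = j then 1 else 0) -
      (\<Sum>p\<in>UNIV. two_by_two p1 p2 t c p $$ (a, b) * two_by_two p1 p2 t' c' p $$ (i, j))) h =
    of_real ((cmod (h 0 0))\<^sup>2 + (cmod (h 0 1))\<^sup>2 + (cmod (h 1 0))\<^sup>2 + (cmod (h 1 1))\<^sup>2
      - t * t' * (cmod (h 0 0))\<^sup>2
      - 2 * (c * c') * (Re (h 1 1 * cnj (h 0 0)) + Re (h 1 0 * cnj (h 0 1))))"
proof -
  have s: "(\<Sum>p\<in>UNIV. two_by_two p1 p2 t c p $$ (a, b) * two_by_two p1 p2 t' c' p $$ (i, j)) =
      two_by_two p1 p2 t c p1 $$ (a, b) * two_by_two p1 p2 t' c' p1 $$ (i, j) +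
      two_by_two p1 p2 t c p2 $$ (a, b) * two_by_two p1 p2 t' c' p2 $$ (i, j)"
    if "a < 2" "b < 2" for a b i j
    by (rule sum_pair[OF p12]) (simp add: two_by_two_other that)
  have cmod_self: "cmod z * cmod z = Re z * Re z + Im z * Im z" for z
    using cmod_power2[of z] by (simp add: power2_eq_square)
  show ?thesis
    by (simp add: bform_def numeral_2_eq_2 s two_by_two_index)
       (simp add: complex_eq_iff power2_eq_square cmod_self algebra_simps)
qed

text \<open>The real part of the coisometric row with entries \<open>E_00\<close> at
  \<open>p1\<close> and \<open>E_10\<close> at \<open>p2\<close>, in terms of matrix units.\<close>

lemma two_by_two_in_range:
  assumes "2 \<le> CARD('d)"
  shows "two_by_two p1 p2 1 (1/2) \<in> matrix_range half_semicircular"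
proof -
  define C :: "'d \<Rightarrow> nat \<Rightarrow> nat \<Rightarrow> complex" where
    "C p a b = (if p = p1 then if a = 0 \<and> b = 0 then 1 else 0
      else if p = p2 then if a = 1 \<and> b = 0 then 1 else 0 else 0)" for p a b
  have "(\<Sum>p\<in>UNIV. \<Sum>l<2. C p a l * cnj (C p b l)) = (if a = b then 1 else 0)" if "a < 2" "b < 2" for a b
  proof -
    have "(\<Sum>p\<in>UNIV. \<Sum>l<2. C p a l * cnj (C p b l)) =
        (\<Sum>l<2. C p1 a l * cnj (C p1 b l)) + (\<Sum>l<2. C p2 a l * cnj (C p2 b l))"
      by (rule sum_pair[OF p12]) (simp add: C_def)
    also have "\<dots> = (if a = b then 1 else 0)"
      using that p12 by (auto simp: C_def numeral_2_eq_2 less_Suc_eq)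
    finally show ?thesis .
  qed
  then have "pos_form 2 (\<lambda>a b. (if a = b then 1 else 0) - (\<Sum>p\<in>UNIV. \<Sum>l<2. C p a l * cnj (C p b l)))"
    by (simp add: pos_form_def form_def)
  from contraction_real_part_in_range[OF assms _ this]
  have "(\<lambda>p. mat 2 2 (\<lambda>(i, j). (C p i j + cnj (C p j i)) / 2)) \<in> matrix_range half_semicircular" by simp
  also have "(\<lambda>p. mat 2 2 (\<lambda>(i, j). (C p i j + cnj (C p j i)) / 2)) = two_by_two p1 p2 1 (1/2)"
    by (intro ext eq_matI) (auto simp: two_by_two_def C_def less_2_cases_iff)
  finally show ?thesis .
qed

lemma two_by_two_notin_ball_B:
  assumes "1 < t\<^sup>2 + c\<^sup>2"
  shows "two_by_two p1 p2 t c \<notin> ball_B"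
proof
  assume "two_by_two p1 p2 t c \<in> ball_B"
  then have "(\<Sum>p\<in>UNIV. \<Sum>l<2. (cmod (\<Sum>a<2. two_by_two p1 p2 t c p $$ (l, a) * (if a = 0 then 1 else 0)))\<^sup>2)
      \<le> (\<Sum>a<2. (cmod (if a = (0::nat) then 1 else 0))\<^sup>2)"
    using ball_B_iff_norm[OF two_by_two_level] by simp
  also have "(\<Sum>p\<in>UNIV. \<Sum>l<2. (cmod (\<Sum>a<2. two_by_two p1 p2 t c p $$ (l, a) * (if a = 0 then 1 else 0)))\<^sup>2) =
      (\<Sum>l<2. (cmod (\<Sum>a<2. two_by_two p1 p2 t c p1 $$ (l, a) * (if a = 0 then 1 else 0)))\<^sup>2) +
      (\<Sum>l<2. (cmod (\<Sum>a<2. two_by_two p1 p2 t c p2 $$ (l, a) * (if a = 0 then 1 else 0)))\<^sup>2)"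
    by (rule sum_pair[OF p12]) (simp add: two_by_two_other)
  finally show False using assms by (simp add: numeral_2_eq_2 two_by_two_index)
qed

lemma two_by_two_in_ball_D_iff:
  "two_by_two p1 p2 t c \<in> ball_D \<longleftrightarrow> tensor_le 2 2 (two_by_two p1 p2 t c) (two_by_two p1 p2 t c)"
proof -
  have "(\<lambda>p. map_mat cnj (two_by_two p1 p2 t c p)) = two_by_two p1 p2 t c"
    by (intro ext eq_matI) (auto simp: two_by_two_def)
  then show ?thesis using ball_D_iff[OF two_by_two_level] by simp
qed

lemma two_by_two_notin_ball_D: "two_by_two p1 p2 1 (1/2) \<notin> ball_D"
  unfolding two_by_two_in_ball_D_iff tensor_le_def two_by_two_tensor_form
proof
  \<comment> \<open>For \<open>t = 1\<close> the square of \<open>h 0 0\<close> cancels, so a small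
    \<open>h 1 1\<close> makes the cross term dominate. At \<open>h 1 1 = 1/4\<close> the form is
    \<open>1/16 - 1/8\<close>.\<close>
  let ?h = "\<lambda>a i::nat. if a = 0 \<and> i = 0 then 1 else if a = 1 \<and> i = 1 then 1/4 else 0 :: complex"
  assume "\<forall>h. 0 \<le> complex_of_real ((cmod (h 0 0))\<^sup>2 + (cmod (h 0 1))\<^sup>2 + (cmod (h 1 0))\<^sup>2 + (cmod (h 1 1))\<^sup>2
      - 1 * 1 * (cmod (h 0 0))\<^sup>2 - 2 * (1/2 * (1/2)) * (Re (h 1 1 * cnj (h 0 0)) + Re (h (1::nat) (0::nat) * cnj (h 0 1))))"
  from this[THEN spec, of ?h] show False by (simp add: complex_nonneg_iff power2_eq_square)
qed

lemma two_by_two_in_ball_D: "two_by_two p1 p2 (9/10) (13/20) \<in> ball_D"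
  unfolding two_by_two_in_ball_D_iff tensor_le_def two_by_two_tensor_form
proof
  fix h :: "nat \<Rightarrow> nat \<Rightarrow> complex"
  have Re_le: "2 * Re (x * cnj y) \<le> u * (cmod x)\<^sup>2 + v * (cmod y)\<^sup>2" if "1 \<le> u * v" "0 < u" for x y u v
  proof -
    have "2 * Re (x * cnj y) \<le> 2 * (cmod x * cmod y)"
      using complex_Re_le_cmod[of "x * cnj y"] by (simp add: norm_mult)
    also have "\<dots> \<le> u * (cmod x)\<^sup>2 + (cmod y)\<^sup>2 / u"
    proof -
      have "0 \<le> (u * cmod x - cmod y)\<^sup>2 / u" using that(2) by simp
      also have "\<dots> = u * (cmod x)\<^sup>2 + (cmod y)\<^sup>2 / u - 2 * (cmod x * cmod y)"
        using that(2) by (simp add: power2_eq_square field_simps)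
      finally show ?thesis by simp
    qed
    also have "(cmod y)\<^sup>2 / u \<le> v * (cmod y)\<^sup>2"
    proof -
      have "1 / u \<le> v" using that by (simp add: field_simps)
      from mult_right_mono[OF this, of "(cmod y)\<^sup>2"] show ?thesis by simp
    qed
    finally show ?thesis by simp
  qed
  \<comment> \<open>The weights are \<open>1 / c^2\<close> and \<open>(1 - t^2) / c^2\<close> for
    \<open>t = 9/10\<close> and \<open>c = 13/20\<close>. Multiplied by \<open>c^2\<close> they use
    up exactly the squares at hand, and their product is at least 1 because
    \<open>t^2 + c^4 <= 1\<close>.\<close>
  have "2 * Re (h 1 1 * cnj (h 0 0)) \<le> 400/169 * (cmod (h 1 1))\<^sup>2 + 76/169 * (cmod (h 0 0))\<^sup>2"
    by (rule Re_le) auto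
  moreover have "2 * Re (h 1 0 * cnj (h 0 1)) \<le> 1 * (cmod (h 1 0))\<^sup>2 + 1 * (cmod (h 0 1))\<^sup>2"
    by (rule Re_le) auto
  moreover have "0 \<le> (cmod (h 1 0))\<^sup>2" "0 \<le> (cmod (h 0 1))\<^sup>2" "0 \<le> (cmod (h 0 0))\<^sup>2" by auto
  ultimately have "0 \<le> (cmod (h 0 0))\<^sup>2 + (cmod (h 0 1))\<^sup>2 + (cmod (h 1 0))\<^sup>2 + (cmod (h 1 1))\<^sup>2
      - 9/10 * (9/10) * (cmod (h 0 0))\<^sup>2
      - 2 * (13/20 * (13/20)) * (Re (h 1 1 * cnj (h 0 0)) + Re (h 1 0 * cnj (h 0 1)))"
    unfolding distrib_left by linarith
  then show "0 \<le> complex_of_real ((cmod (h 0 0))\<^sup>2 + (cmod (h 0 1))\<^sup>2 + (cmod (h 1 0))\<^sup>2 + (cmod (h 1 1))\<^sup>2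
      - 9/10 * (9/10) * (cmod (h 0 0))\<^sup>2
      - 2 * (13/20 * (13/20)) * (Re (h 1 1 * cnj (h 0 0)) + Re (h 1 0 * cnj (h 0 1))))"
    by (simp only: complex_nonneg_iff Re_complex_of_real Im_complex_of_real)
qed

lemma two_by_two_notin_Lehner:
  assumes d: "2 \<le> CARD('d)" and tc: "1 - t < c\<^sup>2 / 4"
  shows "two_by_two p1 p2 t c \<notin> Lehner_ball"
proof
  \<comment> \<open>Against \<open>two_by_two p1 p2 1 (1/2)\<close> the form at
    \<open>h 0 0 = 1\<close> and real \<open>h 1 1 = x\<close> is
    \<open>1 - t + x^2 - c * x\<close>, which is minimal at \<open>x = c/2\<close>.\<close>
  let ?h = "\<lambda>a i::nat. if a = 0 \<and> i = 0 then 1 else if a = 1 \<and> i = 1 then of_real (c/2) else 0 :: complex"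
  assume "two_by_two p1 p2 t c \<in> Lehner_ball"
  then have "tensor_le 2 2 (two_by_two p1 p2 t c) (two_by_two p1 p2 1 (1/2))"
    using Lehner_tensor_range two_by_two_level two_by_two_in_range[OF d] by blast
  from this[unfolded tensor_le_def two_by_two_tensor_form, THEN spec, of ?h]
  have "0 \<le> 1 + (c/2)\<^sup>2 - t - 2 * (c * (1/2)) * (c/2)"
    by (simp add: complex_nonneg_iff power_divide)
  with tc show False by (simp add: power2_eq_square)
qed

text \<open>The row operator is no contraction here, as \<open>t^2 + c^2 = 1.06\<close>, so the
  argument for \<open>ball_B\<close> breaks down. The two components are estimated with different
  weights instead.\<close>

lemma two_by_two_in_Lehner: "two_by_two p1 p2 (9/10) (1/2) \<in> Lehner_ball"
proof -
  let ?X = "two_by_two p1 p2 (9/10) (1/2)"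
  have "(\<Sum>a<2. inner (creation_row ?X 2 h a) (h a)) \<le> (\<Sum>a<2. (norm (h a))\<^sup>2)" for h :: "nat \<Rightarrow> 'd fock"
  proof -
    let ?g = "creation_row ?X 2 h"
    have row: "(norm (?g a))\<^sup>2 = (norm (\<Sum>b<2. ?X p1 $$ (a, b) *\<^sub>C h b))\<^sup>2 + (norm (\<Sum>b<2. ?X p2 $$ (a, b) *\<^sub>C h b))\<^sup>2"
      if "a < 2" for a
      unfolding norm_creation_row
      by (rule sum_pair[OF p12]) (simp add: two_by_two_other that)
    have g0: "(norm (?g 0))\<^sup>2 = 81/100 * (norm (h 0))\<^sup>2 + 1/4 * (norm (h 1))\<^sup>2"
      using row[of 0] by (simp add: numeral_2_eq_2 two_by_two_index norm_scaleC power_mult_distrib power2_eq_square)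
    have g1: "(norm (?g 1))\<^sup>2 = 1/4 * (norm (h 0))\<^sup>2"
      using row[of 1] by (simp add: numeral_2_eq_2 two_by_two_index norm_scaleC power_mult_distrib power2_eq_square)
    have "2 * inner (?g 0) (h 0) \<le> (norm (?g 0))\<^sup>2 + (norm (h 0))\<^sup>2" by (rule two_inner_le)
    \<comment> \<open>The bound on component 0 already uses 1/8 of the square of
      \<open>norm (h 1)\<close>. The weight \<open>4/7\<close> makes component 1 use the remaining
      7/8; the square of \<open>norm (h 0)\<close> then gets
      \<open>181/200 + 1/14 < 1\<close>.\<close>
    moreover have "2 * inner ((4/7) *\<^sub>R ?g 1) (h 1) \<le> (norm ((4/7) *\<^sub>R ?g 1))\<^sup>2 + (norm (h 1))\<^sup>2" by (rule two_inner_le)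
    then have "8/7 * inner (?g 1) (h 1) \<le> 16/49 * (norm (?g 1))\<^sup>2 + (norm (h 1))\<^sup>2"
      by (simp add: power_mult_distrib power2_eq_square)
    moreover have "0 \<le> (norm (h 0))\<^sup>2" "0 \<le> (norm (h 1))\<^sup>2" by auto
    ultimately have "inner (?g 0) (h 0) + inner (?g 1) (h 1) \<le> (norm (h 0))\<^sup>2 + (norm (h 1))\<^sup>2"
      unfolding g0 g1 by linarith
    then show ?thesis by (simp add: numeral_2_eq_2)
  qed
  then show ?thesis by (subst Lehner_ball_iff[OF two_by_two_level]) auto
qed

section \<open>The arrow tuple\<close>

lemma arrow_tuple_level: "arrow_tuple p1 p2 \<in> msa_level 3"
  unfolding msa_level_iff by (auto simp: arrow_tuple_def insert_commute)

lemma arrow_tuple_index: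
  "arrow_tuple p1 p2 p1 $$ (0, 0) = 0" "arrow_tuple p1 p2 p1 $$ (0, Suc 0) = 1"
  "arrow_tuple p1 p2 p1 $$ (0, Suc (Suc 0)) = 0"
  "arrow_tuple p1 p2 p1 $$ (Suc 0, 0) = 1" "arrow_tuple p1 p2 p1 $$ (Suc 0, Suc 0) = 0"
  "arrow_tuple p1 p2 p1 $$ (Suc 0, Suc (Suc 0)) = 0"
  "arrow_tuple p1 p2 p1 $$ (Suc (Suc 0), 0) = 0" "arrow_tuple p1 p2 p1 $$ (Suc (Suc 0), Suc 0) = 0"
  "arrow_tuple p1 p2 p1 $$ (Suc (Suc 0), Suc (Suc 0)) = 0"
  "arrow_tuple p1 p2 p2 $$ (0, 0) = 0" "arrow_tuple p1 p2 p2 $$ (0, Suc 0) = 0"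
  "arrow_tuple p1 p2 p2 $$ (0, Suc (Suc 0)) = 1"
  "arrow_tuple p1 p2 p2 $$ (Suc 0, 0) = 0" "arrow_tuple p1 p2 p2 $$ (Suc 0, Suc 0) = 0"
  "arrow_tuple p1 p2 p2 $$ (Suc 0, Suc (Suc 0)) = 0"
  "arrow_tuple p1 p2 p2 $$ (Suc (Suc 0), 0) = 1" "arrow_tuple p1 p2 p2 $$ (Suc (Suc 0), Suc 0) = 0"
  "arrow_tuple p1 p2 p2 $$ (Suc (Suc 0), Suc (Suc 0)) = 0"
  using p12 by (auto simp: arrow_tuple_def doubleton_eq_iff)

lemma arrow_tuple_other:
  "p \<noteq> p1 \<Longrightarrow> p \<noteq> p2 \<Longrightarrow> a < 3 \<Longrightarrow> b < 3 \<Longrightarrow> arrow_tuple p1 p2 p $$ (a, b) = 0"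
  by (simp add: arrow_tuple_def)

lemma arrow_tuple_in_polar: "arrow_tuple p1 p2 \<in> polar_dual ball_B"
proof -
  have "tensor_le 3 m (arrow_tuple p1 p2) Y" if Y: "Y \<in> ball_B" "Y \<in> msa_level m" for Y m
    unfolding tensor_le_def
  proof
    fix h :: "nat \<Rightarrow> nat \<Rightarrow> complex"
    have m: "1 \<le> m"
    proof -
      have "Y \<in> msa" using Y(1) by (simp add: ball_B_def)
      then obtain k where "1 \<le> k" "Y \<in> msa_level k" by (rule msaE)
      then show ?thesis using msa_level_unique[OF _ Y(2)] by blast
    qed
    define w where "w p i = (\<Sum>j<m. Y p $$ (i, j) * h 0 j)" for p i
    have cw: "cnj (w p j) = (\<Sum>i<m. Y p $$ (i, j) * cnj (h 0 i))" if "j < m" for p j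
      using that by (simp add: w_def cnj_sum msa_levelD[OF Y(2)])
    have s: "(\<Sum>p\<in>UNIV. arrow_tuple p1 p2 p $$ (a, b) * Y p $$ (i, j)) =
        arrow_tuple p1 p2 p1 $$ (a, b) * Y p1 $$ (i, j) + arrow_tuple p1 p2 p2 $$ (a, b) * Y p2 $$ (i, j)"
      if "a < 3" "b < 3" for a b i j
      by (rule sum_pair[OF p12]) (simp add: arrow_tuple_other that)
    have diag: "(\<Sum>i<m. \<Sum>j<m. (if i = j then 1 else 0) * h a j * cnj (h a i)) = (\<Sum>i<m. h a i * cnj (h a i))" for a
    proof (rule sum.cong[OF refl])
      fix i assume "i \<in> {..<m}"
      then have "(\<Sum>j<m. (if i = j then 1 else 0) * h a j * cnj (h a i)) = (\<Sum>j<m. if j = i then h a i * cnj (h a i) else 0)"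
        by (intro sum.cong) auto
      with \<open>i \<in> {..<m}\<close> show "(\<Sum>j<m. (if i = j then 1 else 0) * h a j * cnj (h a i)) = h a i * cnj (h a i)" by simp
    qed
    have low: "(\<Sum>i<m. \<Sum>j<m. Y p $$ (i, j) * h 0 j * cnj (h a i)) = (\<Sum>i<m. w p i * cnj (h a i))" for p a
      by (simp add: w_def sum_distrib_right)
    have up: "(\<Sum>i<m. \<Sum>j<m. Y p $$ (i, j) * h a j * cnj (h 0 i)) = (\<Sum>j<m. h a j * cnj (w p j))" for p a
      by (subst sum.swap) (simp add: cw sum_distrib_left ac_simps)
    have "bform 3 m (\<lambda>a b i j. (if a = b \<and> i = j then 1 else 0) -
          (\<Sum>p\<in>UNIV. arrow_tuple p1 p2 p $$ (a, b) * Y p $$ (i, j))) h =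
        (\<Sum>i<m. h 0 i * cnj (h 0 i)) + (\<Sum>i<m. h 1 i * cnj (h 1 i)) + (\<Sum>i<m. h 2 i * cnj (h 2 i))
        - (\<Sum>j<m. h 1 j * cnj (w p1 j)) - (\<Sum>i<m. w p1 i * cnj (h 1 i))
        - (\<Sum>j<m. h 2 j * cnj (w p2 j)) - (\<Sum>i<m. w p2 i * cnj (h 2 i))"
      unfolding low[symmetric] up[symmetric] diag[symmetric]
      by (simp add: bform_def numeral_2_eq_2 numeral_3_eq_3 s arrow_tuple_index sum_negf)
    \<comment> \<open>Completing the squares in \<open>h 1\<close> and \<open>h 2\<close> leaves the
      squared norm of \<open>h 0\<close> minus those of the \<open>Y p\<close> applied to
      \<open>h 0\<close>, which is nonnegative for \<open>Y\<close> in
      \<open>ball_B\<close>.\<close>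
    also have "\<dots> = (\<Sum>i<m. h 0 i * cnj (h 0 i)) - (\<Sum>i<m. w p1 i * cnj (w p1 i)) - (\<Sum>i<m. w p2 i * cnj (w p2 i))
        + (\<Sum>i<m. (h 1 i - w p1 i) * cnj (h 1 i - w p1 i)) + (\<Sum>i<m. (h 2 i - w p2 i) * cnj (h 2 i - w p2 i))"
      by (simp add: algebra_simps sum.distrib sum_subtractf)
    also have "\<dots> = of_real ((\<Sum>i<m. (cmod (h 0 i))\<^sup>2) - (\<Sum>i<m. (cmod (w p1 i))\<^sup>2) - (\<Sum>i<m. (cmod (w p2 i))\<^sup>2)
        + (\<Sum>i<m. (cmod (h 1 i - w p1 i))\<^sup>2) + (\<Sum>i<m. (cmod (h 2 i - w p2 i))\<^sup>2))"
      by (simp only: of_real_add of_real_diff of_real_sum complex_norm_square)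
    finally have eq: "bform 3 m (\<lambda>a b i j. (if a = b \<and> i = j then 1 else 0) -
          (\<Sum>p\<in>UNIV. arrow_tuple p1 p2 p $$ (a, b) * Y p $$ (i, j))) h = \<dots>" .
    have "(\<Sum>i<m. (cmod (w p1 i))\<^sup>2) + (\<Sum>i<m. (cmod (w p2 i))\<^sup>2) = (\<Sum>p\<in>{p1, p2}. \<Sum>i<m. (cmod (w p i))\<^sup>2)"
      using p12 by simp
    also have "\<dots> \<le> (\<Sum>p\<in>UNIV. \<Sum>i<m. (cmod (w p i))\<^sup>2)"
      by (rule sum_mono2) (auto intro: sum_nonneg)
    also have "\<dots> \<le> (\<Sum>i<m. (cmod (h 0 i))\<^sup>2)"
      unfolding w_def using Y ball_B_iff_norm[OF Y(2) m] by blast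
    finally have "0 \<le> (\<Sum>i<m. (cmod (h 0 i))\<^sup>2) - (\<Sum>i<m. (cmod (w p1 i))\<^sup>2) - (\<Sum>i<m. (cmod (w p2 i))\<^sup>2)
        + (\<Sum>i<m. (cmod (h 1 i - w p1 i))\<^sup>2) + (\<Sum>i<m. (cmod (h 2 i - w p2 i))\<^sup>2)"
      by (smt (verit) sum_nonneg zero_le_power2)
    then show "0 \<le> bform 3 m (\<lambda>a b i j. (if a = b \<and> i = j then 1 else 0) -
          (\<Sum>p\<in>UNIV. arrow_tuple p1 p2 p $$ (a, b) * Y p $$ (i, j))) h"
      unfolding eq by (simp only: complex_nonneg_iff Re_complex_of_real Im_complex_of_real)
  qed
  then show ?thesis using polar_dual_iff[OF arrow_tuple_level] by auto
qed

text \<open>The pairing of a tuple \<open>X\<close> with the arrow tuple is at most \<open>I\<close> only if \<open>\<Sum>\<^sub>i X\<^sub>i\<^sup>2 \<le> I\<close>;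
  the vector below detects that this fails for an element of the Lehner ball.\<close>

lemma arrow_tuple_notin_range: "arrow_tuple p1 p2 \<notin> matrix_range half_semicircular"
proof
  let ?X = "two_by_two p1 p2 (9/10) (1/2)"
  \<comment> \<open>With \<open>e\<close> the first basis vector, this is the triple
    \<open>e, X_p1 e, X_p2 e\<close>, which minimises the arrow form for fixed first entry. Its
    value is \<open>1 - 81/100 - 1/4 < 0\<close>.\<close>
  let ?h = "\<lambda>a i::nat. if a = 0 \<and> i = 0 then 1 else if a = 0 \<and> i = 1 then 9/10
    else if a = 1 \<and> i = 2 then 1/2 else 0 :: complex"
  assume "arrow_tuple p1 p2 \<in> matrix_range half_semicircular"
  then have "tensor_le 2 3 ?X (arrow_tuple p1 p2)"
    using Lehner_tensor_range[OF two_by_two_in_Lehner two_by_two_level _ arrow_tuple_level] by blast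
  then have "0 \<le> bform 2 3 (\<lambda>a b i j. (if a = b \<and> i = j then 1 else 0) -
      (\<Sum>p\<in>UNIV. ?X p $$ (a, b) * arrow_tuple p1 p2 p $$ (i, j))) ?h"
    unfolding tensor_le_def by blast
  moreover have s: "(\<Sum>p\<in>UNIV. ?X p $$ (a, b) * arrow_tuple p1 p2 p $$ (i, j)) =
      ?X p1 $$ (a, b) * arrow_tuple p1 p2 p1 $$ (i, j) + ?X p2 $$ (a, b) * arrow_tuple p1 p2 p2 $$ (i, j)"
    if "a < 2" "b < 2" for a b i j
    by (rule sum_pair[OF p12]) (simp add: two_by_two_other that)
  ultimately show False
    by (simp add: bform_def numeral_2_eq_2 numeral_3_eq_3 s two_by_two_index arrow_tuple_index complex_nonneg_iff)
qed

end

theorem theorem5p4: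
  assumes "CARD('d::finite) \<ge> 2"
  shows
    "(Wmin (cball 0 1 :: (real ^ 'd) set) \<subseteq> ball_B
      \<and> (ball_B :: ('d \<Rightarrow> complex mat) set) \<subset> Lehner_ball
      \<and> (Lehner_ball :: ('d \<Rightarrow> complex mat) set) \<subset> polar_dual ball_B
      \<and> polar_dual ball_B \<subseteq> Wmax (cball 0 1 :: (real ^ 'd) set))
   \<and> (Wmin (cball 0 1 :: (real ^ 'd) set) \<subseteq> ball_B
      \<and> ball_B \<subset> matrix_range (half_semicircular :: 'd \<Rightarrow> _)
      \<and> matrix_range (half_semicircular :: 'd \<Rightarrow> _) \<subset> polar_dual ball_B
      \<and> polar_dual ball_B \<subseteq> Wmax (cball 0 1 :: (real ^ 'd) set))
   \<and> \<not> matrix_range (half_semicircular :: 'd \<Rightarrow> _) \<subseteq> ball_D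
   \<and> \<not> (ball_D :: ('d \<Rightarrow> complex mat) set) \<subseteq> Lehner_ball"
proof -
  obtain p1 p2 :: 'd where p12: "p1 \<noteq> p2"
    using obtain_two_elements[OF assms] .
  let ?X = "two_by_two p1 p2"
  \<comment> \<open>This one element of the matrix range separates three pairs: the matrix range
    from \<open>ball_B\<close>, the polar dual from the Lehner ball, and the matrix range from
    \<open>ball_D\<close>.\<close>
  have range: "?X 1 (1/2) \<in> matrix_range half_semicircular"
    by (rule two_by_two_in_range[OF p12 assms])
  have "?X (9/10) (1/2) \<in> Lehner_ball" "?X (9/10) (1/2) \<notin> ball_B"
    by (rule two_by_two_in_Lehner[OF p12], rule two_by_two_notin_ball_B[OF p12])
       (simp add: power2_eq_square)
  then have 1: "(ball_B :: ('d \<Rightarrow> complex mat) set) \<subset> Lehner_ball"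
    using ball_B_subset_Lehner by blast
  have "?X 1 (1/2) \<in> polar_dual ball_B" "?X 1 (1/2) \<notin> Lehner_ball"
    using range range_subset_polar two_by_two_notin_Lehner[OF p12 assms, of 1 "1/2"] by auto
  then have 2: "(Lehner_ball :: ('d \<Rightarrow> complex mat) set) \<subset> polar_dual ball_B"
    using Lehner_subset_polar[OF assms] by blast
  have "?X 1 (1/2) \<notin> ball_B"
    by (rule two_by_two_notin_ball_B[OF p12]) simp
  then have 3: "ball_B \<subset> matrix_range (half_semicircular :: 'd \<Rightarrow> _)"
    using range ball_B_subset_range[OF assms] by blast
  have 4: "matrix_range (half_semicircular :: 'd \<Rightarrow> _) \<subset> polar_dual ball_B"
    using range_subset_polar arrow_tuple_in_polar[OF p12] arrow_tuple_notin_range[OF p12] by blast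
  have 5: "\<not> matrix_range (half_semicircular :: 'd \<Rightarrow> _) \<subseteq> ball_D"
    using range two_by_two_notin_ball_D[OF p12] by blast
  \<comment> \<open>The window is narrow: \<open>t^2 + c^4\<close> is about 0.9885, just below 1,
    while \<open>1 - t = 0.1\<close> lies just below \<open>c^2 / 4 = 0.105625\<close>.\<close>
  have "?X (9/10) (13/20) \<in> ball_D" "?X (9/10) (13/20) \<notin> Lehner_ball"
    by (rule two_by_two_in_ball_D[OF p12], rule two_by_two_notin_Lehner[OF p12 assms])
       (simp add: power2_eq_square)
  then have 6: "\<not> (ball_D :: ('d \<Rightarrow> complex mat) set) \<subseteq> Lehner_ball" by blast
  show ?thesis
    using Wmin_subset_ball_B 1 2 3 4 5 6 polar_subset_Wmax by blast
qed

end
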